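(* Let $(B_\gamma(t))_{t\in[0,T]}$, $\gamma\in\Gamma=\{0,\dots,P_\eta-1\}$, be the branches of a Brownian decision tree on $[0,T]$ with branching points $0<\tau_1<\dots<\tau_\eta<T$ and offspring numbers $N_1,\dots,N_\eta\ge 1$, where $P_\eta=\prod_{j=1}^\eta N_j$, and let $$\mu_0(T)=(T-\tau_\eta)+\sum_{l=1}^{\eta}(\tau_l-\tau_{l-1})\prod_{j=l}^{\eta}N_j,\qquad \tau_0=0.$$ Then for every $c\in\mathbb{R}$, as $u\to\infty$, $$\mathbb{P}\{\exists\, t\in[0,T]\ \forall\,\gamma\in\Gamma:\ B_\gamma(t)-ct>u\}\sim \mathcal{H}_{P_\eta,1/\mu_0(T)}\;\mathbb{P}\{\forall\,\gamma\in\Gamma:\ B_\gamma(T)-cT>u\},$$ where for $\mathcal{N}\in\mathbb{N}$ and $\lambda>0$ $$\mathcal{H}_{\mathcal{N},\lambda}=\int_{\mathbb{R}^{\mathcal{N}}}\mathbb{P}\{\exists\, t\in(0,\infty)\ \forall\, i\in\{1,\dots,\mathcal{N}\}:\ \lambda B_i^*(t)-\lambda^2t>x_i\}\,e^{\sum_{i=1}^{\mathcal{N}}x_i}\,d\boldsymbol{x}$$ with $B_1^*,\dots,B_{\mathcal{N}}^*$ mutually independent standard Brownian motions on $[0,\infty)$.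
   Context: Brownian decision tree. Fix $T>0$, an integer $\eta\ge 1$, deterministic branching points $0<\tau_1<\dots<\tau_\eta<T$ and integers $N_1,\dots,N_\eta\ge 1$. Conventions: $\tau_0=0$, $\tau_{\eta+1}=T$, $P_0=1$. Put $P_i=\prod_{j=1}^iN_j$, $\Gamma=\{0,1,\dots,P_\eta-1\}$, and let $i(t)=\max\{i\in\{1,\dots,\eta\}: t>\tau_i\}$ for $t>\tau_1$, $i(t)=0$ for $t\in[0,\tau_1]$. Let $B_0^*$ be a standard one-dimensional Brownian motion and, for $i=1,\dots,\eta$, let $\boldsymbol{B}_i^*$ be a standard $\mathbb{R}^{P_i}$-valued Brownian motion (independent components), all of these being mutually independent. Define $\widetilde{\boldsymbol{B}}_\Gamma(t)=B_0^*(t)$ for $t\in[0,\tau_1]$ and, recursively for $t\in(\tau_i,\tau_{i+1}]$, let $\widetilde{\boldsymbol{B}}_\Gamma(t)\in\mathbb{R}^{P_i}$ be the vector obtained by stacking $N_i$ copies of $\widetilde{\boldsymbol{B}}_\Gamma(\tau_i)\in\mathbb{R}^{P_{i-1}}$, plus $\boldsymbol{B}_i^*(t-\tau_i)$. The branch indexed by $\gamma\in\Gamma$ is $B_\gamma(t)=(\widetilde{\boldsymbol{B}}_\Gamma(t))_{(\gamma \bmod P_{i(t)})+1}$. The notation $f(u)\sim g(u)$ means $f(u)/g(u)\to1$. (The Brownian motions in the definition of $\mathcal{H}_{\mathcal{N},\lambda}$ are unrelated to those used to construct the tree.) *)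

theory Defs
  imports "HOL-Probability.Probability"
begin

text \<open>Continuity is required of every path, not just almost every path, so that events quantifying
  over uncountably many times are measurable even if \<open>M\<close> is not complete. The second parameter of
  \<^const>\<open>normal_density\<close> is the standard deviation.\<close>

definition standard_brownian_motion :: "'a measure \<Rightarrow> (real \<Rightarrow> 'a \<Rightarrow> real) \<Rightarrow> bool" where
  "standard_brownian_motion M B \<longleftrightarrow>
     prob_space M \<and>
     (\<forall>t\<ge>0. B t \<in> borel_measurable M) \<and>
     (AE \<omega> in M. B 0 \<omega> = 0) \<and>
     (\<forall>s t. 0 \<le> s \<longrightarrow> s < t \<longrightarrow>
        distributed M lborel (\<lambda>\<omega>. B t \<omega> - B s \<omega>) (normal_density 0 (sqrt (t - s)))) \<and>
     (\<forall>n (r :: nat \<Rightarrow> real). 0 \<le> r 0 \<longrightarrow> strict_mono_on {..n} r \<longrightarrow>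
        prob_space.indep_vars M (\<lambda>_. borel) (\<lambda>j \<omega>. B (r (Suc j)) \<omega> - B (r j) \<omega>) {..<n}) \<and>
     (\<forall>\<omega>\<in>space M. continuous_on {0..} (\<lambda>t. B t \<omega>))"

text \<open>Mutual independence is that of the processes, viewed as random elements of the product space
  of real functions on \<open>[0,\<infinity>)\<close>.\<close>

definition indep_brownian_motions ::
  "'a measure \<Rightarrow> 'i set \<Rightarrow> ('i \<Rightarrow> real \<Rightarrow> 'a \<Rightarrow> real) \<Rightarrow> bool" where
  "indep_brownian_motions M I B \<longleftrightarrow>
     (\<forall>i\<in>I. standard_brownian_motion M (B i)) \<and>
     prob_space.indep_vars M (\<lambda>_. Pi\<^sub>M {0..} (\<lambda>_. borel)) (\<lambda>i \<omega>. \<lambda>t\<in>{0..}. B i t \<omega>) I"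

definition offspring_prod :: "(nat \<Rightarrow> nat) \<Rightarrow> nat \<Rightarrow> nat" where
  "offspring_prod N i = (\<Prod>j=1..i. N j)"

definition tree_level :: "nat \<Rightarrow> (nat \<Rightarrow> real) \<Rightarrow> real \<Rightarrow> nat" where
  "tree_level \<eta> \<tau> t = (if \<tau> 1 < t then Max {i \<in> {1..\<eta>}. \<tau> i < t} else 0)"

text \<open>\<open>tree_vec N \<tau> B i t \<omega> k\<close> is, for \<open>k < offspring_prod N i\<close>, the \<open>(k+1)\<close>-st component of the
  state of the tree at a time \<open>t\<close> of the \<open>i\<close>-th segment \<open>(\<tau>\<^sub>i, \<tau>\<^sub>i\<^sub>+\<^sub>1]\<close> (\<open>[0, \<tau>\<^sub>1]\<close> if \<open>i = 0\<close>), where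
  \<open>B i k\<close> is the \<open>(k+1)\<close>-st component of the driving Brownian motion of that segment. With indices
  counted from 0, the \<open>k\<close>-th component of several stacked copies of a \<open>p\<close>-dimensional vector \<open>v\<close> is
  \<open>v (k mod p)\<close>.\<close>

primrec tree_vec ::
  "(nat \<Rightarrow> nat) \<Rightarrow> (nat \<Rightarrow> real) \<Rightarrow> (nat \<Rightarrow> nat \<Rightarrow> real \<Rightarrow> 'a \<Rightarrow> real) \<Rightarrow>
   nat \<Rightarrow> real \<Rightarrow> 'a \<Rightarrow> nat \<Rightarrow> real" where
  "tree_vec N \<tau> B 0 t \<omega> = (\<lambda>k. B 0 k t \<omega>)"
| "tree_vec N \<tau> B (Suc i) t \<omega> =
     (\<lambda>k. tree_vec N \<tau> B i (\<tau> (Suc i)) \<omega> (k mod offspring_prod N i)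
          + B (Suc i) k (t - \<tau> (Suc i)) \<omega>)"

definition tree_branch ::
  "nat \<Rightarrow> (nat \<Rightarrow> nat) \<Rightarrow> (nat \<Rightarrow> real) \<Rightarrow> (nat \<Rightarrow> nat \<Rightarrow> real \<Rightarrow> 'a \<Rightarrow> real) \<Rightarrow>
   nat \<Rightarrow> real \<Rightarrow> 'a \<Rightarrow> real" where
  "tree_branch \<eta> N \<tau> B \<gamma> t \<omega> =
     (let i = tree_level \<eta> \<tau> t in tree_vec N \<tau> B i t \<omega> (\<gamma> mod offspring_prod N i))"

definition \<mu>\<^sub>0 :: "nat \<Rightarrow> (nat \<Rightarrow> nat) \<Rightarrow> (nat \<Rightarrow> real) \<Rightarrow> real \<Rightarrow> real" where
  "\<mu>\<^sub>0 \<eta> N \<tau> T =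
     (T - \<tau> \<eta>) + (\<Sum>l=1..\<eta>. (\<tau> l - \<tau> (l - 1)) * real (\<Prod>j=l..\<eta>. N j))"

text \<open>The Brownian motions \<open>W\<close> realising the constant (and their probability space) are parameters;
  the value depends only on their joint law.\<close>

definition H_const ::
  "'b measure \<Rightarrow> (nat \<Rightarrow> real \<Rightarrow> 'b \<Rightarrow> real) \<Rightarrow> nat \<Rightarrow> real \<Rightarrow> real" where
  "H_const M W n l =
     (\<integral>x. \<P>(\<omega> in M. \<exists>t>0. \<forall>i<n. l * W i t \<omega> - l\<^sup>2 * t > x i) * exp (\<Sum>i<n. x i)
        \<partial>(Pi\<^sub>M {..<n} (\<lambda>_. lborel)))"

end

theory Submission
  imports Defs "HOL-Real_Asymp.Real_Asymp"
begin

text \<open>Write \<open>n = P\<^sub>\<eta>\<close>, \<open>L = T - \<tau>\<^sub>\<eta>\<close>, \<open>\<mu> = \<mu>\<^sub>0\<close>, \<open>b = (u + cT)/\<mu>\<close> and \<open>\<kappa> = b - c\<close>. The covariance of any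
  branch at time \<open>T\<close> with the sum of all branches is \<open>\<mu>\<close>. Hence, by Cameron and Martin, adding to every
  Gaussian increment of the tree \<open>b\<close> times its variance times the number of branches that use it lifts
  every branch by \<open>b\<mu> = u + cT\<close> at \<open>T\<close> and by \<open>b(\<mu> - s)\<close> at \<open>T - s\<close> for \<open>0 \<le> s \<le> L\<close>. The likelihood
  ratio depends only on the sum of the branches at \<open>T\<close>, so that every event about the last segment is
  rewritten exactly: it gets the factor \<open>exp (-nb\<^sup>2\<mu>/2)\<close>, the weight \<open>exp (-b \<Sum>\<^sub>k B\<^sub>k(T))\<close>, and a
  threshold that no longer grows with \<open>u\<close>, namely \<open>\<kappa>s\<close> at time \<open>T - s\<close>.

  Apply this to the window \<open>[T - h, T]\<close> with \<open>h = 1/u\<close>. The state at \<open>T - h\<close> is the vector at the start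
  of the last segment plus an independent Gaussian vector, and has a bounded continuous density \<open>f\<^sub>h\<close>.
  Integrating over the state at \<open>T\<close> instead and substituting \<open>z = -B(T) = x/\<kappa>\<close> turns the probability of
  the window into
  \<open>\<kappa>\<^sup>-\<^sup>n exp (-nb\<^sup>2\<mu>/2) \<integral> exp (b/\<kappa> \<Sum>\<^sub>k x\<^sub>k) E[f\<^sub>h(-x/\<kappa> - D); \<exists>s \<le> h. \<kappa>V(s) - \<kappa>\<^sup>2s > x] dx\<close>
  where \<open>V\<close> is the last segment run backwards from \<open>T\<close> and \<open>D\<close> its total increment over the window (lemma
  \<open>window_identity\<close>). By Brownian scaling the event has the probability that \<open>\<lambda>W(r) - \<lambda>\<^sup>2r\<close> exceeds \<open>x\<close> in
  every coordinate at some \<open>r \<le> \<kappa>\<^sup>2h/\<lambda>\<^sup>2\<close>, with \<open>\<lambda> = 1/\<mu>\<close> (lemma \<open>beta_hit\<close>). As \<open>u\<close> grows, \<open>h\<close> and \<open>D\<close>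
  vanish while \<open>\<kappa>\<^sup>2h\<close> grows without bound, so the integral tends to \<open>f\<^sub>0(0)\<close> times the constant
  \<open>H\<close>. The exponential maximal inequality bounds the probability by \<open>exp (-2 \<Sum>\<^sub>k max 0 x\<^sub>k)\<close>; this gives
  the dominating function and the finiteness of the constant (lemma \<open>laplace_limit\<close>). For the
  denominator the same computation with the single time \<open>T\<close> in place of the window gives \<open>f\<^sub>0(0)\<close>.

  Outside of the window it is enough to look at the sum of the branches. Its variance grows at least
  at rate \<open>n\<close>, so the exponential maximal inequality, used with the exponent \<open>b\<close>, bounds the probability
  of success before \<open>T - h\<close> by a multiple of \<open>exp (-nb\<^sup>2\<mu>/2 - nh(b\<^sup>2/2 - cb))\<close>. With \<open>h = 1/u\<close> the second part
  decays exponentially in \<open>u\<close>, and so beats the factor \<open>\<kappa>\<^sup>n\<close> (lemma \<open>out_event_bound\<close>). The window, however,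
  still contains all of the Pickands scale \<open>u\<^sup>-\<^sup>2\<close>.

  Events about a continuum of times are reached from dyadic grids, which path continuity and strict
  inequalities permit; on a grid only finitely many independent Gaussian increments matter.\<close>

section \<open>Gaussian measures on finite products\<close>

abbreviation vecs :: "nat \<Rightarrow> (nat \<Rightarrow> real) measure" where
  "vecs n \<equiv> Pi\<^sub>M {..<n} (\<lambda>_. borel)"

abbreviation steps :: "nat \<Rightarrow> nat \<Rightarrow> (nat \<times> nat) set" where
  "steps n m \<equiv> {..<n} \<times> {..<m}"

abbreviation incs :: "nat \<Rightarrow> nat \<Rightarrow> (nat \<times> nat \<Rightarrow> real) measure" where
  "incs n m \<equiv> Pi\<^sub>M (steps n m) (\<lambda>_. borel)"

text \<open>The centred normal law with variance \<open>v\<close>. For \<open>v = 0\<close> it is the point mass at 0, so that the value of a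
  Brownian motion at a starting time is Gaussian even if that time is 0.\<close>
definition gauss :: "real \<Rightarrow> real measure" where
  "gauss v = (if v > 0 then density lborel (\<lambda>x. ennreal (normal_density 0 (sqrt v) x))
              else return borel 0)"

lemma sets_gauss[simp, measurable_cong]: "sets (gauss v) = sets borel"
  by (simp add: gauss_def)

lemma space_gauss[simp]: "space (gauss v) = UNIV"
  by (simp add: gauss_def)

lemma prob_space_gauss: "prob_space (gauss v)"
  by (auto simp: gauss_def intro!: prob_space_normal_density prob_space_return)

lemma product_sigma_finite_gauss: "product_sigma_finite (\<lambda>i. gauss (v i))"
  by (intro product_sigma_finite.intro prob_space_imp_sigma_finite prob_space_gauss)

text \<open>Shifting the Gaussian density by \<open>b v\<close> multiplies it by an exponential of the argument. Shifts proportional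
  to the variance make the factor \<open>b\<close> in the exponent the same for all variances.\<close>
lemma gauss_cameron_martin:
  assumes [measurable]: "F \<in> borel_measurable borel" and v: "v \<ge> 0"
  shows "(\<integral>\<^sup>+x. F x \<partial>gauss v) = (\<integral>\<^sup>+x. F (x + b * v) * ennreal (exp (- b * x - b\<^sup>2 * v / 2)) \<partial>gauss v)"
proof (cases "v > 0")
  case True
  have *: "normal_density 0 (sqrt v) (b * v + x) = normal_density 0 (sqrt v) x * exp (- b * x - b\<^sup>2 * v / 2)" for x
    using True by (simp add: normal_density_def exp_add[symmetric] field_simps power2_eq_square)
  have "(\<integral>\<^sup>+x. F x \<partial>gauss v) = (\<integral>\<^sup>+x. ennreal (normal_density 0 (sqrt v) x) * F x \<partial>lborel)"
    using True by (simp add: gauss_def nn_integral_density)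
  also have "\<dots> = (\<integral>\<^sup>+x. ennreal (normal_density 0 (sqrt v) (b * v + 1 * x)) * F (b * v + 1 * x) \<partial>lborel)"
    by (subst nn_integral_real_affine[where c=1 and t="b * v"]) auto
  also have "\<dots> = (\<integral>\<^sup>+x. ennreal (normal_density 0 (sqrt v) x) * (F (x + b * v) * ennreal (exp (- b * x - b\<^sup>2 * v / 2))) \<partial>lborel)"
    unfolding mult_1 * ennreal_mult'[OF normal_density_nonneg] by (simp add: ac_simps)
  also have "\<dots> = (\<integral>\<^sup>+x. F (x + b * v) * ennreal (exp (- b * x - b\<^sup>2 * v / 2)) \<partial>gauss v)"
    using True by (simp add: gauss_def nn_integral_density)
  finally show ?thesis .
next
  case False
  with v have "v = 0" by simp
  then show ?thesis by (simp add: gauss_def nn_integral_return)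
qed

lemma gauss_exp_moment:
  assumes "v \<ge> 0"
  shows "(\<integral>\<^sup>+x. ennreal (exp (b * x - b\<^sup>2 * v / 2)) \<partial>gauss v) = 1"
proof -
  interpret prob_space "gauss v" by (rule prob_space_gauss)
  have "1 = (\<integral>\<^sup>+x. 1 \<partial>gauss v)" using emeasure_space_1 by simp
  also have "\<dots> = (\<integral>\<^sup>+x. 1 * ennreal (exp (- (-b) * x - (-b)\<^sup>2 * v / 2)) \<partial>gauss v)"
    by (rule gauss_cameron_martin) (use assms in auto)
  finally show ?thesis by simp
qed

text \<open>Since the shifts are proportional to the variances, the likelihood ratio depends on the vector only through
  the sum of its coordinates. Both sides define measures that agree on boxes.\<close>
lemma PiM_gauss_cameron_martin:
  fixes v :: "'i \<Rightarrow> real"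
  assumes J: "finite J" and v: "\<And>j. j \<in> J \<Longrightarrow> v j \<ge> 0"
    and F[measurable]: "F \<in> borel_measurable (Pi\<^sub>M J (\<lambda>_. borel))"
  shows "(\<integral>\<^sup>+x. F x \<partial>Pi\<^sub>M J (\<lambda>j. gauss (v j)))
    = (\<integral>\<^sup>+x. F (\<lambda>j\<in>J. x j + b * v j) * ennreal (exp (- b * (\<Sum>j\<in>J. x j) - b\<^sup>2 * (\<Sum>j\<in>J. v j) / 2))
        \<partial>Pi\<^sub>M J (\<lambda>j. gauss (v j)))"
proof -
  interpret product_sigma_finite "\<lambda>j. gauss (v j)" by (rule product_sigma_finite_gauss)
  let ?N = "Pi\<^sub>M J (\<lambda>j. gauss (v j))"
  let ?w = "\<lambda>x. ennreal (exp (- b * (\<Sum>j\<in>J. x j) - b\<^sup>2 * (\<Sum>j\<in>J. v j) / 2))"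
  let ?s = "\<lambda>x. \<lambda>j\<in>J. x j + b * v j"
  have s_N: "sets ?N = sets (Pi\<^sub>M J (\<lambda>_. borel))" by (intro sets_PiM_cong) auto
  note [measurable_cong] = s_N
  have w_eq: "?w x = (\<Prod>j\<in>J. ennreal (exp (- b * x j - b\<^sup>2 * v j / 2)))" for x
    by (subst prod_ennreal)
       (auto simp: exp_sum[OF J, symmetric] sum_subtractf sum_distrib_left sum_divide_distrib)
  have "distr (density ?N ?w) (Pi\<^sub>M J (\<lambda>_. borel)) ?s = ?N"
  proof (rule PiM_eqI[OF J])
    fix A assume A: "\<And>i. i \<in> J \<Longrightarrow> A i \<in> sets (gauss (v i))"
    then have A': "\<And>i. i \<in> J \<Longrightarrow> A i \<in> sets borel" by simp
    have PA[measurable]: "Pi\<^sub>E J A \<in> sets (Pi\<^sub>M J (\<lambda>_. borel))" by (intro sets_PiM_I_finite J A')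
    have "emeasure (distr (density ?N ?w) (Pi\<^sub>M J (\<lambda>_. borel)) ?s) (Pi\<^sub>E J A)
      = (\<integral>\<^sup>+x. indicator (Pi\<^sub>E J A) x \<partial>distr (density ?N ?w) (Pi\<^sub>M J (\<lambda>_. borel)) ?s)"
      by simp
    also have "\<dots> = (\<integral>\<^sup>+x. ?w x * indicator (Pi\<^sub>E J A) (?s x) \<partial>?N)"
      by (subst nn_integral_distr) (auto simp: nn_integral_density)
    also have "\<dots> = (\<integral>\<^sup>+x. (\<Prod>j\<in>J. indicator (A j) (x j + b * v j) * ennreal (exp (- b * x j - b\<^sup>2 * v j / 2))) \<partial>?N)"
    proof (rule nn_integral_cong)
      fix x
      have "indicator (Pi\<^sub>E J A) (?s x) = (\<Prod>j\<in>J. indicator (A j) (x j + b * v j) :: ennreal)"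
        by (auto simp: indicator_def PiE_iff J prod_zero_iff)
      then show "?w x * indicator (Pi\<^sub>E J A) (?s x) = (\<Prod>j\<in>J. indicator (A j) (x j + b * v j) * ennreal (exp (- b * x j - b\<^sup>2 * v j / 2)))"
        unfolding w_eq by (simp add: prod.distrib mult.commute)
    qed
    also have "\<dots> = (\<Prod>j\<in>J. \<integral>\<^sup>+x. indicator (A j) (x + b * v j) * ennreal (exp (- b * x - b\<^sup>2 * v j / 2)) \<partial>gauss (v j))"
      using A' by (intro product_nn_integral_prod J) (measurable, auto)
    also have "\<dots> = (\<Prod>j\<in>J. emeasure (gauss (v j)) (A j))"
      using A' by (intro prod.cong refl) (subst gauss_cameron_martin[symmetric], auto simp: v)
    finally show "emeasure (distr (density ?N ?w) (Pi\<^sub>M J (\<lambda>_. borel)) ?s) (Pi\<^sub>E J A)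
      = (\<Prod>j\<in>J. emeasure (gauss (v j)) (A j))" .
  qed (simp add: s_N)
  then have "(\<integral>\<^sup>+x. F x \<partial>?N) = (\<integral>\<^sup>+x. F x \<partial>distr (density ?N ?w) (Pi\<^sub>M J (\<lambda>_. borel)) ?s)" by simp
  also have "\<dots> = (\<integral>\<^sup>+x. F (?s x) * ?w x \<partial>?N)"
    by (subst nn_integral_distr) (auto simp: nn_integral_density mult.commute)
  finally show ?thesis .
qed

abbreviation gauss_vec :: "nat \<Rightarrow> real \<Rightarrow> (nat \<Rightarrow> real) measure" where
  "gauss_vec n v \<equiv> Pi\<^sub>M {..<n} (\<lambda>_. gauss v)"

text \<open>The law of the increments of \<open>n\<close> independent Brownian motions over \<open>m\<close> consecutive intervals of length \<open>\<delta>\<close>;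
  the first index is the coordinate and the second one the interval.\<close>
abbreviation gauss_steps :: "nat \<Rightarrow> nat \<Rightarrow> real \<Rightarrow> (nat \<times> nat \<Rightarrow> real) measure" where
  "gauss_steps n m \<delta> \<equiv> Pi\<^sub>M (steps n m) (\<lambda>_. gauss \<delta>)"

lemma prob_space_gauss_steps: "prob_space (gauss_steps n m \<delta>)"
  by (intro prob_space_PiM prob_space_gauss)

text \<open>The exponential maximal inequality. Stop the martingale \<open>exp S\<^sub>j\<close> when \<open>S\<^sub>j\<close> first reaches \<open>y\<close>, and replace
  its value from then on by \<open>exp y\<close>. The resulting \<open>\<Phi>\<^sub>m\<close> has expectation at most 1, by induction on \<open>m\<close>: the new
  increments are independent of the old ones and their exponential has mean 1.\<close>
lemma gauss_steps_maximal:
  fixes \<theta> \<delta> y :: real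
  assumes A: "A \<subseteq> {..<n}" and \<delta>: "\<delta> \<ge> 0"
  shows "emeasure (gauss_steps n m \<delta>)
     {x \<in> space (gauss_steps n m \<delta>). \<exists>j\<le>m. y \<le> (\<Sum>k\<in>A. \<Sum>i<j. \<theta> * x (k, i) - \<theta>\<^sup>2 * \<delta> / 2)} \<le> ennreal (exp (- y))"
proof -
  interpret product_sigma_finite "\<lambda>_::nat\<times>nat. gauss \<delta>" by (rule product_sigma_finite_gauss)
  let ?S = "\<lambda>x j. \<Sum>k\<in>A. \<Sum>i<j. \<theta> * x (k, i) - \<theta>\<^sup>2 * \<delta> / 2"
  define \<Phi> where "\<Phi> m x = (if \<exists>j\<le>m. y \<le> ?S x j then ennreal (exp y) else ennreal (exp (?S x m)))"
    for m and x :: "nat \<times> nat \<Rightarrow> real"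
  have S_meas[measurable]: "(\<lambda>x. ?S x j) \<in> borel_measurable (gauss_steps n m \<delta>)" if "j \<le> m" for j m
    by (intro borel_measurable_sum borel_measurable_diff borel_measurable_times borel_measurable_const)
       (use that A in \<open>auto intro!: measurable_component_singleton\<close>)
  have Phi_meas[measurable]: "\<Phi> m \<in> borel_measurable (gauss_steps n m \<delta>)" for m
    unfolding \<Phi>_def by measurable
  have "(\<integral>\<^sup>+x. \<Phi> m x \<partial>gauss_steps n m \<delta>) \<le> 1"
  proof (induction m)
    case 0
    have "\<Phi> 0 x \<le> 1" for x by (auto simp: \<Phi>_def)
    then have "(\<integral>\<^sup>+x. \<Phi> 0 x \<partial>gauss_steps n 0 \<delta>) \<le> (\<integral>\<^sup>+x. 1 \<partial>gauss_steps n 0 \<delta>)"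
      by (intro nn_integral_mono) auto
    also have "\<dots> = 1" using prob_space.emeasure_space_1[OF prob_space_gauss_steps[of n 0 \<delta>]] by simp
    finally show ?case .
  next
    case (Suc m)
    let ?J = "{..<n} \<times> {m}"
    let ?c = "\<lambda>z::nat\<times>nat\<Rightarrow>real. ennreal (exp (\<Sum>k\<in>A. \<theta> * z (k, m) - \<theta>\<^sup>2 * \<delta> / 2))"
    have un: "steps n (Suc m) = steps n m \<union> ?J" by auto
    have fA: "finite A" using A finite_subset by blast
    have c1: "(\<integral>\<^sup>+z. ?c z \<partial>Pi\<^sub>M ?J (\<lambda>_. gauss \<delta>)) = 1"
    proof -
      have "?c z = (\<Prod>p\<in>?J. if fst p \<in> A then ennreal (exp (\<theta> * z p - \<theta>\<^sup>2 * \<delta> / 2)) else 1)" for z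
      proof -
        have "?c z = (\<Prod>k\<in>A. ennreal (exp (\<theta> * z (k, m) - \<theta>\<^sup>2 * \<delta> / 2)))"
          by (simp add: exp_sum[OF fA] prod_ennreal)
        also have "\<dots> = (\<Prod>k<n. if k \<in> A then ennreal (exp (\<theta> * z (k, m) - \<theta>\<^sup>2 * \<delta> / 2)) else 1)"
          using A by (intro prod.mono_neutral_cong_left) auto
        also have "\<dots> = (\<Prod>p\<in>?J. if fst p \<in> A then ennreal (exp (\<theta> * z p - \<theta>\<^sup>2 * \<delta> / 2)) else 1)"
          by (rule prod.reindex_bij_witness[of _ fst "\<lambda>k. (k, m)"]) auto
        finally show ?thesis .
      qed
      then have "(\<integral>\<^sup>+z. ?c z \<partial>Pi\<^sub>M ?J (\<lambda>_. gauss \<delta>))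
         = (\<integral>\<^sup>+z. (\<Prod>p\<in>?J. (\<lambda>x. if fst p \<in> A then ennreal (exp (\<theta> * x - \<theta>\<^sup>2 * \<delta> / 2)) else 1) (z p)) \<partial>Pi\<^sub>M ?J (\<lambda>_. gauss \<delta>))"
        by simp
      also have "\<dots> = (\<Prod>p\<in>?J. \<integral>\<^sup>+x. (if fst p \<in> A then ennreal (exp (\<theta> * x - \<theta>\<^sup>2 * \<delta> / 2)) else 1) \<partial>gauss \<delta>)"
        by (intro product_nn_integral_prod) auto
      also have "\<dots> = 1"
        using gauss_exp_moment[OF \<delta>] prob_space.emeasure_space_1[OF prob_space_gauss[of \<delta>]]
        by (intro prod.neutral ballI, case_tac "fst x \<in> A") simp_all
      finally show ?thesis .
    qed
    have le: "\<Phi> (Suc m) (merge (steps n m) ?J (x, z)) \<le>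
        (if \<exists>j\<le>m. y \<le> ?S x j then ennreal (exp y) else ennreal (exp (?S x m)) * ?c z)" (is "?l \<le> ?r") for x z
    proof -
      have eq: "?S (merge (steps n m) ?J (x, z)) j = ?S x j" if "j \<le> m" for j
        using that A by (intro sum.cong refl) (auto simp: merge_def)
      have eqS: "?S (merge (steps n m) ?J (x, z)) (Suc m) = ?S x m + (\<Sum>k\<in>A. \<theta> * z (k, m) - \<theta>\<^sup>2 * \<delta> / 2)"
      proof -
        have "?S (merge (steps n m) ?J (x, z)) (Suc m) = ?S (merge (steps n m) ?J (x, z)) m + 
          (\<Sum>k\<in>A. \<theta> * merge (steps n m) ?J (x, z) (k, m) - \<theta>\<^sup>2 * \<delta> / 2)"
          by (simp add: sum.distrib)
        also have "(\<Sum>k\<in>A. \<theta> * merge (steps n m) ?J (x, z) (k, m) - \<theta>\<^sup>2 * \<delta> / 2) = (\<Sum>k\<in>A. \<theta> * z (k, m) - \<theta>\<^sup>2 * \<delta> / 2)"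
          using A by (intro sum.cong refl) (auto simp: merge_def)
        finally show ?thesis using eq[of m] by simp
      qed
      show ?thesis
      proof (cases "\<exists>j\<le>m. y \<le> ?S x j")
        case True
        then obtain j where j: "j \<le> m" "y \<le> ?S x j" by blast
        have "\<exists>j\<le>Suc m. y \<le> ?S (merge (steps n m) ?J (x, z)) j"
          by (rule exI[of _ j]) (use j eq[OF j(1)] in simp)
        with True show ?thesis by (simp add: \<Phi>_def)
      next
        case F: False
        show ?thesis
        proof (cases "y \<le> ?S (merge (steps n m) ?J (x, z)) (Suc m)")
          case True
          then have "?l = ennreal (exp y)" unfolding \<Phi>_def by auto
          also have "\<dots> \<le> ennreal (exp (?S (merge (steps n m) ?J (x, z)) (Suc m)))"
            using True by simp
          also have "\<dots> = ?r" unfolding eqS if_not_P[OF F] by (simp add: exp_add ennreal_mult')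
          finally show ?thesis .
        next
          case False
          then have "\<not> (\<exists>j\<le>Suc m. y \<le> ?S (merge (steps n m) ?J (x, z)) j)" using F eq le_Suc_eq by auto
          then have "?l = ennreal (exp (?S (merge (steps n m) ?J (x, z)) (Suc m)))" unfolding \<Phi>_def by auto
          then show ?thesis unfolding eqS if_not_P[OF F] by (simp add: exp_add ennreal_mult')
        qed
      qed
    qed
    have c_meas: "?c \<in> borel_measurable (Pi\<^sub>M ?J (\<lambda>_. gauss \<delta>))"
      by (intro measurable_compose[OF _ measurable_ennreal] measurable_compose[OF _ borel_measurable_exp]
           borel_measurable_sum borel_measurable_diff borel_measurable_times borel_measurable_const)
         (use A in \<open>auto intro!: measurable_component_singleton\<close>)
    interpret J: prob_space "Pi\<^sub>M ?J (\<lambda>_. gauss \<delta>)" by (intro prob_space_PiM prob_space_gauss)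
    have "(\<integral>\<^sup>+x. \<Phi> (Suc m) x \<partial>gauss_steps n (Suc m) \<delta>) =
       (\<integral>\<^sup>+x. \<integral>\<^sup>+z. \<Phi> (Suc m) (merge (steps n m) ?J (x, z)) \<partial>Pi\<^sub>M ?J (\<lambda>_. gauss \<delta>) \<partial>gauss_steps n m \<delta>)"
      unfolding un by (rule product_nn_integral_fold) (auto simp: un[symmetric])
    also have "\<dots> \<le> (\<integral>\<^sup>+x. \<integral>\<^sup>+z. (if \<exists>j\<le>m. y \<le> ?S x j then ennreal (exp y) else ennreal (exp (?S x m)) * ?c z) \<partial>Pi\<^sub>M ?J (\<lambda>_. gauss \<delta>) \<partial>gauss_steps n m \<delta>)"
      by (intro nn_integral_mono le)
    also have "\<dots> = (\<integral>\<^sup>+x. \<Phi> m x \<partial>gauss_steps n m \<delta>)"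
    proof (rule nn_integral_cong)
      fix x
      show "(\<integral>\<^sup>+z. (if \<exists>j\<le>m. y \<le> ?S x j then ennreal (exp y) else ennreal (exp (?S x m)) * ?c z) \<partial>Pi\<^sub>M ?J (\<lambda>_. gauss \<delta>)) = \<Phi> m x"
      proof (cases "\<exists>j\<le>m. y \<le> ?S x j")
        case True
        then show ?thesis by (auto simp: \<Phi>_def J.emeasure_space_1)
      next
        case False
        show ?thesis unfolding \<Phi>_def if_not_P[OF False] by (simp add: nn_integral_cmult[OF c_meas] c1)
      qed
    qed
    finally show ?case using Suc by order
  qed
  moreover have "ennreal (exp y) * emeasure (gauss_steps n m \<delta>) {x \<in> space (gauss_steps n m \<delta>). \<exists>j\<le>m. y \<le> ?S x j}
      \<le> (\<integral>\<^sup>+x. \<Phi> m x \<partial>gauss_steps n m \<delta>)"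
  proof -
    have set: "{x \<in> space (gauss_steps n m \<delta>). \<exists>j\<le>m. y \<le> ?S x j} \<in> sets (gauss_steps n m \<delta>)"
      by measurable
    have "ennreal (exp y) * emeasure (gauss_steps n m \<delta>) {x \<in> space (gauss_steps n m \<delta>). \<exists>j\<le>m. y \<le> ?S x j}
      = (\<integral>\<^sup>+x. ennreal (exp y) * indicator {x \<in> space (gauss_steps n m \<delta>). \<exists>j\<le>m. y \<le> ?S x j} x \<partial>gauss_steps n m \<delta>)"
      by (rule nn_integral_cmult_indicator[OF set, symmetric])
    also have "\<dots> \<le> (\<integral>\<^sup>+x. \<Phi> m x \<partial>gauss_steps n m \<delta>)"
      by (intro nn_integral_mono) (auto simp: \<Phi>_def indicator_def)
    finally show ?thesis .
  qed
  ultimately have "ennreal (exp y) * emeasure (gauss_steps n m \<delta>) {x \<in> space (gauss_steps n m \<delta>). \<exists>j\<le>m. y \<le> ?S x j} \<le> 1"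
    by order
  then have "ennreal (exp (-y)) * (ennreal (exp y) * emeasure (gauss_steps n m \<delta>) {x \<in> space (gauss_steps n m \<delta>). \<exists>j\<le>m. y \<le> ?S x j}) \<le> ennreal (exp (-y)) * 1"
    by (rule mult_left_mono) auto
  then show ?thesis
    by (simp add: mult.assoc[symmetric] ennreal_mult'[symmetric] exp_add[symmetric])
qed

text \<open>Brownian scaling and time reversal on a grid.\<close>
lemma gauss_steps_reverse_scale:
  assumes \<delta>: "\<delta> > 0" and c: "c \<noteq> 0"
  shows "distr (gauss_steps n m \<delta>) (incs n m)
       (\<lambda>x. \<lambda>(k, i)\<in>steps n m. c * x (k, m - 1 - i)) = gauss_steps n m (c\<^sup>2 * \<delta>)"
proof -
  interpret product_sigma_finite "\<lambda>_::nat\<times>nat. gauss (c\<^sup>2 * \<delta>)" by (rule product_sigma_finite_gauss)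
  interpret G: product_sigma_finite "\<lambda>_::nat\<times>nat. gauss \<delta>" by (rule product_sigma_finite_gauss)
  have g: "emeasure (gauss (c\<^sup>2 * \<delta>)) A = emeasure (gauss \<delta>) {x. c * x \<in> A}" if [measurable]: "A \<in> sets borel" for A
  proof -
    have [measurable]: "{x. c * x \<in> A} \<in> sets borel" by measurable
    have d: "normal_density 0 (sqrt (c\<^sup>2 * \<delta>)) (c * x) * \<bar>c\<bar> = normal_density 0 (sqrt \<delta>) x" for x
      using \<delta> c by (simp add: normal_density_def real_sqrt_mult field_simps power_mult_distrib)
    have d': "ennreal \<bar>c\<bar> * (ennreal (normal_density 0 (sqrt (c\<^sup>2 * \<delta>)) (0 + c * x)) * indicator A (0 + c * x))
        = ennreal (normal_density 0 (sqrt \<delta>) x) * indicator A (c * x)" for x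
      unfolding d[symmetric] by (subst ennreal_mult') (auto simp: ac_simps)
    have "emeasure (gauss (c\<^sup>2 * \<delta>)) A = (\<integral>\<^sup>+x. ennreal (normal_density 0 (sqrt (c\<^sup>2 * \<delta>)) x) * indicator A x \<partial>lborel)"
      using \<delta> c by (simp add: gauss_def emeasure_density)
    also have "\<dots> = ennreal \<bar>c\<bar> * (\<integral>\<^sup>+x. ennreal (normal_density 0 (sqrt (c\<^sup>2 * \<delta>)) (0 + c * x)) * indicator A (0 + c * x) \<partial>lborel)"
      by (rule nn_integral_real_affine) (use c in auto)
    also have "\<dots> = (\<integral>\<^sup>+x. ennreal (normal_density 0 (sqrt \<delta>) x) * indicator A (c * x) \<partial>lborel)"
      by (subst nn_integral_cmult[symmetric], measurable) (simp only: d')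
    also have "\<dots> = emeasure (gauss \<delta>) {x. c * x \<in> A}"
      using \<delta> c by (simp add: gauss_def emeasure_density indicator_def)
    finally show ?thesis .
  qed
  show ?thesis
  proof (rule PiM_eqI)
    fix A :: "nat \<times> nat \<Rightarrow> real set" assume "\<And>p. p \<in> steps n m \<Longrightarrow> A p \<in> sets (gauss (c\<^sup>2 * \<delta>))"
    then have A[measurable]: "\<And>p. p \<in> steps n m \<Longrightarrow> A p \<in> sets borel" by simp
    let ?r = "\<lambda>(k::nat, i). (k, m - 1 - i)"
    let ?D = "\<lambda>p. {x. c * x \<in> A (?r p)}"
    have D: "?D p \<in> sets borel" if "p \<in> steps n m" for p
    proof -
      have "(\<lambda>x. c * x) -` A (?r p) \<inter> space borel \<in> sets borel"
        using that by (intro measurable_sets[OF _ A]) auto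
      then show ?thesis by (simp add: vimage_def)
    qed
    have s: "Pi\<^sub>E (steps n m) A \<in> sets (incs n m)"
      by (intro sets_PiM_I_finite) (auto intro: A)
    have f: "(\<lambda>x. \<lambda>(k, i)\<in>steps n m. c * x (k, m - 1 - i)) \<in> gauss_steps n m \<delta> \<rightarrow>\<^sub>M incs n m"
      by (intro measurable_restrict) (auto intro!: borel_measurable_times measurable_component_singleton)
    have pre: "(\<lambda>x. \<lambda>(k, i)\<in>steps n m. c * x (k, m - 1 - i)) -` Pi\<^sub>E (steps n m) A \<inter> space (gauss_steps n m \<delta>)
        = Pi\<^sub>E (steps n m) ?D" (is "?L = ?R")
    proof (rule set_eqI)
      fix x
      have *: "(\<forall>p\<in>steps n m. c * x (?r p) \<in> A p) \<longleftrightarrow> (\<forall>p\<in>steps n m. c * x p \<in> A (?r p))"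
      proof -
        have r: "?r ` steps n m = steps n m"
        proof -
          have r1: "?r p \<in> steps n m" if "p \<in> steps n m" for p using that by auto
          moreover have "p \<in> ?r ` steps n m" if "p \<in> steps n m" for p
            by (rule image_eqI[OF _ r1[OF that]]) (use that in auto)
          ultimately show ?thesis by (intro subset_antisym image_subsetI subsetI) blast+
        qed
        have "(\<forall>p\<in>steps n m. c * x (?r p) \<in> A p) \<longleftrightarrow> (\<forall>p\<in>?r ` steps n m. c * x (?r p) \<in> A p)" by (simp only: r)
        also have "\<dots> \<longleftrightarrow> (\<forall>p\<in>steps n m. c * x p \<in> A (?r p))" by auto
        finally show ?thesis .
      qed
      have "x \<in> ?L \<longleftrightarrow> x \<in> extensional (steps n m) \<and> (\<forall>p\<in>steps n m. c * x (?r p) \<in> A p)"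
        by (auto simp: space_PiM PiE_iff)
      also have "\<dots> \<longleftrightarrow> x \<in> ?R" unfolding * by (auto simp: PiE_iff)
      finally show "x \<in> ?L \<longleftrightarrow> x \<in> ?R" .
    qed
    have "emeasure (distr (gauss_steps n m \<delta>) (incs n m) (\<lambda>x. \<lambda>(k, i)\<in>steps n m. c * x (k, m - 1 - i))) (Pi\<^sub>E (steps n m) A)
       = (\<Prod>p\<in>steps n m. emeasure (gauss \<delta>) (?D p))"
      unfolding emeasure_distr[OF f s] pre by (rule G.emeasure_PiM) (use D in auto)
    also have "\<dots> = (\<Prod>p\<in>steps n m. emeasure (gauss (c\<^sup>2 * \<delta>)) (A (?r p)))"
      by (intro prod.cong refl) (subst g, auto)
    also have "\<dots> = (\<Prod>p\<in>steps n m. emeasure (gauss (c\<^sup>2 * \<delta>)) (A p))"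
      by (rule prod.reindex_bij_witness[of _ ?r ?r]) auto
    finally show "emeasure (distr (gauss_steps n m \<delta>) (incs n m) (\<lambda>x. \<lambda>(k, i)\<in>steps n m. c * x (k, m - 1 - i))) (Pi\<^sub>E (steps n m) A)
       = (\<Prod>p\<in>steps n m. emeasure (gauss (c\<^sup>2 * \<delta>)) (A p))" .
  qed (auto intro!: sets_PiM_cong)
qed

section \<open>Increments of independent Brownian motions\<close>

text \<open>The value at \<open>t\<close> counts as the increment number 0. It is the past of the grid that starts at \<open>t\<close>.\<close>
definition bm_step :: "(real \<Rightarrow> 'a \<Rightarrow> real) \<Rightarrow> real \<Rightarrow> real \<Rightarrow> nat \<Rightarrow> 'a \<Rightarrow> real" where
  "bm_step B t \<delta> j \<omega> = (case j of 0 \<Rightarrow> B t \<omega> - B 0 \<omega>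
     | Suc i \<Rightarrow> B (t + real (Suc i) * \<delta>) \<omega> - B (t + real i * \<delta>) \<omega>)"

abbreviation step_var :: "real \<Rightarrow> real \<Rightarrow> nat \<Rightarrow> real" where
  "step_var t \<delta> j \<equiv> (if j = 0 then t else \<delta>)"

lemma bm_step_path:
  assumes "t \<ge> 0" "\<delta> > 0"
  shows "bm_step B t \<delta> j \<omega> = bm_step (\<lambda>s w. w s) t \<delta> j (\<lambda>s\<in>{0..}. B s \<omega>)"
  using assms by (auto simp: bm_step_def split: nat.split)

lemma bm_step_path_measurable:
  assumes "t \<ge> 0" "\<delta> > 0"
  shows "bm_step (\<lambda>s w. w s) t \<delta> j \<in> borel_measurable (Pi\<^sub>M {0..} (\<lambda>_. borel))"
proof -
  have [measurable]: "(\<lambda>w. w s) \<in> borel_measurable (Pi\<^sub>M {0..} (\<lambda>_. borel))" if "s \<ge> 0" for s :: real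
    using that by (intro measurable_component_singleton) auto
  show ?thesis
  proof (cases j)
    case 0
    then have "bm_step (\<lambda>s w. w s) t \<delta> j = (\<lambda>w. w t - w 0)" by (simp add: bm_step_def fun_eq_iff)
    then show ?thesis using assms by simp
  next
    case (Suc i)
    then have "bm_step (\<lambda>s w. w s) t \<delta> j = (\<lambda>w. w (t + real (Suc i) * \<delta>) - w (t + real i * \<delta>))"
      by (simp add: bm_step_def fun_eq_iff)
    then show ?thesis using assms by (auto intro!: borel_measurable_diff)
  qed
qed

lemma bm_step_measurable:
  assumes "standard_brownian_motion M B" "t \<ge> 0" "\<delta> > 0"
  shows "bm_step B t \<delta> j \<in> borel_measurable M"
proof (cases j)
  case 0
  then have "bm_step B t \<delta> j = (\<lambda>w. B t w - B 0 w)" by (simp add: bm_step_def fun_eq_iff)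
  then show ?thesis using assms by (auto simp: standard_brownian_motion_def intro!: borel_measurable_diff)
next
  case (Suc i)
  then have "bm_step B t \<delta> j = (\<lambda>w. B (t + real (Suc i) * \<delta>) w - B (t + real i * \<delta>) w)"
    by (simp add: bm_step_def fun_eq_iff)
  then show ?thesis using assms by (auto simp: standard_brownian_motion_def intro!: borel_measurable_diff)
qed

lemma bm_increment_distr:
  assumes bm: "standard_brownian_motion M B" and st: "0 \<le> s" "s < t"
  shows "distr M borel (\<lambda>\<omega>. B t \<omega> - B s \<omega>) = gauss (t - s)"
proof -
  have "distributed M lborel (\<lambda>\<omega>. B t \<omega> - B s \<omega>) (normal_density 0 (sqrt (t - s)))"
    using bm st by (auto simp: standard_brownian_motion_def)
  then have "distr M lborel (\<lambda>\<omega>. B t \<omega> - B s \<omega>) = density lborel (normal_density 0 (sqrt (t - s)))"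
    by (rule distributed_distr_eq_density)
  moreover have "distr M lborel (\<lambda>\<omega>. B t \<omega> - B s \<omega>) = distr M borel (\<lambda>\<omega>. B t \<omega> - B s \<omega>)"
    by (intro distr_cong) auto
  ultimately show ?thesis using st by (simp add: gauss_def)
qed

lemma bm_step_distr:
  assumes bm: "standard_brownian_motion M B" and t: "t \<ge> 0" "\<delta> > 0"
  shows "distr M borel (bm_step B t \<delta> j) = gauss (step_var t \<delta> j)"
proof (cases j)
  case 0
  interpret prob_space M using bm by (simp add: standard_brownian_motion_def)
  have eq: "bm_step B t \<delta> j = (\<lambda>w. B t w - B 0 w)" using 0 by (simp add: bm_step_def fun_eq_iff)
  show ?thesis
  proof (cases "t = 0")
    case True
    have "distr M borel (\<lambda>_. 0 :: real) = return borel 0"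
      by (intro measure_eqI) (auto simp: emeasure_distr indicator_def emeasure_space_1)
    moreover have "bm_step B t \<delta> j = (\<lambda>_. 0)" by (subst eq) (simp add: True)
    ultimately show ?thesis using 0 True by (simp add: gauss_def)
  next
    case False
    then show ?thesis unfolding eq using 0 t bm_increment_distr[OF bm, of 0 t] by simp
  qed
next
  case (Suc i)
  have eq: "bm_step B t \<delta> j = (\<lambda>w. B (t + real (Suc i) * \<delta>) w - B (t + real i * \<delta>) w)"
    using Suc by (simp add: bm_step_def fun_eq_iff)
  show ?thesis unfolding eq using Suc t bm_increment_distr[OF bm, of "t + real i * \<delta>" "t + real (Suc i) * \<delta>"]
    by (simp add: algebra_simps)
qed

text \<open>If \<open>t > 0\<close>, then 0 is one more grid point and the increments are independent by definition. If \<open>t = 0\<close>,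
  then increment number 0 vanishes and only contributes an indicator.\<close>
lemma bm_steps_prob:
  assumes bm: "standard_brownian_motion M B" and t: "t \<ge> 0" "\<delta> > 0"
    and A: "\<And>j. j \<le> m \<Longrightarrow> A j \<in> sets borel"
  shows "measure M {\<omega> \<in> space M. \<forall>j\<le>m. bm_step B t \<delta> j \<omega> \<in> A j} = (\<Prod>j\<le>m. measure (gauss (step_var t \<delta> j)) (A j))"
proof -
  interpret prob_space M using bm by (simp add: standard_brownian_motion_def)
  have ind: "indep_vars (\<lambda>_. borel) (\<lambda>j \<omega>. B (r (Suc j)) \<omega> - B (r j) \<omega>) {..<n}"
    if "0 \<le> r 0" "strict_mono_on {..n} r" for n r
    using bm that by (auto simp: standard_brownian_motion_def)
  have pr: "prob (bm_step B t \<delta> j -` C \<inter> space M) = measure (gauss (step_var t \<delta> j)) C" if "C \<in> sets borel" for C j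
    unfolding bm_step_distr[OF bm t, symmetric]
    using that by (subst measure_distr) (auto intro: bm_step_measurable[OF bm t])
  show ?thesis
  proof (cases "t = 0")
    case False
    define r where "r = (\<lambda>j. case j of 0 \<Rightarrow> 0 | Suc i \<Rightarrow> t + real i * \<delta>)"
    have "strict_mono r"
      unfolding strict_mono_Suc_iff using t False by (auto simp: r_def split: nat.split)
    then have sm: "strict_mono_on {..Suc m} r" by (simp add: strict_mono_on_def strict_mono_def)
    have iv: "indep_vars (\<lambda>_. borel) (bm_step B t \<delta>) {..<Suc m}"
    proof -
      have "(\<lambda>j \<omega>. B (r (Suc j)) \<omega> - B (r j) \<omega>) = bm_step B t \<delta>"
        by (auto simp: fun_eq_iff bm_step_def r_def split: nat.split)
      then show ?thesis using ind[OF _ sm] by (simp add: r_def)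
    qed
    have "{\<omega> \<in> space M. \<forall>j\<le>m. bm_step B t \<delta> j \<omega> \<in> A j} = (\<Inter>j\<in>{..<Suc m}. bm_step B t \<delta> j -` A j \<inter> space M)"
      by (auto simp: less_Suc_eq_le)
    also have "prob \<dots> = (\<Prod>j\<in>{..<Suc m}. prob (bm_step B t \<delta> j -` A j \<inter> space M))"
      by (rule indep_varsD_finite[OF iv]) (use A in auto)
    also have "\<dots> = (\<Prod>j\<in>{..<Suc m}. measure (gauss (step_var t \<delta> j)) (A j))"
      by (intro prod.cong refl pr A) auto
    finally show ?thesis by (simp add: lessThan_Suc_atMost)
  next
    case True
    have iv: "indep_vars (\<lambda>_. borel) (\<lambda>j. bm_step B t \<delta> (Suc j)) {..<m}"
    proof -
      have "strict_mono (\<lambda>j. real j * \<delta>)" using t by (auto simp: strict_mono_def)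
      then have sm: "strict_mono_on {..m} (\<lambda>j. real j * \<delta>)" by (simp add: strict_mono_on_def strict_mono_def)
      have "(\<lambda>j \<omega>. B (real (Suc j) * \<delta>) \<omega> - B (real j * \<delta>) \<omega>) = (\<lambda>j. bm_step B t \<delta> (Suc j))"
        using True by (auto simp: fun_eq_iff bm_step_def split: nat.split)
      then show ?thesis using ind[OF _ sm] by simp
    qed
    have z: "bm_step B t \<delta> 0 \<omega> = 0" for \<omega> using True by (simp add: bm_step_def)
    have g0: "measure (gauss t) (A 0) = indicator (A 0) 0"
      using True A[of 0] by (simp add: gauss_def measure_return)
    have all: "(\<forall>j\<le>m. Q j) \<longleftrightarrow> Q 0 \<and> (\<forall>j<m. Q (Suc j))" for Q
      by (metis Suc_le_eq bot_nat_0.extremum not0_implies_Suc)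
    have "prob {\<omega> \<in> space M. \<forall>j<m. bm_step B t \<delta> (Suc j) \<omega> \<in> A (Suc j)} = (\<Prod>j<m. measure (gauss \<delta>) (A (Suc j)))"
    proof (cases "m = 0")
      case True then show ?thesis by (simp add: prob_space)
    next
      case False
      have "{\<omega> \<in> space M. \<forall>j<m. bm_step B t \<delta> (Suc j) \<omega> \<in> A (Suc j)} = (\<Inter>j\<in>{..<m}. bm_step B t \<delta> (Suc j) -` A (Suc j) \<inter> space M)"
        using False by (auto simp: less_Suc_eq_le)
      also have "prob \<dots> = (\<Prod>j\<in>{..<m}. prob (bm_step B t \<delta> (Suc j) -` A (Suc j) \<inter> space M))"
        by (rule indep_varsD_finite[OF iv]) (use A False in auto)
      also have "\<dots> = (\<Prod>j\<in>{..<m}. measure (gauss (step_var t \<delta> (Suc j))) (A (Suc j)))"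
        by (intro prod.cong refl pr A) auto
      finally show ?thesis by simp
    qed
    moreover have "{\<omega> \<in> space M. \<forall>j\<le>m. bm_step B t \<delta> j \<omega> \<in> A j} =
      (if 0 \<in> A 0 then {\<omega> \<in> space M. \<forall>j<m. bm_step B t \<delta> (Suc j) \<omega> \<in> A (Suc j)} else {})"
      by (auto simp: all z)
    ultimately have "prob {\<omega> \<in> space M. \<forall>j\<le>m. bm_step B t \<delta> j \<omega> \<in> A j} = indicator (A 0) 0 * (\<Prod>j<m. measure (gauss \<delta>) (A (Suc j)))"
      by (auto simp: indicator_def)
    also have "\<dots> = (\<Prod>j\<le>m. measure (gauss (step_var t \<delta> j)) (A j))"
      unfolding lessThan_Suc_atMost[symmetric] prod.lessThan_Suc_shift by (simp add: g0)
    finally show ?thesis .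
  qed
qed

text \<open>Independence between the processes and independence within each of them are combined on boxes.\<close>
lemma indep_bm_steps_distr:
  assumes ibm: "indep_brownian_motions M I B" and I: "finite I" "I \<noteq> {}"
    and t: "\<And>p. p \<in> I \<Longrightarrow> t p \<ge> 0" and \<delta>: "\<delta> > 0"
  shows "distr M (Pi\<^sub>M (I \<times> {..m}) (\<lambda>_. borel)) (\<lambda>\<omega>. \<lambda>q\<in>I \<times> {..m}. bm_step (B (fst q)) (t (fst q)) \<delta> (snd q) \<omega>)
     = Pi\<^sub>M (I \<times> {..m}) (\<lambda>q. gauss (step_var (t (fst q)) \<delta> (snd q)))"
proof -
  interpret G: product_sigma_finite "\<lambda>q. gauss (step_var (t (fst q)) \<delta> (snd q))"
    by (rule product_sigma_finite_gauss)
  have bm: "\<And>p. p \<in> I \<Longrightarrow> standard_brownian_motion M (B p)" using ibm by (auto simp: indep_brownian_motions_def)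
  obtain p0 where "p0 \<in> I" using I by auto
  then interpret prob_space M using bm by (auto simp: standard_brownian_motion_def)
  have iv: "indep_vars (\<lambda>_. Pi\<^sub>M {0..} (\<lambda>_. borel)) (\<lambda>i \<omega>. \<lambda>t\<in>{0..}. B i t \<omega>) I"
    using ibm by (auto simp: indep_brownian_motions_def)
  let ?K = "I \<times> {..m}"
  let ?X = "\<lambda>\<omega>. \<lambda>q\<in>?K. bm_step (B (fst q)) (t (fst q)) \<delta> (snd q) \<omega>"
  have Xm: "?X \<in> M \<rightarrow>\<^sub>M Pi\<^sub>M ?K (\<lambda>_. borel)"
    by (intro measurable_restrict) (auto intro!: bm_step_measurable bm t \<delta>)
  show ?thesis
  proof (rule G.PiM_eqI)
    fix A assume "\<And>q. q \<in> ?K \<Longrightarrow> A q \<in> sets (gauss (step_var (t (fst q)) \<delta> (snd q)))"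
    then have A: "\<And>q. q \<in> ?K \<Longrightarrow> A q \<in> sets borel" by simp
    have PA: "Pi\<^sub>E ?K A \<in> sets (Pi\<^sub>M ?K (\<lambda>_. borel))" by (intro sets_PiM_I_finite A) (use I in auto)
    define C where "C p = {w \<in> space (Pi\<^sub>M {0..} (\<lambda>_. borel)). \<forall>j\<in>{..m}. bm_step (\<lambda>s w. w s) (t p) \<delta> j w \<in> A (p, j)}" for p
    have C: "C p \<in> sets (Pi\<^sub>M {0..} (\<lambda>_. borel))" if "p \<in> I" for p
      unfolding C_def
    proof (rule sets.sets_Collect_finite_All)
      fix j assume "j \<in> {..m}"
      then show "{w \<in> space (Pi\<^sub>M {0..} (\<lambda>_. borel)). bm_step (\<lambda>s w. w s) (t p) \<delta> j w \<in> A (p, j)} \<in> sets (Pi\<^sub>M {0..} (\<lambda>_. borel))"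
        using measurable_sets[OF bm_step_path_measurable[OF t[OF that] \<delta>, of j] A[of "(p, j)"]] that
        by (simp add: vimage_def Int_def conj_commute)
    qed auto
    have pre: "(\<lambda>\<omega>. \<lambda>t\<in>{0..}. B p t \<omega>) -` C p \<inter> space M = {\<omega> \<in> space M. \<forall>j\<le>m. bm_step (B p) (t p) \<delta> j \<omega> \<in> A (p, j)}"
      if "p \<in> I" for p
      using bm_step_path[OF t[OF that] \<delta>, of "B p"] by (auto simp: C_def space_PiM)
    have "?X -` Pi\<^sub>E ?K A \<inter> space M = (\<Inter>p\<in>I. (\<lambda>\<omega>. \<lambda>t\<in>{0..}. B p t \<omega>) -` C p \<inter> space M)"
      using pre I by (auto simp: PiE_iff restrict_def extensional_def)
    then have "prob (?X -` Pi\<^sub>E ?K A \<inter> space M) = prob (\<Inter>p\<in>I. (\<lambda>\<omega>. \<lambda>t\<in>{0..}. B p t \<omega>) -` C p \<inter> space M)" by simp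
    also have "\<dots> = (\<Prod>p\<in>I. prob ((\<lambda>\<omega>. \<lambda>t\<in>{0..}. B p t \<omega>) -` C p \<inter> space M))"
      by (rule indep_varsD_finite[OF iv]) (use I C in auto)
    also have "\<dots> = (\<Prod>p\<in>I. \<Prod>j\<in>{..m}. measure (gauss (step_var (t p) \<delta> j)) (A (p, j)))"
      by (intro prod.cong refl) (simp add: pre, subst bm_steps_prob, auto intro!: bm t \<delta> A)
    also have "\<dots> = (\<Prod>q\<in>?K. measure (gauss (step_var (t (fst q)) \<delta> (snd q))) (A q))"
      by (subst prod.cartesian_product) (auto simp: case_prod_beta)
    finally have *: "prob (?X -` Pi\<^sub>E ?K A \<inter> space M) = (\<Prod>q\<in>?K. measure (gauss (step_var (t (fst q)) \<delta> (snd q))) (A q))" .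
    have fm: "finite_measure (gauss v)" for v using prob_space_gauss[of v] by (simp add: prob_space_def)
    have "emeasure (distr M (Pi\<^sub>M ?K (\<lambda>_. borel)) ?X) (Pi\<^sub>E ?K A) = ennreal (prob (?X -` Pi\<^sub>E ?K A \<inter> space M))"
      by (simp add: emeasure_distr[OF Xm PA] emeasure_eq_measure)
    also have "\<dots> = (\<Prod>q\<in>?K. emeasure (gauss (step_var (t (fst q)) \<delta> (snd q))) (A q))"
      unfolding * by (subst prod_ennreal[symmetric]) (auto simp: finite_measure.emeasure_eq_measure[OF fm])
    finally show "emeasure (distr M (Pi\<^sub>M ?K (\<lambda>_. borel)) ?X) (Pi\<^sub>E ?K A) = (\<Prod>q\<in>?K. emeasure (gauss (step_var (t (fst q)) \<delta> (snd q))) (A q))" .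
  qed (use I in \<open>auto intro!: sets_PiM_cong\<close>)
qed

text \<open>The form in which independence is used below: a function of some of the variables and a family of other
  ones have a product law.\<close>
lemma (in prob_space) indep_vars_split_distr:
  fixes X :: "'i \<Rightarrow> 'a \<Rightarrow> real"
  assumes ind: "indep_vars (\<lambda>_. borel) X K" and A: "A \<subseteq> K" and q: "inj_on q S" "q ` S \<subseteq> K - A" "S \<noteq> {}"
    and D: "\<And>s. s \<in> S \<Longrightarrow> distr M borel (X (q s)) = D s"
    and f[measurable]: "f \<in> Pi\<^sub>M A (\<lambda>_. borel) \<rightarrow>\<^sub>M N"
  shows "distr M (N \<Otimes>\<^sub>M Pi\<^sub>M S (\<lambda>_. borel)) (\<lambda>\<omega>. (f (\<lambda>a\<in>A. X a \<omega>), \<lambda>s\<in>S. X (q s) \<omega>))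
     = distr M N (\<lambda>\<omega>. f (\<lambda>a\<in>A. X a \<omega>)) \<Otimes>\<^sub>M Pi\<^sub>M S D"
proof -
  let ?g = "\<lambda>x. \<lambda>s\<in>S. x (q s)"
  have g: "?g \<in> Pi\<^sub>M (q ` S) (\<lambda>_. borel) \<rightarrow>\<^sub>M Pi\<^sub>M S (\<lambda>_. borel)"
    by (intro measurable_restrict measurable_component_singleton) auto
  have "indep_var (Pi\<^sub>M A (\<lambda>_. borel)) (\<lambda>\<omega>. \<lambda>a\<in>A. X a \<omega>) (Pi\<^sub>M (q ` S) (\<lambda>_. borel)) (\<lambda>\<omega>. \<lambda>a\<in>q ` S. X a \<omega>)"
    by (rule indep_var_restrict[OF ind]) (use A q in auto)
  then have rvA[measurable]: "(\<lambda>\<omega>. \<lambda>a\<in>A. X a \<omega>) \<in> M \<rightarrow>\<^sub>M Pi\<^sub>M A (\<lambda>_. borel)"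
    and rvS[measurable]: "(\<lambda>\<omega>. \<lambda>a\<in>q ` S. X a \<omega>) \<in> M \<rightarrow>\<^sub>M Pi\<^sub>M (q ` S) (\<lambda>_. borel)"
    and prod: "distr M (Pi\<^sub>M A (\<lambda>_. borel)) (\<lambda>\<omega>. \<lambda>a\<in>A. X a \<omega>) \<Otimes>\<^sub>M distr M (Pi\<^sub>M (q ` S) (\<lambda>_. borel)) (\<lambda>\<omega>. \<lambda>a\<in>q ` S. X a \<omega>)
      = distr M (Pi\<^sub>M A (\<lambda>_. borel) \<Otimes>\<^sub>M Pi\<^sub>M (q ` S) (\<lambda>_. borel)) (\<lambda>\<omega>. (\<lambda>a\<in>A. X a \<omega>, \<lambda>a\<in>q ` S. X a \<omega>))" (is "?PA \<Otimes>\<^sub>M ?PS = ?PP")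
    unfolding indep_var_distribution_eq by auto
  note g[measurable]
  interpret gS: prob_space "distr ?PS (Pi\<^sub>M S (\<lambda>_. borel)) ?g"
    by (intro prob_space.prob_space_distr prob_space_distr) (auto intro: measurable_compose[OF _ g])
  have gX: "?g (\<lambda>a\<in>q ` S. X a \<omega>) = (\<lambda>s\<in>S. X (q s) \<omega>)" for \<omega>
    by (auto simp: fun_eq_iff)
  have pm: "(\<lambda>(x, y). (f x, ?g y)) \<in> Pi\<^sub>M A (\<lambda>_. borel) \<Otimes>\<^sub>M Pi\<^sub>M (q ` S) (\<lambda>_. borel) \<rightarrow>\<^sub>M N \<Otimes>\<^sub>M Pi\<^sub>M S (\<lambda>_. borel)"
    unfolding case_prod_beta
    by (intro measurable_Pair measurable_compose[OF measurable_fst f] measurable_compose[OF measurable_snd g])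
  have "distr ?PA N f \<Otimes>\<^sub>M distr ?PS (Pi\<^sub>M S (\<lambda>_. borel)) ?g = distr (?PA \<Otimes>\<^sub>M ?PS) (N \<Otimes>\<^sub>M Pi\<^sub>M S (\<lambda>_. borel)) (\<lambda>(x, y). (f x, ?g y))"
    by (rule pair_measure_distr) (use f g in \<open>auto intro: gS.sigma_finite_measure_axioms\<close>)
  also have "\<dots> = distr M (N \<Otimes>\<^sub>M Pi\<^sub>M S (\<lambda>_. borel)) (\<lambda>\<omega>. (f (\<lambda>a\<in>A. X a \<omega>), \<lambda>s\<in>S. X (q s) \<omega>))"
    unfolding prod distr_distr[OF pm measurable_Pair[OF rvA rvS]] by (simp only: comp_def prod.case gX)
  finally have 1: "distr M N (\<lambda>\<omega>. f (\<lambda>a\<in>A. X a \<omega>)) \<Otimes>\<^sub>M distr M (Pi\<^sub>M S (\<lambda>_. borel)) (\<lambda>\<omega>. \<lambda>s\<in>S. X (q s) \<omega>)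
      = distr M (N \<Otimes>\<^sub>M Pi\<^sub>M S (\<lambda>_. borel)) (\<lambda>\<omega>. (f (\<lambda>a\<in>A. X a \<omega>), \<lambda>s\<in>S. X (q s) \<omega>))"
    unfolding distr_distr[OF g rvS] distr_distr[OF f rvA] by (simp only: comp_def gX)
  have rv: "random_variable borel (X (q s))" if "s \<in> S" for s
    using ind q(2) that by (auto simp: indep_vars_def)
  have iS: "indep_vars (\<lambda>_. borel) X (q ` S)" by (rule indep_vars_subset[OF ind]) (use q in auto)
  have lawS: "?PS = Pi\<^sub>M (q ` S) (\<lambda>a. distr M borel (X a))"
    using indep_vars_iff_distr_eq_PiM'[of "q ` S" X "\<lambda>_. borel"] iS rv q(3) by auto
  have sS: "sets (Pi\<^sub>M S (\<lambda>s. distr M borel (X (q s)))) = sets (Pi\<^sub>M S (\<lambda>_. borel))"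
    by (intro sets_PiM_cong) auto
  have "distr M (Pi\<^sub>M S (\<lambda>_. borel)) (\<lambda>\<omega>. \<lambda>s\<in>S. X (q s) \<omega>) = distr ?PS (Pi\<^sub>M S (\<lambda>_. borel)) ?g"
    unfolding distr_distr[OF g rvS] by (simp only: comp_def gX)
  also have "\<dots> = distr (Pi\<^sub>M (q ` S) (\<lambda>a. distr M borel (X a))) (Pi\<^sub>M S (\<lambda>s. distr M borel (X (q s)))) ?g"
    unfolding lawS by (intro distr_cong refl) (simp add: sS)
  also have "\<dots> = Pi\<^sub>M S (\<lambda>s. distr M borel (X (q s)))"
    by (rule distr_PiM_reindex) (use q(1) rv in \<open>auto intro: prob_space_distr\<close>)
  also have "\<dots> = Pi\<^sub>M S D" by (intro PiM_cong refl D)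
  finally show ?thesis using 1 by simp
qed

text \<open>A law on \<open>\<real>\<^sup>n\<close> that obeys the Cameron--Martin formula for shifts along the diagonal. For a Gaussian vector this says that each coordinate has covariance \<open>s\<close> with the sum of all of
  them. The laws of the tree are degenerate, so the property replaces densities and covariance matrices.\<close>
definition tilt :: "nat \<Rightarrow> real \<Rightarrow> (nat \<Rightarrow> real) measure \<Rightarrow> bool" where
  "tilt n s Q \<longleftrightarrow> sets Q = sets (vecs n) \<and>
     (\<forall>b. \<forall>F\<in>borel_measurable (vecs n).
       (\<integral>\<^sup>+x. F x \<partial>Q) = (\<integral>\<^sup>+x. F (\<lambda>k\<in>{..<n}. x k + b * s) *
          ennreal (exp (- b * (\<Sum>k<n. x k) - real n * b\<^sup>2 * s / 2)) \<partial>Q))"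

lemma tiltD:
  assumes "tilt n s Q" "F \<in> borel_measurable (vecs n)"
  shows "(\<integral>\<^sup>+x. F x \<partial>Q) = (\<integral>\<^sup>+x. F (\<lambda>k\<in>{..<n}. x k + b * s) *
          ennreal (exp (- b * (\<Sum>k<n. x k) - real n * b\<^sup>2 * s / 2)) \<partial>Q)"
  using assms unfolding tilt_def by blast

lemma tilt_sets: "tilt n s Q \<Longrightarrow> sets Q = sets (vecs n)"
  by (simp add: tilt_def)

lemma measurable_sum_lessThan[measurable]:
  "(\<lambda>x. \<Sum>k<n. x k) \<in> borel_measurable (vecs n)"
  by (intro borel_measurable_sum measurable_component_singleton) auto

lemma measurable_shift[measurable]:
  "(\<lambda>x. \<lambda>k\<in>{..<n}. x k + c) \<in> vecs n \<rightarrow>\<^sub>M vecs n"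
  by (intro measurable_restrict borel_measurable_add measurable_component_singleton borel_measurable_const)

lemma tilt_add:
  assumes Q: "tilt n s Q" and v: "v \<ge> 0"
  shows "tilt n (s + v) (distr (Q \<Otimes>\<^sub>M gauss_vec n v) (vecs n) (\<lambda>(x, g). \<lambda>k\<in>{..<n}. x k + g k))"
  unfolding tilt_def
proof (intro conjI allI ballI)
  let ?E = "vecs n" and ?G = "gauss_vec n v"
  let ?a = "\<lambda>(x, g). \<lambda>k\<in>{..<n}. x k + g k :: real"
  note [measurable_cong] = tilt_sets[OF Q]
  have [measurable_cong]: "sets ?G = sets ?E" by (intro sets_PiM_cong) auto
  interpret G: prob_space ?G by (intro prob_space_PiM prob_space_gauss)
  have a[measurable]: "?a \<in> ?E \<Otimes>\<^sub>M ?E \<rightarrow>\<^sub>M ?E"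
    unfolding case_prod_beta
    by (intro measurable_restrict borel_measurable_add measurable_compose[OF measurable_fst measurable_component_singleton]
        measurable_compose[OF measurable_snd measurable_component_singleton])
  have a'[measurable]: "(\<lambda>x. ?a (x, g)) \<in> ?E \<rightarrow>\<^sub>M ?E" if "g \<in> space ?E" for g
    using measurable_compose[OF measurable_Pair2'[OF that] a] by simp
  have a''[measurable]: "(\<lambda>g. ?a (x, g)) \<in> ?E \<rightarrow>\<^sub>M ?E" if "x \<in> space ?E" for x
    using measurable_compose[OF measurable_Pair1'[OF that] a] by simp
  fix b and F :: "(nat \<Rightarrow> real) \<Rightarrow> ennreal" assume F[measurable]: "F \<in> borel_measurable ?E"
  let ?w = "\<lambda>s x. ennreal (exp (- b * (\<Sum>k<n. x k) - real n * b\<^sup>2 * s / 2))"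
  have w[measurable]: "?w s \<in> borel_measurable ?E" for s by measurable
  let ?sh = "\<lambda>c x. \<lambda>k\<in>{..<n}. x k + c :: real"
  have sp: "space Q = space ?E" "space ?G = space ?E" using sets_eq_imp_space_eq[OF tilt_sets[OF Q]] by (auto simp: space_PiM)
  have "(\<integral>\<^sup>+x. F x \<partial>distr (Q \<Otimes>\<^sub>M ?G) ?E ?a) = (\<integral>\<^sup>+z. F (?a z) \<partial>(Q \<Otimes>\<^sub>M ?G))"
    by (rule nn_integral_distr) auto
  also have "\<dots> = (\<integral>\<^sup>+x. \<integral>\<^sup>+g. F (?a (x, g)) \<partial>?G \<partial>Q)"
    by (rule G.nn_integral_fst[symmetric]) measurable
  also have "\<dots> = (\<integral>\<^sup>+x. (\<integral>\<^sup>+g. F (?a (?sh (b * s) x, g)) \<partial>?G) * ?w s x \<partial>Q)"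
    by (subst tiltD[OF Q, of _ b]) (auto intro!: G.borel_measurable_nn_integral)
  also have "\<dots> = (\<integral>\<^sup>+x. (\<integral>\<^sup>+g. F (?sh (b * (s + v)) (?a (x, g))) * ?w (s + v) (?a (x, g)) \<partial>?G) \<partial>Q)"
  proof (rule nn_integral_cong)
    fix x assume "x \<in> space Q"
    then have x: "x \<in> space ?E" by (simp add: sp)
    have x': "?sh (b * s) x \<in> space ?E" by (rule measurable_space[OF measurable_shift x])
    have e1: "?a (?sh (b * s) x, \<lambda>j\<in>{..<n}. g j + b * v) = ?sh (b * (s + v)) (?a (x, g))" for g
      by (auto simp: fun_eq_iff algebra_simps)
    have e2: "?w s x * ennreal (exp (- b * (\<Sum>j<n. g j) - b\<^sup>2 * (\<Sum>j<n. v) / 2)) = ?w (s + v) (?a (x, g))" for g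
      by (subst ennreal_mult'[symmetric]) (auto simp: exp_add[symmetric] sum.distrib algebra_simps add_divide_distrib)
    have "(\<integral>\<^sup>+g. F (?a (?sh (b * s) x, g)) \<partial>?G)
       = (\<integral>\<^sup>+g. F (?a (?sh (b * s) x, \<lambda>j\<in>{..<n}. g j + b * v)) * ennreal (exp (- b * (\<Sum>j<n. g j) - b\<^sup>2 * (\<Sum>j<n. v) / 2)) \<partial>?G)"
      by (rule PiM_gauss_cameron_martin) (use v measurable_compose[OF a''[OF x'] F] in auto)
    then have "(\<integral>\<^sup>+g. F (?a (?sh (b * s) x, g)) \<partial>?G) * ?w s x
       = (\<integral>\<^sup>+g. F (?sh (b * (s + v)) (?a (x, g))) * ennreal (exp (- b * (\<Sum>j<n. g j) - b\<^sup>2 * (\<Sum>j<n. v) / 2)) \<partial>?G) * ?w s x"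
      unfolding e1 by simp
    also have "\<dots> = (\<integral>\<^sup>+g. F (?sh (b * (s + v)) (?a (x, g))) * ennreal (exp (- b * (\<Sum>j<n. g j) - b\<^sup>2 * (\<Sum>j<n. v) / 2)) * ?w s x \<partial>?G)"
    proof (rule nn_integral_multc[symmetric])
      have [measurable]: "(\<lambda>g. F (?sh (b * (s + v)) (?a (x, g)))) \<in> borel_measurable ?E"
        using measurable_compose[OF a''[OF x] measurable_compose[OF measurable_shift F]] by simp
      show "(\<lambda>g. F (?sh (b * (s + v)) (?a (x, g))) * ennreal (exp (- b * (\<Sum>j<n. g j) - b\<^sup>2 * (\<Sum>j<n. v) / 2))) \<in> borel_measurable ?G"
        by measurable
    qed
    also have "\<dots> = (\<integral>\<^sup>+g. F (?sh (b * (s + v)) (?a (x, g))) * ?w (s + v) (?a (x, g)) \<partial>?G)"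
      unfolding e2[symmetric] by (simp only: ac_simps)
    finally show "(\<integral>\<^sup>+g. F (?a (?sh (b * s) x, g)) \<partial>?G) * ?w s x = \<dots>" .
  qed
  also have "\<dots> = (\<integral>\<^sup>+z. F (?sh (b * (s + v)) (?a z)) * ?w (s + v) (?a z) \<partial>(Q \<Otimes>\<^sub>M ?G))"
    by (rule G.nn_integral_fst) measurable
  also have "\<dots> = (\<integral>\<^sup>+x. F (?sh (b * (s + v)) x) * ?w (s + v) x \<partial>distr (Q \<Otimes>\<^sub>M ?G) ?E ?a)"
    by (rule nn_integral_distr[symmetric]) auto
  finally show "(\<integral>\<^sup>+x. F x \<partial>distr (Q \<Otimes>\<^sub>M ?G) ?E ?a) = \<dots>" .
qed simp

lemma sum_mod_copies: "(\<Sum>k<n * N. x (k mod n)) = real N * (\<Sum>k<n. x k :: real)"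
proof (induction N)
  case (Suc N)
  have "(\<Sum>k<n * Suc N. x (k mod n)) = (\<Sum>k<n * N. x (k mod n)) + (\<Sum>k\<in>{n * N..<n * N + n}. x (k mod n))"
    by (subst sum.union_disjoint[symmetric]) (auto intro!: sum.cong)
  also have "(\<Sum>k\<in>{n * N..<n * N + n}. x (k mod n)) = (\<Sum>k<n. x k)"
    by (rule sum.reindex_bij_witness[of _ "\<lambda>k. n * N + k" "\<lambda>k. k - n * N"]) (auto simp: mod_mult_self4 le_iff_add)
  finally show ?case using Suc by (simp add: algebra_simps)
qed simp

text \<open>A tilt by \<open>b\<close> of all copies is a tilt by \<open>b N\<close> of the original vector.\<close>
lemma tilt_copies:
  assumes Q: "tilt n s Q" and n: "n > 0"
  shows "tilt (n * N) (real N * s) (distr Q (vecs (n * N)) (\<lambda>x. \<lambda>k\<in>{..<n * N}. x (k mod n)))"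
  unfolding tilt_def
proof (intro conjI allI ballI)
  let ?E = "vecs n" and ?E' = "vecs (n * N)"
  note [measurable_cong] = tilt_sets[OF Q]
  let ?c = "\<lambda>x. \<lambda>k\<in>{..<n * N}. x (k mod n) :: real"
  have c[measurable]: "?c \<in> ?E \<rightarrow>\<^sub>M ?E'"
    using n by (intro measurable_restrict measurable_component_singleton) auto
  fix b and F :: "(nat \<Rightarrow> real) \<Rightarrow> ennreal" assume F[measurable]: "F \<in> borel_measurable ?E'"
  let ?w = "\<lambda>x. ennreal (exp (- b * (\<Sum>k<n * N. x k) - real (n * N) * b\<^sup>2 * (real N * s) / 2))"
  have w[measurable]: "?w \<in> borel_measurable ?E'" by measurable
  have "(\<integral>\<^sup>+x. F x \<partial>distr Q ?E' ?c) = (\<integral>\<^sup>+x. F (?c x) \<partial>Q)" by (rule nn_integral_distr) measurable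
  also have "\<dots> = (\<integral>\<^sup>+x. F (?c (\<lambda>k\<in>{..<n}. x k + (b * real N) * s)) *
       ennreal (exp (- (b * real N) * (\<Sum>k<n. x k) - real n * (b * real N)\<^sup>2 * s / 2)) \<partial>Q)"
    by (rule tiltD[OF Q]) measurable
  also have "\<dots> = (\<integral>\<^sup>+x. F (\<lambda>k\<in>{..<n * N}. ?c x k + b * (real N * s)) * ?w (?c x) \<partial>Q)"
  proof (intro nn_integral_cong arg_cong2[where f="(*)"] arg_cong[where f=F] arg_cong[where f=ennreal] arg_cong[where f=exp])
    fix x
    show "?c (\<lambda>k\<in>{..<n}. x k + (b * real N) * s) = (\<lambda>k\<in>{..<n * N}. ?c x k + b * (real N * s))"
      using n by (auto simp: fun_eq_iff)
    have "(\<Sum>k<n * N. ?c x k) = real N * (\<Sum>k<n. x k)" using sum_mod_copies[of x n N] by simp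
    then show "- (b * real N) * (\<Sum>k<n. x k) - real n * (b * real N)\<^sup>2 * s / 2 =
        - b * (\<Sum>k<n * N. ?c x k) - real (n * N) * b\<^sup>2 * (real N * s) / 2"
      by (simp add: power2_eq_square algebra_simps)
  qed
  also have "\<dots> = (\<integral>\<^sup>+x. F (\<lambda>k\<in>{..<n * N}. x k + b * (real N * s)) * ?w x \<partial>distr Q ?E' ?c)"
    by (rule nn_integral_distr[symmetric]) measurable
  finally show "(\<integral>\<^sup>+x. F x \<partial>distr Q ?E' ?c) = \<dots>" .
qed simp

lemma tilt_zero: "tilt n 0 (return (vecs n) (\<lambda>k\<in>{..<n}. 0))"
  by (auto simp: tilt_def nn_integral_return space_PiM)

section \<open>The segments of the tree\<close>

lemma offspring_prod_Suc: "offspring_prod N (Suc i) = offspring_prod N i * N (Suc i)"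
  by (simp add: offspring_prod_def)

lemma offspring_prod_0[simp]: "offspring_prod N 0 = 1"
  by (simp add: offspring_prod_def)

text \<open>Brownian motions start at 0 only almost surely. Subtracting the initial value gives paths for which the
  branches are continuous everywhere.\<close>
definition from_zero :: "(nat \<Rightarrow> nat \<Rightarrow> real \<Rightarrow> 'a \<Rightarrow> real) \<Rightarrow> nat \<Rightarrow> nat \<Rightarrow> real \<Rightarrow> 'a \<Rightarrow> real" where
  "from_zero B i k t \<omega> = B i k t \<omega> - B i k 0 \<omega>"

text \<open>The copied vector with which segment \<open>i\<close> starts; segment 0 starts at 0.\<close>
primrec incoming ::
  "(nat \<Rightarrow> nat) \<Rightarrow> (nat \<Rightarrow> real) \<Rightarrow> (nat \<Rightarrow> nat \<Rightarrow> real \<Rightarrow> 'a \<Rightarrow> real) \<Rightarrow> nat \<Rightarrow> 'a \<Rightarrow> nat \<Rightarrow> real" where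
  "incoming N \<tau> B 0 \<omega> = (\<lambda>k. 0)"
| "incoming N \<tau> B (Suc i) \<omega> = (\<lambda>k. incoming N \<tau> B i \<omega> (k mod offspring_prod N i)
      + B i (k mod offspring_prod N i) (\<tau> (Suc i) - \<tau> i) \<omega>)"

text \<open>The covariance of one coordinate of the incoming vector with the sum of its coordinates.\<close>
primrec incoming_var :: "(nat \<Rightarrow> nat) \<Rightarrow> (nat \<Rightarrow> real) \<Rightarrow> nat \<Rightarrow> real" where
  "incoming_var N \<tau> 0 = 0"
| "incoming_var N \<tau> (Suc i) = real (N (Suc i)) * (incoming_var N \<tau> i + (\<tau> (Suc i) - \<tau> i))"

lemma tree_vec_incoming:
  assumes "\<tau> 0 = 0"
  shows "tree_vec N \<tau> B i t \<omega> k = incoming N \<tau> B i \<omega> k + B i k (t - \<tau> i) \<omega>"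
  by (induction i arbitrary: t k) (simp_all add: assms)

lemma incoming_var_eq:
  "incoming_var N \<tau> i = (\<Sum>l=1..i. (\<tau> l - \<tau> (l - 1)) * real (\<Prod>j=l..i. N j))"
proof (induction i)
  case (Suc i)
  have "(\<Sum>l=1..Suc i. (\<tau> l - \<tau> (l - 1)) * real (\<Prod>j=l..Suc i. N j))
     = (\<Sum>l=1..i. (\<tau> l - \<tau> (l - 1)) * real (\<Prod>j=l..Suc i. N j)) + (\<tau> (Suc i) - \<tau> i) * real (N (Suc i))"
    by simp
  also have "(\<Sum>l=1..i. (\<tau> l - \<tau> (l - 1)) * real (\<Prod>j=l..Suc i. N j)) = real (N (Suc i)) * incoming_var N \<tau> i"
    unfolding Suc sum_distrib_left by (intro sum.cong refl) simp
  finally show ?case by (simp add: algebra_simps)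
qed simp

lemma \<mu>\<^sub>0_incoming_var: "\<mu>\<^sub>0 \<eta> N \<tau> T = incoming_var N \<tau> \<eta> + (T - \<tau> \<eta>)"
  by (simp add: \<mu>\<^sub>0_def incoming_var_eq)

locale brownian_tree =
  fixes M :: "'a measure" and B :: "nat \<Rightarrow> nat \<Rightarrow> real \<Rightarrow> 'a \<Rightarrow> real"
    and \<eta> :: nat and N :: "nat \<Rightarrow> nat" and \<tau> :: "nat \<Rightarrow> real" and T :: real
  assumes \<eta>: "\<eta> \<ge> 1" and \<tau>0: "\<tau> 0 = 0" and \<tau>_mono: "strict_mono_on {0..\<eta>} \<tau>" and \<tau>T: "\<tau> \<eta> < T"
    and N: "\<And>j. j \<in> {1..\<eta>} \<Longrightarrow> N j \<ge> 1"
    and ibm: "indep_brownian_motions M (SIGMA i:{0..\<eta>}. {..<offspring_prod N i}) (\<lambda>(i, k). B i k)"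
begin

abbreviation "P \<equiv> offspring_prod N"
abbreviation "B' \<equiv> from_zero B"
abbreviation "X \<equiv> incoming N \<tau> B'"
abbreviation "xvar \<equiv> incoming_var N \<tau>"

definition Z :: "nat \<Rightarrow> real \<Rightarrow> 'a \<Rightarrow> nat \<Rightarrow> real" where
  "Z i t \<omega> k = X i \<omega> k + B' i k t \<omega>"

abbreviation "I \<equiv> (SIGMA i:{0..\<eta>}. {..<P i})"

lemma P_pos: "i \<le> \<eta> \<Longrightarrow> P i > 0"
proof -
  assume i: "i \<le> \<eta>"
  have "N j > 0" if "j \<in> {1..i}" for j using N[of j] i that by auto
  then show "P i > 0" by (simp add: offspring_prod_def prod_pos)
qed

lemma \<tau>_less: "i < \<eta> \<Longrightarrow> \<tau> i < \<tau> (Suc i)"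
  using \<tau>_mono by (auto simp: strict_mono_on_def)

lemma bm: "i \<le> \<eta> \<Longrightarrow> k < P i \<Longrightarrow> standard_brownian_motion M (B i k)"
  using ibm unfolding indep_brownian_motions_def by force

sublocale prob_space M
  using bm[of 0 0] by (simp add: standard_brownian_motion_def)

lemma B_measurable: "i \<le> \<eta> \<Longrightarrow> k < P i \<Longrightarrow> t \<ge> 0 \<Longrightarrow> B i k t \<in> borel_measurable M"
  using bm by (auto simp: standard_brownian_motion_def)

lemma B'_measurable: "i \<le> \<eta> \<Longrightarrow> k < P i \<Longrightarrow> t \<ge> 0 \<Longrightarrow> B' i k t \<in> borel_measurable M"
  unfolding from_zero_def[abs_def] by (intro borel_measurable_diff B_measurable) auto

lemma X_measurable: "i \<le> \<eta> \<Longrightarrow> k < P i \<Longrightarrow> (\<lambda>\<omega>. X i \<omega> k) \<in> borel_measurable M"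
proof (induction i arbitrary: k)
  case (Suc i)
  then have "P i > 0" using P_pos by simp
  then show ?case using Suc \<tau>_less[of i] by (auto intro!: borel_measurable_add B'_measurable)
qed simp

lemma Z_measurable: "i \<le> \<eta> \<Longrightarrow> k < P i \<Longrightarrow> t \<ge> 0 \<Longrightarrow> (\<lambda>\<omega>. Z i t \<omega> k) \<in> borel_measurable M"
  unfolding Z_def by (intro borel_measurable_add X_measurable B'_measurable)

lemma Xvec_measurable: "i \<le> \<eta> \<Longrightarrow> (\<lambda>\<omega>. \<lambda>k\<in>{..<P i}. X i \<omega> k) \<in> M \<rightarrow>\<^sub>M vecs (P i)"
  by (intro measurable_restrict X_measurable) auto

lemma Zvec_measurable: "i \<le> \<eta> \<Longrightarrow> t \<ge> 0 \<Longrightarrow> (\<lambda>\<omega>. \<lambda>k\<in>{..<P i}. Z i t \<omega> k) \<in> M \<rightarrow>\<^sub>M vecs (P i)"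
  by (intro measurable_restrict Z_measurable) auto

lemma B'_continuous: "i \<le> \<eta> \<Longrightarrow> k < P i \<Longrightarrow> \<omega> \<in> space M \<Longrightarrow> continuous_on {0..} (\<lambda>t. B' i k t \<omega>)"
  using bm[of i k] unfolding from_zero_def by (auto simp: standard_brownian_motion_def intro!: continuous_intros)

lemma B'_0[simp]: "B' i k 0 \<omega> = 0"
  by (simp add: from_zero_def)

text \<open>To study segment \<open>i\<close> from its time \<open>t\<close> on, the motions of the earlier segments are needed at the end of
  their segments only, and those of segment \<open>i\<close> at \<open>t\<close> and on the grid that follows.\<close>
definition start :: "nat \<Rightarrow> real \<Rightarrow> nat \<times> nat \<Rightarrow> real" where
  "start i t p = (if fst p < i then \<tau> (Suc (fst p)) - \<tau> (fst p) else if fst p = i then t else 0)"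

definition coord :: "nat \<Rightarrow> real \<Rightarrow> real \<Rightarrow> (nat \<times> nat) \<times> nat \<Rightarrow> 'a \<Rightarrow> real" where
  "coord i t \<delta> q = bm_step ((\<lambda>(i, k). B i k) (fst q)) (start i t (fst q)) \<delta> (snd q)"

lemma finite_I: "finite I" by auto
lemma I_nonempty: "I \<noteq> {}" using P_pos[of 0] by fastforce

lemma start_nonneg: "i \<le> \<eta> \<Longrightarrow> t \<ge> 0 \<Longrightarrow> start i t p \<ge> 0"
  using \<tau>_less[of "fst p"] by (auto simp: start_def)

lemma coord_distr:
  assumes "i \<le> \<eta>" "t \<ge> 0" "\<delta> > 0" "q \<in> I \<times> {..m}"
  shows "distr M borel (coord i t \<delta> q) = gauss (step_var (start i t (fst q)) \<delta> (snd q))"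
    and "coord i t \<delta> q \<in> borel_measurable M"
proof -
  have "standard_brownian_motion M ((\<lambda>(i, k). B i k) (fst q))" using assms(4) bm by auto
  then show "distr M borel (coord i t \<delta> q) = gauss (step_var (start i t (fst q)) \<delta> (snd q))"
    "coord i t \<delta> q \<in> borel_measurable M"
    using bm_step_distr start_nonneg assms bm_step_measurable unfolding coord_def by blast+
qed

lemma coord_indep:
  assumes "i \<le> \<eta>" "t \<ge> 0" "\<delta> > 0"
  shows "indep_vars (\<lambda>_. borel) (coord i t \<delta>) (I \<times> {..m})"
proof -
  have "distr M (Pi\<^sub>M (I \<times> {..m}) (\<lambda>_. borel)) (\<lambda>\<omega>. \<lambda>q\<in>I \<times> {..m}. coord i t \<delta> q \<omega>)
      = Pi\<^sub>M (I \<times> {..m}) (\<lambda>q. gauss (step_var (start i t (fst q)) \<delta> (snd q)))"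
    unfolding coord_def
    by (rule indep_bm_steps_distr[OF ibm finite_I I_nonempty start_nonneg]) (use assms in auto)
  also have "\<dots> = Pi\<^sub>M (I \<times> {..m}) (\<lambda>q. distr M borel (coord i t \<delta> q))"
    by (intro PiM_cong refl) (simp add: coord_distr[OF assms])
  finally show ?thesis
    by (subst indep_vars_iff_distr_eq_PiM') (use I_nonempty coord_distr(2)[OF assms] in auto)
qed

abbreviation past :: "nat \<Rightarrow> ((nat \<times> nat) \<times> nat) set" where
  "past i \<equiv> (SIGMA l:{..<i}. {..<P l}) \<times> {0}"

text \<open>The incoming vector as a function of finitely many coordinates. The recursion of \<^const>\<open>incoming\<close> is run on
  a family of motions that read off the coordinates and ignore the time.\<close>
abbreviation cX :: "nat \<Rightarrow> ((nat \<times> nat) \<times> nat \<Rightarrow> real) \<Rightarrow> nat \<Rightarrow> real" where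
  "cX \<equiv> incoming N \<tau> (\<lambda>l k t g. g ((l, k), 0))"

lemma cX_measurable:
  assumes "past i \<subseteq> A" "k < P i" "i \<le> \<eta>"
  shows "(\<lambda>g. cX i g k) \<in> borel_measurable (Pi\<^sub>M A (\<lambda>_. borel))"
  using assms
proof (induction i arbitrary: k)
  case (Suc i)
  have "k mod P i < P i" using P_pos[of i] Suc by simp
  moreover have "past i \<subseteq> A" using Suc.prems by auto
  ultimately have 1: "(\<lambda>g. cX i g (k mod P i)) \<in> borel_measurable (Pi\<^sub>M A (\<lambda>_. borel))"
    using Suc by auto
  have "((i, k mod P i), 0) \<in> A" using Suc.prems(1) \<open>k mod P i < P i\<close> by auto
  then have "(\<lambda>g. g ((i, k mod P i), 0)) \<in> borel_measurable (Pi\<^sub>M A (\<lambda>_. borel))"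
    by (rule measurable_component_singleton)
  with 1 show ?case by (auto intro!: borel_measurable_add)
qed simp

lemma cX_coord:
  assumes "past j \<subseteq> A" "k < P j" "j \<le> i" "i \<le> \<eta>"
  shows "cX j (\<lambda>a\<in>A. coord i t \<delta> a \<omega>) k = X j \<omega> k"
  using assms
proof (induction j arbitrary: k)
  case (Suc j)
  have "k mod P j < P j" using P_pos[of j] Suc by simp
  moreover from this have "((j, k mod P j), 0) \<in> A" using Suc.prems(1) by auto
  moreover have "past j \<subseteq> A" using Suc.prems by auto
  ultimately show ?case using Suc by (simp add: coord_def start_def bm_step_def from_zero_def)
qed simp

lemma incoming_law:
  assumes i: "i \<le> \<eta>" and t: "t \<ge> 0"
  shows "distr M (vecs (P i) \<Otimes>\<^sub>M vecs (P i)) (\<lambda>\<omega>. (\<lambda>k\<in>{..<P i}. X i \<omega> k, \<lambda>k\<in>{..<P i}. B' i k t \<omega>))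
    = distr M (vecs (P i)) (\<lambda>\<omega>. \<lambda>k\<in>{..<P i}. X i \<omega> k) \<Otimes>\<^sub>M gauss_vec (P i) t"
proof -
  let ?q = "\<lambda>k. ((i, k), 0)"
  let ?f = "\<lambda>g. \<lambda>k\<in>{..<P i}. cX i g k"
  have f: "?f \<in> Pi\<^sub>M (past i) (\<lambda>_. borel) \<rightarrow>\<^sub>M vecs (P i)"
    by (intro measurable_restrict cX_measurable) (use i in auto)
  have "distr M (vecs (P i) \<Otimes>\<^sub>M vecs (P i)) (\<lambda>\<omega>. (?f (\<lambda>a\<in>past i. coord i t 1 a \<omega>), \<lambda>k\<in>{..<P i}. coord i t 1 (?q k) \<omega>))
    = distr M (vecs (P i)) (\<lambda>\<omega>. ?f (\<lambda>a\<in>past i. coord i t 1 a \<omega>)) \<Otimes>\<^sub>M gauss_vec (P i) t"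
  proof (rule indep_vars_split_distr[OF coord_indep[OF i t, of 1 0]])
    show "distr M borel (coord i t 1 (?q k)) = gauss t" if "k \<in> {..<P i}" for k
      using that i t by (subst coord_distr[of _ _ _ _ 0]) (auto simp: start_def)
    show "?f \<in> Pi\<^sub>M (past i) (\<lambda>_. borel) \<rightarrow>\<^sub>M vecs (P i)" by (rule f)
  qed (use i P_pos[OF i] in \<open>auto simp: inj_on_def\<close>)
  moreover have "(\<lambda>k\<in>{..<P i}. cX i (\<lambda>a\<in>past i. coord i t 1 a \<omega>) k) = (\<lambda>k\<in>{..<P i}. X i \<omega> k)" for \<omega>
    using cX_coord[of i "past i"] i by (auto simp: fun_eq_iff)
  moreover have "(\<lambda>k\<in>{..<P i}. coord i t 1 (?q k) \<omega>) = (\<lambda>k\<in>{..<P i}. B' i k t \<omega>)" for \<omega>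
    by (auto simp: fun_eq_iff coord_def start_def bm_step_def from_zero_def)
  ultimately show ?thesis by simp
qed

text \<open>The Markov property at time \<open>t\<close> of segment \<open>i\<close>.\<close>
lemma segment_law:
  assumes i: "i \<le> \<eta>" and t: "t \<ge> 0" and \<delta>: "\<delta> > 0" and m: "m > 0"
  shows "distr M (vecs (P i) \<Otimes>\<^sub>M incs (P i) m)
      (\<lambda>\<omega>. (\<lambda>k\<in>{..<P i}. Z i t \<omega> k, \<lambda>(k, j)\<in>steps (P i) m. B' i k (t + real (Suc j) * \<delta>) \<omega> - B' i k (t + real j * \<delta>) \<omega>))
    = distr M (vecs (P i)) (\<lambda>\<omega>. \<lambda>k\<in>{..<P i}. Z i t \<omega> k) \<Otimes>\<^sub>M gauss_steps (P i) m \<delta>"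
proof -
  let ?q = "\<lambda>(k, j). ((i, k), Suc j)"
  let ?A = "past (Suc i)"
  let ?f = "\<lambda>g. \<lambda>k\<in>{..<P i}. cX i g k + g ((i, k), 0)"
  have f: "?f \<in> Pi\<^sub>M ?A (\<lambda>_. borel) \<rightarrow>\<^sub>M vecs (P i)"
    by (intro measurable_restrict borel_measurable_add cX_measurable measurable_component_singleton)
       (use i in auto)
  have "distr M (vecs (P i) \<Otimes>\<^sub>M incs (P i) m) (\<lambda>\<omega>. (?f (\<lambda>a\<in>?A. coord i t \<delta> a \<omega>), \<lambda>p\<in>steps (P i) m. coord i t \<delta> (?q p) \<omega>))
    = distr M (vecs (P i)) (\<lambda>\<omega>. ?f (\<lambda>a\<in>?A. coord i t \<delta> a \<omega>)) \<Otimes>\<^sub>M gauss_steps (P i) m \<delta>"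
  proof (rule indep_vars_split_distr[OF coord_indep[OF i t \<delta>, of m]])
    show "distr M borel (coord i t \<delta> (?q p)) = gauss \<delta>" if "p \<in> steps (P i) m" for p
      using that i t \<delta> by (subst coord_distr[of _ _ _ _ m]) auto
    show "?f \<in> Pi\<^sub>M ?A (\<lambda>_. borel) \<rightarrow>\<^sub>M vecs (P i)" by (rule f)
  qed (use i P_pos[OF i] m in \<open>auto simp: inj_on_def\<close>)
  moreover have "(\<lambda>k\<in>{..<P i}. cX i (\<lambda>a\<in>?A. coord i t \<delta> a \<omega>) k + (\<lambda>a\<in>?A. coord i t \<delta> a \<omega>) ((i, k), 0)) = (\<lambda>k\<in>{..<P i}. Z i t \<omega> k)" for \<omega>
  proof (intro restrict_ext)
    fix k assume k: "k \<in> {..<P i}"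
    have "cX i (\<lambda>a\<in>?A. coord i t \<delta> a \<omega>) k = X i \<omega> k" by (rule cX_coord) (use i k in auto)
    then show "cX i (\<lambda>a\<in>?A. coord i t \<delta> a \<omega>) k + (\<lambda>a\<in>?A. coord i t \<delta> a \<omega>) ((i, k), 0) = Z i t \<omega> k"
      using k by (simp add: Z_def coord_def start_def bm_step_def from_zero_def)
  qed
  moreover have "(\<lambda>p\<in>steps (P i) m. coord i t \<delta> (?q p) \<omega>) = (\<lambda>(k, j)\<in>steps (P i) m. B' i k (t + real (Suc j) * \<delta>) \<omega> - B' i k (t + real j * \<delta>) \<omega>)" for \<omega>
    by (auto simp: fun_eq_iff coord_def start_def bm_step_def from_zero_def restrict_def)
  ultimately show ?thesis by simp
qed

lemma Z_law:
  assumes i: "i \<le> \<eta>" and t: "t \<ge> 0"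
  shows "distr M (vecs (P i)) (\<lambda>\<omega>. \<lambda>k\<in>{..<P i}. Z i t \<omega> k)
    = distr (distr M (vecs (P i)) (\<lambda>\<omega>. \<lambda>k\<in>{..<P i}. X i \<omega> k) \<Otimes>\<^sub>M gauss_vec (P i) t) (vecs (P i)) (\<lambda>(x, g). \<lambda>k\<in>{..<P i}. x k + g k)"
proof -
  have a[measurable]: "(\<lambda>(x, g). \<lambda>k\<in>{..<P i}. x k + g k :: real) \<in> vecs (P i) \<Otimes>\<^sub>M vecs (P i) \<rightarrow>\<^sub>M vecs (P i)"
    unfolding case_prod_beta
    by (intro measurable_restrict borel_measurable_add measurable_compose[OF measurable_fst measurable_component_singleton]
        measurable_compose[OF measurable_snd measurable_component_singleton])
  have b: "(\<lambda>\<omega>. (\<lambda>k\<in>{..<P i}. X i \<omega> k, \<lambda>k\<in>{..<P i}. B' i k t \<omega>)) \<in> M \<rightarrow>\<^sub>M vecs (P i) \<Otimes>\<^sub>M vecs (P i)"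
    by (intro measurable_Pair Xvec_measurable measurable_restrict B'_measurable) (use i t in auto)
  show ?thesis
    unfolding incoming_law[OF i t, symmetric] distr_distr[OF a b]
    by (intro distr_cong refl) (auto simp: Z_def fun_eq_iff)
qed

text \<open>Branching multiplies the diagonal variance by the number of copies and running time adds to it, so by
  induction over the segments the diagonal variance at the end is \<open>\<mu>\<^sub>0\<close>.\<close>
lemma tilt_X: "i \<le> \<eta> \<Longrightarrow> tilt (P i) (xvar i) (distr M (vecs (P i)) (\<lambda>\<omega>. \<lambda>k\<in>{..<P i}. X i \<omega> k))"
  and tilt_Z: "i \<le> \<eta> \<Longrightarrow> t \<ge> 0 \<Longrightarrow> tilt (P i) (xvar i + t) (distr M (vecs (P i)) (\<lambda>\<omega>. \<lambda>k\<in>{..<P i}. Z i t \<omega> k))"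
proof -
  have Z: "tilt (P i) (xvar i + t) (distr M (vecs (P i)) (\<lambda>\<omega>. \<lambda>k\<in>{..<P i}. Z i t \<omega> k))"
    if "tilt (P i) (xvar i) (distr M (vecs (P i)) (\<lambda>\<omega>. \<lambda>k\<in>{..<P i}. X i \<omega> k))" "i \<le> \<eta>" "t \<ge> 0" for i t
    unfolding Z_law[OF that(2,3)] by (rule tilt_add[OF that(1,3)])
  show X: "i \<le> \<eta> \<Longrightarrow> tilt (P i) (xvar i) (distr M (vecs (P i)) (\<lambda>\<omega>. \<lambda>k\<in>{..<P i}. X i \<omega> k))" for i
  proof (induction i)
    case 0
    have "distr M (vecs (P 0)) (\<lambda>\<omega>. \<lambda>k\<in>{..<P 0}. X 0 \<omega> k) = return (vecs (P 0)) (\<lambda>k\<in>{..<P 0}. 0)"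
      by (intro measure_eqI) (auto simp: emeasure_distr indicator_def emeasure_space_1 space_PiM)
    then show ?case using tilt_zero[of "P 0"] by (simp only: incoming_var.simps)
  next
    case (Suc i)
    let ?l = "\<tau> (Suc i) - \<tau> i"
    have i: "i \<le> \<eta>" "?l \<ge> 0" using Suc.prems \<tau>_less[of i] by auto
    have c: "(\<lambda>x. \<lambda>k\<in>{..<P (Suc i)}. x (k mod P i) :: real) \<in> vecs (P i) \<rightarrow>\<^sub>M vecs (P (Suc i))"
      by (intro measurable_restrict measurable_component_singleton) (use P_pos[OF i(1)] in auto)
    have "tilt (P (Suc i)) (xvar (Suc i)) (distr (distr M (vecs (P i)) (\<lambda>\<omega>. \<lambda>k\<in>{..<P i}. Z i ?l \<omega> k)) (vecs (P (Suc i))) (\<lambda>x. \<lambda>k\<in>{..<P (Suc i)}. x (k mod P i)))"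
      unfolding offspring_prod_Suc incoming_var.simps
      by (rule tilt_copies[OF Z[OF Suc.IH]]) (use i P_pos in auto)
    also have "distr (distr M (vecs (P i)) (\<lambda>\<omega>. \<lambda>k\<in>{..<P i}. Z i ?l \<omega> k)) (vecs (P (Suc i))) (\<lambda>x. \<lambda>k\<in>{..<P (Suc i)}. x (k mod P i))
       = distr M (vecs (P (Suc i))) (\<lambda>\<omega>. \<lambda>k\<in>{..<P (Suc i)}. X (Suc i) \<omega> k)"
      unfolding distr_distr[OF c Zvec_measurable[OF i]]
      by (intro distr_cong refl) (use P_pos[OF i(1)] in \<open>auto simp: Z_def fun_eq_iff\<close>)
    finally show ?case .
  qed
  show "i \<le> \<eta> \<Longrightarrow> t \<ge> 0 \<Longrightarrow> tilt (P i) (xvar i + t) (distr M (vecs (P i)) (\<lambda>\<omega>. \<lambda>k\<in>{..<P i}. Z i t \<omega> k))"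
    by (rule Z[OF X])
qed

end

section \<open>Events over a continuum of times\<close>

text \<open>The set of times at which finitely many continuous functions are positive is relatively open, hence it
  contains a dyadic time unless it is empty.\<close>
lemma ex_dyadic_iff:
  fixes f :: "nat \<Rightarrow> real \<Rightarrow> real"
  assumes ab: "a < b" and cont: "\<And>k. k < n \<Longrightarrow> continuous_on {a..b} (f k)"
  shows "(\<exists>t\<in>{a..b}. \<forall>k<n. f k t > 0) \<longleftrightarrow> (\<exists>m. \<exists>j\<le>2^m. \<forall>k<n. f k (a + real j * ((b - a) / 2^m)) > 0)"
proof
  assume "\<exists>m. \<exists>j\<le>2^m. \<forall>k<n. f k (a + real j * ((b - a) / 2^m)) > 0"
  then obtain m j where j: "j \<le> 2^m" and p: "\<forall>k<n. f k (a + real j * ((b - a) / 2^m)) > 0" by blast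
  have "real j * ((b - a) / 2^m) \<le> 2^m * ((b - a) / 2^m)"
    using of_nat_mono[OF j, where 'a=real] ab by (intro mult_right_mono) simp_all
  then have "a + real j * ((b - a) / 2^m) \<in> {a..b}" using ab by simp
  with p show "\<exists>t\<in>{a..b}. \<forall>k<n. f k t > 0" by blast
next
  assume "\<exists>t\<in>{a..b}. \<forall>k<n. f k t > 0"
  then obtain t where t: "t \<in> {a..b}" and p: "\<And>k. k < n \<Longrightarrow> f k t > 0" by blast
  have "(f k \<longlongrightarrow> f k t) (at t within {a..b})" if "k < n" for k
    using cont[OF that] t by (auto simp: continuous_on_def)
  then have "\<forall>k\<in>{..<n}. \<forall>\<^sub>F s in at t within {a..b}. f k s > 0"
    using p order_tendstoD(1) by blast
  then have "\<forall>\<^sub>F s in at t within {a..b}. \<forall>k\<in>{..<n}. f k s > 0"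
    by (rule eventually_ball_finite[OF finite_lessThan])
  then obtain d where d: "d > 0" and q: "\<And>s. s \<in> {a..b} \<Longrightarrow> dist s t < d \<Longrightarrow> \<forall>k<n. f k s > 0"
    using p unfolding eventually_at by (metis lessThan_iff)
  obtain m where m: "(b - a) / d < 2^m" using real_arch_pow[of 2] by force
  define \<delta> where "\<delta> = (b - a) / 2^m"
  have \<delta>: "\<delta> > 0" "\<delta> < d" using m d ab by (auto simp: \<delta>_def field_simps)
  define j where "j = nat \<lfloor>(t - a) / \<delta>\<rfloor>"
  have q0: "(t - a) / \<delta> \<ge> 0" using t \<delta> by simp
  have j: "real j \<le> (t - a) / \<delta>" "(t - a) / \<delta> < real j + 1" using q0 by (simp_all add: j_def)
  have jt: "real j * \<delta> \<le> t - a" "t - a < real j * \<delta> + \<delta>" using j \<delta> by (auto simp: field_simps)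
  have "real j * \<delta> \<le> 2^m * \<delta>" using jt t by (simp add: \<delta>_def)
  then have "real j \<le> real (2^m)" using \<delta> by (simp add: mult_le_cancel_right)
  then have "j \<le> 2^m" by (simp only: of_nat_le_iff)
  moreover have "\<forall>k<n. f k (a + real j * \<delta>) > 0"
    by (rule q) (use jt t \<delta> in \<open>auto simp: dist_real_def intro: mult_nonneg_nonneg\<close>)
  ultimately show "\<exists>m. \<exists>j\<le>2^m. \<forall>k<n. f k (a + real j * ((b - a) / 2^m)) > 0"
    unfolding \<delta>_def by blast
qed

lemma dyadic_refine:
  fixes f :: "nat \<Rightarrow> real \<Rightarrow> real"
  assumes "m \<le> m'" "\<exists>j\<le>2^m. \<forall>k<n. f k (a + real j * ((b - a) / 2^m)) > 0"
  shows "\<exists>j\<le>2^m'. \<forall>k<n. f k (a + real j * ((b - a) / 2^m')) > 0"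
proof -
  obtain j where j: "j \<le> 2^m" "\<forall>k<n. f k (a + real j * ((b - a) / 2^m)) > 0" using assms by blast
  have e: "(2::nat)^m' = 2^m * 2^(m' - m)" "(2::real)^m' = 2^m * 2^(m' - m)" using assms(1) by (simp_all add: power_add[symmetric])
  have "real (j * 2^(m' - m)) * ((b - a) / 2^m') = real j * ((b - a) / 2^m)" by (simp add: e(2))
  then have "\<forall>k<n. f k (a + real (j * 2^(m' - m)) * ((b - a) / 2^m')) > 0" using j by metis
  moreover have "j * 2^(m' - m) \<le> 2^m'" unfolding e(1) using j by simp
  ultimately show ?thesis by blast
qed

context prob_space begin

lemma dyadic_event:
  fixes f :: "nat \<Rightarrow> real \<Rightarrow> 'a \<Rightarrow> real"
  assumes ab: "a < b"
    and cont: "\<And>k \<omega>. k < n \<Longrightarrow> \<omega> \<in> space M \<Longrightarrow> continuous_on {a..b} (\<lambda>t. f k t \<omega>)"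
    and meas: "\<And>k t. k < n \<Longrightarrow> t \<in> {a..b} \<Longrightarrow> f k t \<in> borel_measurable M"
  defines "A m \<equiv> {\<omega> \<in> space M. \<exists>j\<le>2^m. \<forall>k<n. f k (a + real j * ((b - a) / 2^m)) \<omega> > 0}"
  shows "A m \<in> events" "incseq A"
    "(\<Union>m. A m) = {\<omega> \<in> space M. \<exists>t\<in>{a..b}. \<forall>k<n. f k t \<omega> > 0}"
    "{\<omega> \<in> space M. \<exists>t\<in>{a..b}. \<forall>k<n. f k t \<omega> > 0} \<in> events"
    "(\<lambda>m. prob (A m)) \<longlonglongrightarrow> prob {\<omega> \<in> space M. \<exists>t\<in>{a..b}. \<forall>k<n. f k t \<omega> > 0}"
proof -
  have pt: "a + real j * ((b - a) / 2^m) \<in> {a..b}" if "j \<le> 2^m" for j m :: nat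
  proof -
    have "real j * ((b - a) / 2^m) \<le> 2^m * ((b - a) / 2^m)"
      using of_nat_mono[OF that, where 'a=real] ab by (intro mult_right_mono) simp_all
    then show ?thesis using ab by simp
  qed
  have A: "A m \<in> events" for m
  proof -
    have "A m = (\<Union>j\<in>{..2^m}. {\<omega> \<in> space M. \<forall>k\<in>{..<n}. f k (a + real j * ((b - a) / 2^m)) \<omega> > 0})"
      by (auto simp: A_def)
    also have "\<dots> \<in> events"
    proof (intro sets.finite_UN sets.sets_Collect_finite_All)
      fix j k :: nat assume "j \<in> {..2^m}" "k \<in> {..<n}"
      then have [measurable]: "f k (a + real j * ((b - a) / 2^m)) \<in> borel_measurable M"
        by (intro meas pt) auto
      show "{\<omega> \<in> space M. f k (a + real j * ((b - a) / 2^m)) \<omega> > 0} \<in> events" by measurable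
    qed auto
    finally show ?thesis .
  qed
  then show "A m \<in> events" .
  show inc: "incseq A"
  proof (rule incseq_SucI, rule subsetI)
    fix m \<omega> assume "\<omega> \<in> A m"
    then have \<omega>: "\<omega> \<in> space M" and e: "\<exists>j\<le>2^m. \<forall>k<n. f k (a + real j * ((b - a) / 2^m)) \<omega> > 0"
      by (simp_all only: A_def mem_Collect_eq)
    have "\<exists>j\<le>2^Suc m. \<forall>k<n. f k (a + real j * ((b - a) / 2^Suc m)) \<omega> > 0"
      by (rule dyadic_refine[of m "Suc m" n "\<lambda>k t. f k t \<omega>" a b, OF _ e]) simp
    with \<omega> show "\<omega> \<in> A (Suc m)" by (simp only: A_def mem_Collect_eq)
  qed
  show un: "(\<Union>m. A m) = {\<omega> \<in> space M. \<exists>t\<in>{a..b}. \<forall>k<n. f k t \<omega> > 0}"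
  proof -
    have "(\<Union>m. A m) = {\<omega> \<in> space M. \<exists>m. \<exists>j\<le>2^m. \<forall>k<n. f k (a + real j * ((b - a) / 2^m)) \<omega> > 0}"
      unfolding A_def by blast
    also have "\<dots> = {\<omega> \<in> space M. \<exists>t\<in>{a..b}. \<forall>k<n. f k t \<omega> > 0}"
      by (intro Collect_cong conj_cong refl ex_dyadic_iff[OF ab, symmetric] cont)
    finally show ?thesis .
  qed
  show "{\<omega> \<in> space M. \<exists>t\<in>{a..b}. \<forall>k<n. f k t \<omega> > 0} \<in> events"
    unfolding un[symmetric] using A by auto
  show "(\<lambda>m. prob (A m)) \<longlonglongrightarrow> prob {\<omega> \<in> space M. \<exists>t\<in>{a..b}. \<forall>k<n. f k t \<omega> > 0}"
    unfolding un[symmetric] by (rule finite_Lim_measure_incseq[OF _ inc]) (use A in auto)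
qed

text \<open>Needed for exceedances at positive times, and for the branches as they are given: these are continuous on the segments \<open>(\<tau>\<^sub>i, \<tau>\<^sub>i\<^sub>+\<^sub>1]\<close>, but if a
  driving motion does not start at 0 they jump at their left ends.\<close>
lemma half_open_event:
  fixes f :: "nat \<Rightarrow> real \<Rightarrow> 'a \<Rightarrow> real"
  assumes ab: "a < b"
    and cont: "\<And>k \<omega>. k < n \<Longrightarrow> \<omega> \<in> space M \<Longrightarrow> continuous_on {a..b} (\<lambda>t. f k t \<omega>)"
    and meas: "\<And>k t. k < n \<Longrightarrow> t \<in> {a..b} \<Longrightarrow> f k t \<in> borel_measurable M"
  shows "{\<omega> \<in> space M. \<exists>t\<in>{a<..b}. \<forall>k<n. f k t \<omega> > 0} \<in> events"
proof -
  define e where "e m = a + (b - a) / (real m + 2)" for m :: nat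
  have e: "a < e m" "e m < b" for m
  proof -
    have "(b - a) * 1 < (b - a) * (real m + 2)" using ab by (intro mult_strict_left_mono) auto
    then have "(b - a) / (real m + 2) < b - a" by (simp add: pos_divide_less_eq add_pos_nonneg)
    moreover have "0 < (b - a) / (real m + 2)" using ab by simp
    ultimately show "a < e m" "e m < b" by (simp_all add: e_def)
  qed
  have "\<exists>m. e m \<le> t" if "a < t" for t
  proof -
    obtain m where m: "(b - a) / (t - a) < real m" using reals_Archimedean2 by blast
    have "b - a < real m * (t - a)" using m that by (simp add: pos_divide_less_eq)
    also have "\<dots> \<le> (real m + 2) * (t - a)" using that by (intro mult_right_mono) auto
    finally have "e m \<le> t" by (simp add: e_def field_simps)
    then show ?thesis by blast
  qed
  then have "{\<omega> \<in> space M. \<exists>t\<in>{a<..b}. \<forall>k<n. f k t \<omega> > 0} = (\<Union>m. {\<omega> \<in> space M. \<exists>t\<in>{e m..b}. \<forall>k<n. f k t \<omega> > 0})"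
    using e(1) by (fastforce intro: less_le_trans)
  also have "\<dots> \<in> events"
  proof (intro sets.countable_UN image_subsetI)
    fix m
    show "{\<omega> \<in> space M. \<exists>t\<in>{e m..b}. \<forall>k<n. f k t \<omega> > 0} \<in> events"
      by (rule dyadic_event(4)[OF e(2)])
         (use e(1)[of m] in \<open>auto intro!: meas intro: continuous_on_subset[OF cont]\<close>)
  qed
  finally show ?thesis .
qed

end

section \<open>The maximal inequality on a segment\<close>

lemma tilt_exp_moment:
  assumes Q: "tilt n s Q" and p: "prob_space Q"
  shows "(\<integral>\<^sup>+x. ennreal (exp (b * (\<Sum>k<n. x k) - real n * b\<^sup>2 * s / 2)) \<partial>Q) = 1"
proof -
  have "1 = (\<integral>\<^sup>+x. 1 \<partial>Q)" using prob_space.emeasure_space_1[OF p] by simp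
  also have "\<dots> = (\<integral>\<^sup>+x. 1 * ennreal (exp (- (-b) * (\<Sum>k<n. x k) - real n * (-b)\<^sup>2 * s / 2)) \<partial>Q)"
    by (rule tiltD[OF Q]) simp
  finally show ?thesis by simp
qed

context brownian_tree begin

lemma Z_continuous: "i \<le> \<eta> \<Longrightarrow> k < P i \<Longrightarrow> \<omega> \<in> space M \<Longrightarrow> continuous_on {0..} (\<lambda>t. Z i t \<omega> k)"
  unfolding Z_def by (intro continuous_intros B'_continuous)

text \<open>Given the state at the start of the segment, apply \<open>gauss_steps_maximal\<close> to the increments with the level
  \<open>y\<close> lowered by the initial value; the exponential moment of the initial value is 1.\<close>
lemma segment_maximal_grid:
  assumes i: "i \<le> \<eta>" and \<delta>: "\<delta> > 0" and m: "m > 0"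
  shows "prob {\<omega> \<in> space M. \<exists>j\<le>m. y < \<theta> * (\<Sum>k<P i. Z i (real j * \<delta>) \<omega> k) - \<theta>\<^sup>2 * real (P i) * (xvar i + real j * \<delta>) / 2} \<le> exp (- y)"
    (is "prob ?A \<le> _")
proof -
  let ?n = "P i"
  let ?D = "\<lambda>\<omega>. \<lambda>(k, j)\<in>steps ?n m. B' i k (0 + real (Suc j) * \<delta>) \<omega> - B' i k (0 + real j * \<delta>) \<omega>"
  let ?Z = "\<lambda>\<omega>. \<lambda>k\<in>{..<?n}. Z i 0 \<omega> k"
  let ?S = "incs ?n m"
  let ?Q = "distr M (vecs ?n) ?Z" and ?G = "gauss_steps ?n m \<delta>"
  let ?g = "\<lambda>x. \<theta> * (\<Sum>k<?n. x k) - real ?n * \<theta>\<^sup>2 * xvar i / 2"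
  let ?h = "\<lambda>d j. \<Sum>k<?n. \<Sum>i<j. \<theta> * d (k, i) - \<theta>\<^sup>2 * \<delta> / 2"
  let ?C = "{z \<in> space (vecs ?n \<Otimes>\<^sub>M ?S). \<exists>j\<le>m. y \<le> ?g (fst z) + ?h (snd z) j}"
  have Zm: "?Z \<in> M \<rightarrow>\<^sub>M vecs ?n" by (rule Zvec_measurable) (use i in auto)
  have Dm: "?D \<in> M \<rightarrow>\<^sub>M ?S"
    unfolding case_prod_beta
    by (intro measurable_restrict borel_measurable_diff B'_measurable) (use i \<delta> in auto)
  have hm: "(\<lambda>d. ?h d j) \<in> borel_measurable ?S" if "j \<le> m" for j
    by (intro borel_measurable_sum borel_measurable_diff borel_measurable_times borel_measurable_const
          measurable_component_singleton) (use that in auto)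
  have C: "?C \<in> sets (vecs ?n \<Otimes>\<^sub>M ?S)"
  proof -
    have "?C = (\<Union>j\<in>{..m}. {z \<in> space (vecs ?n \<Otimes>\<^sub>M ?S). y \<le> ?g (fst z) + ?h (snd z) j})" by auto
    also have "\<dots> \<in> sets (vecs ?n \<Otimes>\<^sub>M ?S)"
    proof (intro sets.finite_UN)
      fix j assume "j \<in> {..m}"
      then have [measurable]: "(\<lambda>z. ?h (snd z) j) \<in> borel_measurable (vecs ?n \<Otimes>\<^sub>M ?S)"
        by (intro measurable_compose[OF measurable_snd hm]) auto
      have [measurable]: "(\<lambda>z. ?g (fst z)) \<in> borel_measurable (vecs ?n \<Otimes>\<^sub>M ?S)"
        by (intro measurable_compose[OF measurable_fst]) measurable
      show "{z \<in> space (vecs ?n \<Otimes>\<^sub>M ?S). y \<le> ?g (fst z) + ?h (snd z) j} \<in> sets (vecs ?n \<Otimes>\<^sub>M ?S)" by measurable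
    qed auto
    finally show ?thesis .
  qed
  interpret Q: prob_space ?Q by (rule prob_space_distr[OF Zm])
  interpret G: prob_space ?G by (rule prob_space_gauss_steps)
  have sG: "sets ?G = sets ?S" by (intro sets_PiM_cong) auto
  have sQG: "sets (?Q \<Otimes>\<^sub>M ?G) = sets (vecs ?n \<Otimes>\<^sub>M ?S)" by (intro sets_pair_measure_cong sG) simp
  have spG: "space ?G = space ?S" by (rule sets_eq_imp_space_eq[OF sG])
  have "?A \<subseteq> (\<lambda>\<omega>. (?Z \<omega>, ?D \<omega>)) -` ?C \<inter> space M"
  proof
    fix \<omega> assume "\<omega> \<in> ?A"
    then obtain j where \<omega>: "\<omega> \<in> space M" and j: "j \<le> m"
      and y: "y < \<theta> * (\<Sum>k<P i. Z i (real j * \<delta>) \<omega> k) - \<theta>\<^sup>2 * real (P i) * (xvar i + real j * \<delta>) / 2" by blast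
    have "Z i (real j * \<delta>) \<omega> k = ?Z \<omega> k + (\<Sum>i<j. ?D \<omega> (k, i))" if "k < ?n" for k
    proof -
      have "(\<Sum>i<j. ?D \<omega> (k, i)) = (\<Sum>l<j. B' i k (real (Suc l) * \<delta>) \<omega> - B' i k (real l * \<delta>) \<omega>)"
        using that j by (intro sum.cong refl) auto
      also have "\<dots> = B' i k (real j * \<delta>) \<omega> - B' i k (real 0 * \<delta>) \<omega>" by (rule sum_lessThan_telescope)
      finally show ?thesis using that by (simp add: Z_def)
    qed
    then have "(\<Sum>k<P i. Z i (real j * \<delta>) \<omega> k) = (\<Sum>k<P i. ?Z \<omega> k + (\<Sum>i<j. ?D \<omega> (k, i)))"
      by (intro sum.cong refl) simp
    then have "\<theta> * (\<Sum>k<P i. Z i (real j * \<delta>) \<omega> k) - \<theta>\<^sup>2 * real (P i) * (xvar i + real j * \<delta>) / 2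
       = ?g (?Z \<omega>) + ?h (?D \<omega>) j"
      by (simp only: sum.distrib sum_subtractf sum_distrib_left[symmetric]) (simp add: algebra_simps add_divide_distrib)
    then have "?g (?Z \<omega>) + ?h (?D \<omega>) j \<ge> y" using y by linarith
    moreover have "(?Z \<omega>, ?D \<omega>) \<in> space (vecs ?n \<Otimes>\<^sub>M ?S)"
      using measurable_space[OF measurable_Pair[OF Zm Dm] \<omega>] .
    ultimately have "(?Z \<omega>, ?D \<omega>) \<in> ?C" using j by auto
    then show "\<omega> \<in> (\<lambda>\<omega>. (?Z \<omega>, ?D \<omega>)) -` ?C \<inter> space M" using \<omega> by blast
  qed
  then have "emeasure M ?A \<le> emeasure M ((\<lambda>\<omega>. (?Z \<omega>, ?D \<omega>)) -` ?C \<inter> space M)"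
    by (rule emeasure_mono) (rule measurable_sets[OF measurable_Pair[OF Zm Dm] C])
  also have "\<dots> = emeasure (distr M (vecs ?n \<Otimes>\<^sub>M ?S) (\<lambda>\<omega>. (?Z \<omega>, ?D \<omega>))) ?C"
    by (rule emeasure_distr[symmetric, OF measurable_Pair[OF Zm Dm] C])
  also have "\<dots> = emeasure (?Q \<Otimes>\<^sub>M ?G) ?C"
    using segment_law[OF i order_refl \<delta> m] by simp
  also have "\<dots> = (\<integral>\<^sup>+x. emeasure ?G (Pair x -` ?C) \<partial>?Q)"
    by (rule G.emeasure_pair_measure_alt) (use C sQG in simp)
  also have "\<dots> \<le> (\<integral>\<^sup>+x. ennreal (exp (-y)) * ennreal (exp (\<theta> * (\<Sum>k<?n. x k) - real ?n * \<theta>\<^sup>2 * xvar i / 2)) \<partial>?Q)"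
  proof (rule nn_integral_mono)
    fix x assume "x \<in> space ?Q"
    have "Pair x -` ?C \<subseteq> {d \<in> space ?G. \<exists>j\<le>m. y - ?g x \<le> ?h d j}"
      by (auto simp: space_pair_measure spG algebra_simps)
    moreover have "{d \<in> space ?G. \<exists>j\<le>m. y - ?g x \<le> ?h d j} \<in> sets ?G"
    proof -
      have "{d \<in> space ?G. \<exists>j\<le>m. y - ?g x \<le> ?h d j} = (\<Union>j\<in>{..m}. {d \<in> space ?S. y - ?g x \<le> ?h d j})"
        by (auto simp: spG)
      also have "\<dots> \<in> sets ?S"
        by (intro sets.finite_UN borel_measurable_le borel_measurable_const hm) auto
      finally show ?thesis unfolding sG .
    qed
    ultimately have "emeasure ?G (Pair x -` ?C) \<le> emeasure ?G {d \<in> space ?G. \<exists>j\<le>m. y - ?g x \<le> ?h d j}"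
      by (rule emeasure_mono)
    also have "\<dots> \<le> ennreal (exp (- (y - ?g x)))"
      by (rule gauss_steps_maximal) (use \<delta> in auto)
    also have "\<dots> = ennreal (exp (-y)) * ennreal (exp (?g x))"
      by (simp add: ennreal_mult'[symmetric] exp_add[symmetric])
    finally show "emeasure ?G (Pair x -` ?C) \<le> ennreal (exp (-y)) * ennreal (exp (?g x))" .
  qed
  also have "\<dots> = ennreal (exp (-y)) * (\<integral>\<^sup>+x. ennreal (exp (?g x)) \<partial>?Q)"
    by (rule nn_integral_cmult) measurable
  also have "(\<integral>\<^sup>+x. ennreal (exp (?g x)) \<partial>?Q) = 1"
    using tilt_exp_moment[OF tilt_Z[OF i order_refl] Q.prob_space_axioms] by simp
  finally show ?thesis by (simp add: emeasure_eq_measure)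
qed

abbreviation tilted_sum :: "nat \<Rightarrow> real \<Rightarrow> real \<Rightarrow> 'a \<Rightarrow> real" where
  "tilted_sum i \<theta> t \<omega> \<equiv> \<theta> * (\<Sum>k<P i. Z i t \<omega> k) - \<theta>\<^sup>2 * real (P i) * (xvar i + t) / 2"

lemma segment_process:
  assumes i: "i \<le> \<eta>"
  shows "\<omega> \<in> space M \<Longrightarrow> continuous_on {0..l} (\<lambda>t. tilted_sum i \<theta> t \<omega> - y)"
    and "t \<in> {0..l} \<Longrightarrow> (\<lambda>\<omega>. tilted_sum i \<theta> t \<omega> - y) \<in> borel_measurable M"
proof -
  show "continuous_on {0..l} (\<lambda>t. tilted_sum i \<theta> t \<omega> - y)" if "\<omega> \<in> space M"
    using continuous_on_subset[OF Z_continuous[OF i _ that], of _ "{0..l}"] by (intro continuous_intros) auto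
  show "(\<lambda>\<omega>. tilted_sum i \<theta> t \<omega> - y) \<in> borel_measurable M" if "t \<in> {0..l}"
    by (intro borel_measurable_diff borel_measurable_times borel_measurable_const borel_measurable_sum Z_measurable) (use that i in auto)
qed

lemma
  assumes i: "i \<le> \<eta>" and l: "l > 0"
  shows segment_event: "{\<omega> \<in> space M. \<exists>t\<in>{0..l}. y < tilted_sum i \<theta> t \<omega>} \<in> events"
    and segment_maximal: "prob {\<omega> \<in> space M. \<exists>t\<in>{0..l}. y < tilted_sum i \<theta> t \<omega>} \<le> exp (- y)"
proof -
  let ?f = "\<lambda>(k::nat) t \<omega>. tilted_sum i \<theta> t \<omega> - y"
  have "{\<omega> \<in> space M. \<exists>t\<in>{0..l}. \<forall>k<1. ?f k t \<omega> > 0} \<in> events"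
    by (rule dyadic_event(4)[OF l]; rule segment_process[OF i]; assumption)
  then show "{\<omega> \<in> space M. \<exists>t\<in>{0..l}. y < tilted_sum i \<theta> t \<omega>} \<in> events"
    by simp
  have "(\<lambda>m. prob {\<omega> \<in> space M. \<exists>j\<le>2^m. \<forall>k<1. ?f k (0 + real j * ((l - 0) / 2^m)) \<omega> > 0})
     \<longlonglongrightarrow> prob {\<omega> \<in> space M. \<exists>t\<in>{0..l}. \<forall>k<1. ?f k t \<omega> > 0}"
    by (rule dyadic_event(5)[OF l]; rule segment_process[OF i]; assumption)
  moreover have "prob {\<omega> \<in> space M. \<exists>j\<le>2^m. \<forall>k<1. ?f k (0 + real j * ((l - 0) / 2^m)) \<omega> > 0} \<le> exp (- y)" for m
    using segment_maximal_grid[OF i, of "l / 2^m" "2^m" y \<theta>] l by simp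
  ultimately have "prob {\<omega> \<in> space M. \<exists>t\<in>{0..l}. \<forall>k<1. ?f k t \<omega> > 0} \<le> exp (- y)"
    by (intro LIMSEQ_le_const2) auto
  then show "prob {\<omega> \<in> space M. \<exists>t\<in>{0..l}. y < tilted_sum i \<theta> t \<omega>} \<le> exp (- y)" by simp
qed

end

section \<open>Laws smoothed by a Gaussian vector\<close>

abbreviation leb :: "nat \<Rightarrow> (nat \<Rightarrow> real) measure" where
  "leb n \<equiv> Pi\<^sub>M {..<n} (\<lambda>_. lborel)"

lemma sets_leb: "sets (leb n) = sets (vecs n)"
  by (intro sets_PiM_cong) auto

lemma sigma_finite_leb: "sigma_finite_measure (leb n)"
proof -
  interpret product_sigma_finite "\<lambda>_::nat. lborel :: real measure" ..
  show ?thesis by (rule sigma_finite) simp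
qed

lemma leb_affine:
  assumes c: "c \<noteq> 0" and F[measurable]: "F \<in> borel_measurable (vecs n)"
  shows "(\<integral>\<^sup>+x. F x \<partial>leb n) = ennreal (\<bar>c\<bar> ^ n) * (\<integral>\<^sup>+x. F (\<lambda>k\<in>{..<n}. t k + c * x k) \<partial>leb n)"
proof -
  interpret product_sigma_finite "\<lambda>_::nat. lborel :: real measure" ..
  let ?E = "vecs n"
  let ?a = "\<lambda>x. \<lambda>k\<in>{..<n}. t k + c * x k"
  note [measurable_cong] = sets_leb[of n]
  have a[measurable]: "?a \<in> ?E \<rightarrow>\<^sub>M ?E"
    by (intro measurable_restrict borel_measurable_add borel_measurable_times borel_measurable_const measurable_component_singleton)
  have "density (distr (leb n) ?E ?a) (\<lambda>_. ennreal (\<bar>c\<bar> ^ n)) = leb n"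
  proof (rule PiM_eqI)
    fix A :: "nat \<Rightarrow> real set" assume "\<And>i. i \<in> {..<n} \<Longrightarrow> A i \<in> sets lborel"
    then have A: "\<And>i. i \<in> {..<n} \<Longrightarrow> A i \<in> sets borel" by simp
    have PA[measurable]: "Pi\<^sub>E {..<n} A \<in> sets ?E" by (intro sets_PiM_I_finite A) auto
    have "emeasure (density (distr (leb n) ?E ?a) (\<lambda>_. ennreal (\<bar>c\<bar> ^ n))) (Pi\<^sub>E {..<n} A)
      = ennreal (\<bar>c\<bar> ^ n) * (\<integral>\<^sup>+x. indicator (Pi\<^sub>E {..<n} A) (?a x) \<partial>leb n)"
    proof -
      have "emeasure (density (distr (leb n) ?E ?a) (\<lambda>_. ennreal (\<bar>c\<bar> ^ n))) (Pi\<^sub>E {..<n} A)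
        = (\<integral>\<^sup>+x. ennreal (\<bar>c\<bar> ^ n) * indicator (Pi\<^sub>E {..<n} A) x \<partial>distr (leb n) ?E ?a)"
        by (rule emeasure_density) auto
      also have "\<dots> = (\<integral>\<^sup>+x. ennreal (\<bar>c\<bar> ^ n) * indicator (Pi\<^sub>E {..<n} A) (?a x) \<partial>leb n)"
        by (rule nn_integral_distr) measurable
      also have "\<dots> = ennreal (\<bar>c\<bar> ^ n) * (\<integral>\<^sup>+x. indicator (Pi\<^sub>E {..<n} A) (?a x) \<partial>leb n)"
        by (rule nn_integral_cmult) measurable
      finally show ?thesis .
    qed
    also have "(\<integral>\<^sup>+x. indicator (Pi\<^sub>E {..<n} A) (?a x) \<partial>leb n) = (\<integral>\<^sup>+x. (\<Prod>k<n. indicator (A k) (t k + c * x k)) \<partial>leb n)"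
      by (intro nn_integral_cong) (auto simp: indicator_def PiE_iff prod_zero_iff)
    also have "\<dots> = (\<Prod>k<n. \<integral>\<^sup>+x. indicator (A k) (t k + c * x) \<partial>lborel)"
    proof (intro product_nn_integral_prod)
      fix k assume "k \<in> {..<n}"
      then have [measurable]: "A k \<in> sets borel" by (rule A)
      show "(\<lambda>x. indicator (A k) (t k + c * x)) \<in> borel_measurable lborel" by measurable
    qed simp
    also have "ennreal (\<bar>c\<bar> ^ n) * \<dots> = (\<Prod>k<n. ennreal \<bar>c\<bar> * (\<integral>\<^sup>+x. indicator (A k) (t k + c * x) \<partial>lborel))"
      by (simp add: prod.distrib ennreal_power)
    also have "\<dots> = (\<Prod>k<n. emeasure lborel (A k))"
    proof (intro prod.cong refl)
      fix k assume "k \<in> {..<n}"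
      then show "ennreal \<bar>c\<bar> * (\<integral>\<^sup>+x. indicator (A k) (t k + c * x) \<partial>lborel) = emeasure lborel (A k)"
        using A c by (subst nn_integral_real_affine[symmetric]) auto
    qed
    finally show "emeasure (density (distr (leb n) ?E ?a) (\<lambda>_. ennreal (\<bar>c\<bar> ^ n))) (Pi\<^sub>E {..<n} A) = (\<Prod>k<n. emeasure lborel (A k))" .
  qed (auto simp: sets_leb)
  then have "(\<integral>\<^sup>+x. F x \<partial>leb n) = (\<integral>\<^sup>+x. F x \<partial>density (distr (leb n) ?E ?a) (\<lambda>_. ennreal (\<bar>c\<bar> ^ n)))" by simp
  also have "\<dots> = (\<integral>\<^sup>+x. ennreal (\<bar>c\<bar> ^ n) * F x \<partial>distr (leb n) ?E ?a)" by (rule nn_integral_density) auto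
  also have "\<dots> = (\<integral>\<^sup>+x. ennreal (\<bar>c\<bar> ^ n) * F (?a x) \<partial>leb n)" by (rule nn_integral_distr) measurable
  also have "\<dots> = ennreal (\<bar>c\<bar> ^ n) * (\<integral>\<^sup>+x. F (?a x) \<partial>leb n)" by (rule nn_integral_cmult) measurable
  finally show ?thesis .
qed

lemma PiM_gauss_density:
  assumes v: "v > 0"
  shows "gauss_vec n v = density (leb n) (\<lambda>x. \<Prod>k<n. ennreal (normal_density 0 (sqrt v) (x k)))"
proof -
  interpret L: product_sigma_finite "\<lambda>_::nat. lborel :: real measure" ..
  interpret product_sigma_finite "\<lambda>_::nat. gauss v" by (rule product_sigma_finite_gauss)
  let ?w = "\<lambda>x. \<Prod>k<n. ennreal (normal_density 0 (sqrt v) (x k))"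
  note [measurable_cong] = sets_leb[of n]
  have w[measurable]: "?w \<in> borel_measurable (vecs n)"
    by (intro borel_measurable_prod_ennreal measurable_compose[OF measurable_component_singleton]) auto
  have "density (leb n) ?w = gauss_vec n v"
  proof (rule PiM_eqI)
    fix A :: "nat \<Rightarrow> real set" assume "\<And>i. i \<in> {..<n} \<Longrightarrow> A i \<in> sets (gauss v)"
    then have A: "\<And>i. i \<in> {..<n} \<Longrightarrow> A i \<in> sets borel" by simp
    have PA[measurable]: "Pi\<^sub>E {..<n} A \<in> sets (vecs n)" by (intro sets_PiM_I_finite A) auto
    have "emeasure (density (leb n) ?w) (Pi\<^sub>E {..<n} A) = (\<integral>\<^sup>+x. ?w x * indicator (Pi\<^sub>E {..<n} A) x \<partial>leb n)"
      by (rule emeasure_density) (auto simp: sets_leb)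
    also have "\<dots> = (\<integral>\<^sup>+x. (\<Prod>k<n. ennreal (normal_density 0 (sqrt v) (x k)) * indicator (A k) (x k)) \<partial>leb n)"
    proof (rule nn_integral_cong)
      fix x assume "x \<in> space (leb n)"
      then have "indicator (Pi\<^sub>E {..<n} A) x = (\<Prod>k<n. indicator (A k) (x k) :: ennreal)"
        by (auto simp: indicator_def PiE_iff space_PiM prod_zero_iff)
      then show "?w x * indicator (Pi\<^sub>E {..<n} A) x = (\<Prod>k<n. ennreal (normal_density 0 (sqrt v) (x k)) * indicator (A k) (x k))"
        by (simp add: prod.distrib)
    qed
    also have "\<dots> = (\<Prod>k<n. \<integral>\<^sup>+x. ennreal (normal_density 0 (sqrt v) x) * indicator (A k) x \<partial>lborel)"
    proof (intro L.product_nn_integral_prod)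
      fix k assume "k \<in> {..<n}"
      then have [measurable]: "A k \<in> sets borel" by (rule A)
      show "(\<lambda>x. ennreal (normal_density 0 (sqrt v) x) * indicator (A k) x) \<in> borel_measurable lborel" by measurable
    qed simp
    also have "\<dots> = (\<Prod>k<n. emeasure (gauss v) (A k))"
      using A v by (intro prod.cong refl) (auto simp: gauss_def emeasure_density)
    finally show "emeasure (density (leb n) ?w) (Pi\<^sub>E {..<n} A) = (\<Prod>k<n. emeasure (gauss v) (A k))" .
  qed (auto simp: sets_leb intro!: sets_PiM_cong)
  then show ?thesis by simp
qed

abbreviation heat :: "nat \<Rightarrow> real \<Rightarrow> (nat \<Rightarrow> real) \<Rightarrow> (nat \<Rightarrow> real) \<Rightarrow> ennreal" where
  "heat n v y x \<equiv> \<Prod>k<n. ennreal (normal_density 0 (sqrt v) (y k - x k))"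

text \<open>The density of the sum of a vector with law \<open>Q\<close> and an independent Gaussian vector. As \<open>Q\<close> may be degenerate,
  it is kept as an integral against \<open>Q\<close>.\<close>
definition smoothed :: "nat \<Rightarrow> (nat \<Rightarrow> real) measure \<Rightarrow> real \<Rightarrow> (nat \<Rightarrow> real) \<Rightarrow> ennreal" where
  "smoothed n Q v y = (\<integral>\<^sup>+x. (heat n v y x) \<partial>Q)"

lemma smoothed_kernel_measurable:
  assumes [measurable_cong]: "sets Q = sets (vecs n)"
  shows "(\<lambda>(y, x). heat n v y x) \<in> borel_measurable (vecs n \<Otimes>\<^sub>M Q)"
  unfolding case_prod_beta
proof (rule borel_measurable_prod_ennreal)
  fix k assume k: "k \<in> {..<n}"
  have [measurable]: "(\<lambda>z. fst z k) \<in> borel_measurable (vecs n \<Otimes>\<^sub>M Q)"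
    by (intro measurable_compose[OF measurable_fst measurable_component_singleton[OF k]])
  have "(\<lambda>x. x k) \<in> borel_measurable Q" 
    using measurable_component_singleton[OF k, of "\<lambda>_. borel :: real measure"] by measurable
  then have [measurable]: "(\<lambda>z. snd z k) \<in> borel_measurable (vecs n \<Otimes>\<^sub>M Q)"
    by (intro measurable_compose[OF measurable_snd])
  show "(\<lambda>z. ennreal (normal_density 0 (sqrt v) (fst z k - snd z k))) \<in> borel_measurable (vecs n \<Otimes>\<^sub>M Q)"
    by measurable
qed

lemma smoothed_measurable:
  assumes "sets Q = sets (vecs n)" "prob_space Q"
  shows "smoothed n Q v \<in> borel_measurable (vecs n)"
proof -
  interpret prob_space Q by fact
  show ?thesis
    unfolding smoothed_def[abs_def]
    by (rule borel_measurable_nn_integral[OF smoothed_kernel_measurable[OF assms(1)]])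
qed

lemma add_gauss_density:
  assumes sQ: "sets Q = sets (vecs n)" and pQ: "prob_space Q" and v: "v > 0"
  shows "distr (Q \<Otimes>\<^sub>M gauss_vec n v) (vecs n) (\<lambda>(x, g). \<lambda>k\<in>{..<n}. x k + g k)
     = density (leb n) (smoothed n Q v)" (is "?D = _")
proof (rule measure_eqI)
  let ?E = "vecs n"
  let ?a = "\<lambda>(x, g). \<lambda>k\<in>{..<n}. x k + g k :: real"
  let ?w = "\<lambda>x. \<Prod>k<n. ennreal (normal_density 0 (sqrt v) (x k))"
  interpret Q: prob_space Q by fact
  interpret L: sigma_finite_measure "leb n" by (rule sigma_finite_leb)
  interpret G: prob_space "gauss_vec n v" by (intro prob_space_PiM prob_space_gauss)
  interpret QL: pair_sigma_finite Q "leb n" ..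
  note [measurable_cong] = sQ sets_leb[of n]
  have [measurable_cong]: "sets (gauss_vec n v) = sets ?E" by (intro sets_PiM_cong) auto
  note smoothed_measurable[OF sQ pQ, measurable]
  have a[measurable]: "?a \<in> ?E \<Otimes>\<^sub>M ?E \<rightarrow>\<^sub>M ?E"
    unfolding case_prod_beta
    by (intro measurable_restrict borel_measurable_add measurable_compose[OF measurable_fst measurable_component_singleton]
        measurable_compose[OF measurable_snd measurable_component_singleton])
  have w[measurable]: "?w \<in> borel_measurable ?E"
    by (intro borel_measurable_prod_ennreal measurable_compose[OF measurable_component_singleton]) auto
  fix A assume "A \<in> sets ?D"
  then have A[measurable]: "A \<in> sets ?E" by simp
  have "emeasure ?D A = (\<integral>\<^sup>+z. indicator A z \<partial>?D)" by simp
  also have "\<dots> = (\<integral>\<^sup>+z. indicator A (?a z) \<partial>(Q \<Otimes>\<^sub>M gauss_vec n v))"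
    by (rule nn_integral_distr) measurable
  also have "\<dots> = (\<integral>\<^sup>+x. \<integral>\<^sup>+g. indicator A (?a (x, g)) \<partial>gauss_vec n v \<partial>Q)"
    by (rule G.nn_integral_fst[symmetric]) measurable
  also have "\<dots> = (\<integral>\<^sup>+x. \<integral>\<^sup>+y. (heat n v y x) * indicator A y \<partial>leb n \<partial>Q)"
  proof (rule nn_integral_cong)
    fix x assume "x \<in> space Q"
    then have x: "x \<in> space ?E" using sets_eq_imp_space_eq[OF sQ] by simp
    have [measurable]: "(\<lambda>g. ?a (x, g)) \<in> ?E \<rightarrow>\<^sub>M ?E"
      using measurable_compose[OF measurable_Pair1'[OF x] a] by simp
    have [measurable]: "(\<lambda>y. heat n v y x) \<in> borel_measurable ?E"
      by (intro borel_measurable_prod_ennreal measurable_compose[OF measurable_component_singleton]) auto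
    have "(\<integral>\<^sup>+g. indicator A (?a (x, g)) \<partial>gauss_vec n v) = (\<integral>\<^sup>+g. ?w g * indicator A (?a (x, g)) \<partial>leb n)"
      unfolding PiM_gauss_density[OF v] by (rule nn_integral_density) measurable
    also have "\<dots> = (\<integral>\<^sup>+g. (\<Prod>k<n. ennreal (normal_density 0 (sqrt v) ((\<lambda>k\<in>{..<n}. x k + 1 * g k) k - x k))) * indicator A (\<lambda>k\<in>{..<n}. x k + 1 * g k) \<partial>leb n)"
      by (intro nn_integral_cong) simp
    also have "\<dots> = (\<integral>\<^sup>+y. (heat n v y x) * indicator A y \<partial>leb n)"
      by (subst leb_affine[where c=1 and t=x]) auto
    finally show "(\<integral>\<^sup>+g. indicator A (?a (x, g)) \<partial>gauss_vec n v) = \<dots>" .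
  qed
  also have "\<dots> = (\<integral>\<^sup>+y. \<integral>\<^sup>+x. (heat n v y x) * indicator A y \<partial>Q \<partial>leb n)"
  proof (rule QL.Fubini'[symmetric])
    have [measurable]: "(\<lambda>(y, x). heat n v y x) \<in> borel_measurable (?E \<Otimes>\<^sub>M Q)"
      by (rule smoothed_kernel_measurable[OF sQ])
    have "(\<lambda>z. (\<lambda>(y, x). heat n v y x) (snd z, fst z)) \<in> borel_measurable (Q \<Otimes>\<^sub>M leb n)"
      by (rule measurable_compose[OF _ smoothed_kernel_measurable[OF sQ]]) measurable
    then show "(\<lambda>(x, y). (heat n v y x) * indicator A y) \<in> borel_measurable (Q \<Otimes>\<^sub>M leb n)"
      by (simp add: case_prod_beta)
  qed
  also have "\<dots> = (\<integral>\<^sup>+y. smoothed n Q v y * indicator A y \<partial>leb n)"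
  proof (rule nn_integral_cong)
    fix y assume "y \<in> space (leb n)"
    then have y: "y \<in> space ?E" by (simp add: space_PiM)
    have "(\<lambda>x. heat n v y x) \<in> borel_measurable Q"
      using measurable_compose[OF measurable_Pair1'[OF y] smoothed_kernel_measurable[OF sQ]] by simp
    then show "(\<integral>\<^sup>+x. (heat n v y x) * indicator A y \<partial>Q) = smoothed n Q v y * indicator A y"
      unfolding smoothed_def by (rule nn_integral_multc)
  qed
  also have "\<dots> = emeasure (density (leb n) (smoothed n Q v)) A"
    by (rule emeasure_density[symmetric]) (auto simp: sets_leb intro: smoothed_measurable[OF sQ pQ])
  finally show "emeasure ?D A = \<dots>" .
qed (simp add: sets_leb)

section \<open>The last segment seen from its end\<close>

text \<open>From the initial state \<open>y\<close>, the walk with increments \<open>d\<close> exceeds the level \<open>g j\<close> in all coordinates for some \<open>j\<close> in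
  \<open>J\<close>. The set \<open>J\<close> is the whole grid for the window and only the last index for the event at time \<open>T\<close>.\<close>
definition hits :: "nat \<Rightarrow> nat set \<Rightarrow> (nat \<Rightarrow> real) \<Rightarrow> (nat \<Rightarrow> real) \<Rightarrow> (nat \<times> nat \<Rightarrow> real) \<Rightarrow> bool" where
  "hits n J g y d \<longleftrightarrow> (\<exists>j\<in>J. \<forall>k<n. g j < y k + (\<Sum>i<j. d (k, i)))"

lemma hits_measurable[measurable]:
  assumes J: "J \<subseteq> {..m}"
  shows "{z \<in> space (vecs n \<Otimes>\<^sub>M incs n m). hits n J g (fst z) (snd z)}
     \<in> sets (vecs n \<Otimes>\<^sub>M incs n m)" (is "?A \<in> sets ?N")
proof -
  have "?A = (\<Union>j\<in>J. {z \<in> space ?N. \<forall>k\<in>{..<n}. g j < fst z k + (\<Sum>i<j. snd z (k, i))})"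
    by (auto simp: hits_def)
  also have "\<dots> \<in> sets ?N"
  proof (intro sets.finite_UN sets.sets_Collect_finite_All borel_measurable_less borel_measurable_const borel_measurable_add borel_measurable_sum)
    show "finite J" using J finite_subset by blast
    fix j k assume j: "j \<in> J" and k: "k \<in> {..<n}"
    show "(\<lambda>z. fst z k) \<in> borel_measurable ?N"
      by (intro measurable_compose[OF measurable_fst] measurable_component_singleton k)
    fix i assume "i \<in> {..<j}"
    then have "(k, i) \<in> steps n m" using j k J by auto
    then show "(\<lambda>z. snd z (k, i)) \<in> borel_measurable ?N"
      by (intro measurable_compose[OF measurable_snd] measurable_component_singleton)
  qed auto
  finally show ?thesis .
qed

lemma (in prob_space) distr_pair_snd:
  assumes "sigma_finite_measure N"
  shows "distr (M \<Otimes>\<^sub>M N) N snd = N"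
proof (rule measure_eqI)
  interpret N: sigma_finite_measure N by fact
  fix A assume "A \<in> sets (distr (M \<Otimes>\<^sub>M N) N snd)"
  then have A: "A \<in> sets N" by simp
  have "snd -` A \<inter> space (M \<Otimes>\<^sub>M N) = space M \<times> A"
    using sets.sets_into_space[OF A] by (auto simp: space_pair_measure)
  then show "emeasure (distr (M \<Otimes>\<^sub>M N) N snd) A = emeasure N A"
    using A by (simp add: emeasure_distr N.emeasure_pair_measure_Times emeasure_space_1)
qed simp

text \<open>The change of measure on a grid. The state \<open>y\<close> at the start of the grid and the increments \<open>d\<close> are shifted so
  that the mean at time \<open>j\<close> is \<open>a - b s\<close>, where \<open>s = (m - j) \<delta>\<close> is the time to the end. Then the threshold
  \<open>a - c s\<close> turns into \<open>(b - c) s\<close>. Finally the integral over the initial state is replaced by one over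
  the negative \<open>z\<close> of the final state.\<close>
lemma tilted_window:
  assumes Q: "tilt n s Q" and pQ: "prob_space Q" and Qd: "Q = density (leb n) f"
    and f[measurable]: "f \<in> borel_measurable (vecs n)"
    and \<delta>: "\<delta> \<ge> 0" and J: "J \<subseteq> {..m}"
    and a: "a = b * (s + real m * \<delta>)"
  shows "emeasure (Q \<Otimes>\<^sub>M gauss_steps n m \<delta>)
      {z \<in> space (Q \<Otimes>\<^sub>M gauss_steps n m \<delta>). hits n J (\<lambda>j. a - c * (real (m - j) * \<delta>)) (fst z) (snd z)}
    = (\<integral>\<^sup>+z. \<integral>\<^sup>+d. ennreal (exp (b * (\<Sum>k<n. z k) - real n * b\<^sup>2 * (s + real m * \<delta>) / 2))
          * f (\<lambda>k\<in>{..<n}. - (\<Sum>i<m. d (k, i)) + (- 1) * z k)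
          * (if \<exists>j\<in>J. \<forall>k<n. z k < - (\<Sum>i=j..<m. d (k, i)) - (b - c) * (real (m - j) * \<delta>) then 1 else 0)
        \<partial>gauss_steps n m \<delta> \<partial>leb n)"
proof -
  let ?E = "vecs n" and ?S = "incs n m"
  let ?G = "gauss_steps n m \<delta>"
  let ?g1 = "\<lambda>j. a - c * (real (m - j) * \<delta>)" and ?g2 = "\<lambda>j. (b - c) * (real (m - j) * \<delta>)"
  let ?I = "\<lambda>g y d. if hits n J g y d then 1 else 0 :: ennreal"
  let ?w = "\<lambda>y d. ennreal (exp (- b * (\<Sum>k<n. y k + (\<Sum>i<m. d (k, i))) - real n * b\<^sup>2 * (s + real m * \<delta>) / 2))"
  let ?y = "\<lambda>z d. \<lambda>k\<in>{..<n}. - (\<Sum>i<m. d (k, i)) + (- 1) * z k"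
  let ?R = "\<lambda>z d. \<exists>j\<in>J. \<forall>k<n. z k < - (\<Sum>i=j..<m. d (k, i)) - (b - c) * (real (m - j) * \<delta>)"
  let ?e = "\<lambda>z. ennreal (exp (b * (\<Sum>k<n. z k) - real n * b\<^sup>2 * (s + real m * \<delta>) / 2))"
  interpret Q: prob_space Q by fact
  interpret L: sigma_finite_measure "leb n" by (rule sigma_finite_leb)
  interpret G: prob_space ?G by (rule prob_space_gauss_steps)
  interpret LG: pair_sigma_finite "leb n" ?G ..
  have sG: "sets ?G = sets ?S" by (intro sets_PiM_cong) auto
  note [measurable_cong] = sG sets_leb[of n] tilt_sets[OF Q]
  have spQ: "space Q = space ?E" by (rule sets_eq_imp_space_eq[OF tilt_sets[OF Q]])
  have spG: "space ?G = space ?S" by (rule sets_eq_imp_space_eq[OF sG])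
  have H[measurable]: "Measurable.pred (?E \<Otimes>\<^sub>M ?S) (\<lambda>z. hits n J g (fst z) (snd z))" for g
    using hits_measurable[OF J] by (simp add: pred_def)
  have Im[measurable]: "(\<lambda>z. ?I g (fst z) (snd z)) \<in> borel_measurable (?E \<Otimes>\<^sub>M ?S)" for g by measurable
  have Imd: "(\<lambda>d. ?I g y d) \<in> borel_measurable ?S" if "y \<in> space ?E" for g y
    using measurable_compose[OF measurable_Pair1'[OF that] Im[of g]] by simp
  have Sm[measurable]: "(\<lambda>d. \<Sum>i<m. d (k, i)) \<in> borel_measurable ?S" if "k < n" for k
    by (intro borel_measurable_sum measurable_component_singleton) (use that in auto)
  have Sm2: "(\<lambda>z. \<Sum>k<n. fst z k + (\<Sum>i<m. snd z (k, i))) \<in> borel_measurable (?E \<Otimes>\<^sub>M ?S)"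
    by (intro borel_measurable_sum borel_measurable_add measurable_compose[OF measurable_fst measurable_component_singleton]
        measurable_compose[OF measurable_snd measurable_component_singleton]) auto
  have wm[measurable]: "(\<lambda>z. ?w (fst z) (snd z)) \<in> borel_measurable (?E \<Otimes>\<^sub>M ?S)"
    using Sm2 by measurable
  have wmd: "(\<lambda>d. ?w y d) \<in> borel_measurable ?S" if "y \<in> space ?E" for y
    using measurable_compose[OF measurable_Pair1'[OF that] wm] by simp
  have "emeasure (Q \<Otimes>\<^sub>M ?G) {z \<in> space (Q \<Otimes>\<^sub>M ?G). hits n J ?g1 (fst z) (snd z)}
     = (\<integral>\<^sup>+z. ?I ?g1 (fst z) (snd z) \<partial>(Q \<Otimes>\<^sub>M ?G))"
  proof -
    have "{z \<in> space (Q \<Otimes>\<^sub>M ?G). hits n J ?g1 (fst z) (snd z)} \<in> sets (Q \<Otimes>\<^sub>M ?G)" by measurable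
    then have "emeasure (Q \<Otimes>\<^sub>M ?G) {z \<in> space (Q \<Otimes>\<^sub>M ?G). hits n J ?g1 (fst z) (snd z)}
      = (\<integral>\<^sup>+z. indicator {z \<in> space (Q \<Otimes>\<^sub>M ?G). hits n J ?g1 (fst z) (snd z)} z \<partial>(Q \<Otimes>\<^sub>M ?G))"
      by (rule nn_integral_indicator[symmetric])
    also have "\<dots> = (\<integral>\<^sup>+z. ?I ?g1 (fst z) (snd z) \<partial>(Q \<Otimes>\<^sub>M ?G))"
      by (intro nn_integral_cong) (simp add: indicator_def)
    finally show ?thesis .
  qed
  also have "\<dots> = (\<integral>\<^sup>+y. \<integral>\<^sup>+d. ?I ?g1 y d \<partial>?G \<partial>Q)"
    by (subst G.nn_integral_fst[symmetric]) auto
  \<comment> \<open>Shift the initial state, then the increments, and collect the two likelihood ratios in \<open>?w\<close>.\<close>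
  also have "\<dots> = (\<integral>\<^sup>+y. (\<integral>\<^sup>+d. ?I ?g1 (\<lambda>k\<in>{..<n}. y k + b * s) d \<partial>?G)
       * ennreal (exp (- b * (\<Sum>k<n. y k) - real n * b\<^sup>2 * s / 2)) \<partial>Q)"
  proof (rule tiltD[OF Q])
    have "(\<lambda>(y, d). ?I ?g1 y d) \<in> borel_measurable (?E \<Otimes>\<^sub>M ?G)"
      using Im[of ?g1] by (simp add: case_prod_beta cong: measurable_cong_sets)
    then show "(\<lambda>y. \<integral>\<^sup>+d. ?I ?g1 y d \<partial>?G) \<in> borel_measurable ?E"
      by (rule G.borel_measurable_nn_integral)
  qed
  also have "\<dots> = (\<integral>\<^sup>+y. \<integral>\<^sup>+d. ?I ?g2 y d * ?w y d \<partial>?G \<partial>Q)"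
  proof (rule nn_integral_cong)
    fix y assume "y \<in> space Q"
    then have y: "y \<in> space ?E" by (simp add: spQ)
    have y': "(\<lambda>k\<in>{..<n}. y k + b * s) \<in> space ?E" by (auto simp: space_PiM)
    let ?w2 = "\<lambda>d. ennreal (exp (- b * (\<Sum>p\<in>steps n m. d p) - b\<^sup>2 * (\<Sum>p\<in>steps n m. \<delta>) / 2))"
    have "(\<integral>\<^sup>+d. ?I ?g1 (\<lambda>k\<in>{..<n}. y k + b * s) d \<partial>?G)
      = (\<integral>\<^sup>+d. ?I ?g1 (\<lambda>k\<in>{..<n}. y k + b * s) (\<lambda>p\<in>steps n m. d p + b * \<delta>) * ?w2 d \<partial>?G)"
      by (rule PiM_gauss_cameron_martin) (use \<delta> Imd[OF y'] in auto)
    also have "\<dots> = (\<integral>\<^sup>+d. ?I ?g2 y d * ?w2 d \<partial>?G)"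
    proof (intro nn_integral_cong arg_cong2[where f="(*)"] refl if_cong)
      fix d
      show "hits n J ?g1 (\<lambda>k\<in>{..<n}. y k + b * s) (\<lambda>p\<in>steps n m. d p + b * \<delta>) = hits n J ?g2 y d"
        unfolding hits_def
      proof (intro bex_cong refl all_cong1 imp_cong)
        fix j k assume j: "j \<in> J" and k: "k < n"
        then have jm: "j \<le> m" using J by auto
        have "(\<Sum>i<j. (\<lambda>p\<in>steps n m. d p + b * \<delta>) (k, i)) = (\<Sum>i<j. d (k, i) + b * \<delta>)"
          using jm k by (intro sum.cong) auto
        also have "\<dots> = (\<Sum>i<j. d (k, i)) + real j * (b * \<delta>)" by (simp add: sum.distrib)
        finally show "(?g1 j < (\<lambda>k\<in>{..<n}. y k + b * s) k + (\<Sum>i<j. (\<lambda>p\<in>steps n m. d p + b * \<delta>) (k, i))) =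
           (?g2 j < y k + (\<Sum>i<j. d (k, i)))"
          using jm k unfolding a by (simp add: of_nat_diff algebra_simps)
      qed
    qed
    finally have "(\<integral>\<^sup>+d. ?I ?g1 (\<lambda>k\<in>{..<n}. y k + b * s) d \<partial>?G) * ennreal (exp (- b * (\<Sum>k<n. y k) - real n * b\<^sup>2 * s / 2))
      = (\<integral>\<^sup>+d. ?I ?g2 y d * ?w2 d \<partial>?G) * ennreal (exp (- b * (\<Sum>k<n. y k) - real n * b\<^sup>2 * s / 2))" by simp
    also have "\<dots> = (\<integral>\<^sup>+d. ?I ?g2 y d * ?w2 d * ennreal (exp (- b * (\<Sum>k<n. y k) - real n * b\<^sup>2 * s / 2)) \<partial>?G)"
    proof (rule nn_integral_multc[symmetric])
      note [measurable] = Imd[OF y]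
      have "(\<lambda>d. \<Sum>p\<in>steps n m. d p) \<in> borel_measurable ?S"
        by (intro borel_measurable_sum measurable_component_singleton)
      then show "(\<lambda>d. ?I ?g2 y d * ?w2 d) \<in> borel_measurable ?G" by measurable
    qed
    also have "\<dots> = (\<integral>\<^sup>+d. ?I ?g2 y d * ?w y d \<partial>?G)"
    proof (intro nn_integral_cong)
      fix d :: "nat \<times> nat \<Rightarrow> real"
      have "(\<Sum>p\<in>steps n m. d p) = (\<Sum>k<n. \<Sum>i<m. d (k, i))" by (simp add: sum.cartesian_product)
      then have "?w2 d * ennreal (exp (- b * (\<Sum>k<n. y k) - real n * b\<^sup>2 * s / 2)) = ?w y d"
        by (subst ennreal_mult'[symmetric]) (auto simp: exp_add[symmetric] sum.distrib algebra_simps add_divide_distrib)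
      then show "?I ?g2 y d * ?w2 d * ennreal (exp (- b * (\<Sum>k<n. y k) - real n * b\<^sup>2 * s / 2)) = ?I ?g2 y d * ?w y d"
        by (simp only: mult.assoc)
    qed
    finally show "(\<integral>\<^sup>+d. ?I ?g1 (\<lambda>k\<in>{..<n}. y k + b * s) d \<partial>?G) * ennreal (exp (- b * (\<Sum>k<n. y k) - real n * b\<^sup>2 * s / 2)) = \<dots>" .
  qed
  also have "\<dots> = (\<integral>\<^sup>+y. f y * (\<integral>\<^sup>+d. ?I ?g2 y d * ?w y d \<partial>?G) \<partial>leb n)"
  proof -
    have "(\<lambda>(y, d). ?I ?g2 y d * ?w y d) \<in> borel_measurable (?E \<Otimes>\<^sub>M ?S)"
      unfolding case_prod_beta by measurable
    then have "(\<lambda>(y, d). ?I ?g2 y d * ?w y d) \<in> borel_measurable (?E \<Otimes>\<^sub>M ?G)"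
      by (simp cong: measurable_cong_sets)
    then have [measurable]: "(\<lambda>y. \<integral>\<^sup>+d. ?I ?g2 y d * ?w y d \<partial>?G) \<in> borel_measurable ?E"
      by (rule G.borel_measurable_nn_integral)
    show ?thesis unfolding Qd by (rule nn_integral_density) measurable
  qed
  also have "\<dots> = (\<integral>\<^sup>+y. \<integral>\<^sup>+d. f y * (?I ?g2 y d * ?w y d) \<partial>?G \<partial>leb n)"
  proof (rule nn_integral_cong)
    fix y assume "y \<in> space (leb n)"
    then have "y \<in> space ?E" by (simp add: space_PiM)
    note [measurable] = Imd[OF this] wmd[OF this]
    show "f y * (\<integral>\<^sup>+d. ?I ?g2 y d * ?w y d \<partial>?G) = (\<integral>\<^sup>+d. f y * (?I ?g2 y d * ?w y d) \<partial>?G)"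
      by (rule nn_integral_cmult[symmetric]) measurable
  qed
  also have "\<dots> = (\<integral>\<^sup>+d. \<integral>\<^sup>+y. f y * (?I ?g2 y d * ?w y d) \<partial>leb n \<partial>?G)"
    by (rule LG.Fubini'[symmetric]) (unfold case_prod_beta, measurable)
  also have "\<dots> = (\<integral>\<^sup>+d. \<integral>\<^sup>+z. ?e z * f (?y z d) * (if ?R z d then 1 else 0) \<partial>leb n \<partial>?G)"
  proof (rule nn_integral_cong)
    fix d assume "d \<in> space ?G"
    then have d: "d \<in> space ?S" by (simp add: spG)
    have [measurable]: "(\<lambda>y. ?I ?g2 y d) \<in> borel_measurable ?E" "(\<lambda>y. ?w y d) \<in> borel_measurable ?E"
      using measurable_compose[OF measurable_Pair2'[OF d] Im[of ?g2]] measurable_compose[OF measurable_Pair2'[OF d] wm] by simp_all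
    \<comment> \<open>The reflection \<open>y = - D - z\<close>, where \<open>D\<close> is the sum of all increments; then \<open>z\<close> is minus the final state.\<close>
    have "(\<integral>\<^sup>+y. f y * (?I ?g2 y d * ?w y d) \<partial>leb n) = ennreal (\<bar>- 1\<bar> ^ n) * (\<integral>\<^sup>+z. f (?y z d) * (?I ?g2 (?y z d) d * ?w (?y z d) d) \<partial>leb n)"
      by (rule leb_affine) (simp, measurable)
    also have "\<dots> = (\<integral>\<^sup>+z. f (?y z d) * (?I ?g2 (?y z d) d * ?w (?y z d) d) \<partial>leb n)" by simp
    also have "\<dots> = (\<integral>\<^sup>+z. ?e z * f (?y z d) * (if ?R z d then 1 else 0) \<partial>leb n)"
    proof (rule nn_integral_cong)
      fix z
      have w: "?w (?y z d) d = ?e z"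
        by (simp add: sum_negf)
      have "hits n J ?g2 (?y z d) d \<longleftrightarrow> (?R z d)"
        unfolding hits_def
      proof (intro bex_cong refl all_cong1 imp_cong)
        fix j k assume j: "j \<in> J" and k: "k < n"
        then have jm: "j \<le> m" using J by auto
        have "(\<Sum>i<m. d (k, i)) = (\<Sum>i<j. d (k, i)) + (\<Sum>i=j..<m. d (k, i))"
          using jm sum.atLeastLessThan_concat[of 0 j m "\<lambda>i. d (k, i)"] by (simp add: atLeast0LessThan)
        then show "(?g2 j < ?y z d k + (\<Sum>i<j. d (k, i))) = (z k < - (\<Sum>i=j..<m. d (k, i)) - (b - c) * (real (m - j) * \<delta>))"
          using k by auto
      qed
      then show "f (?y z d) * (?I ?g2 (?y z d) d * ?w (?y z d) d) = ?e z * f (?y z d) * (if ?R z d then 1 else 0)"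
        unfolding w by (simp only: ac_simps)
    qed
    finally show "(\<integral>\<^sup>+y. f y * (?I ?g2 y d * ?w y d) \<partial>leb n) = \<dots>" .
  qed
  also have "\<dots> = (\<integral>\<^sup>+z. \<integral>\<^sup>+d. ?e z * f (?y z d) * (if ?R z d then 1 else 0) \<partial>?G \<partial>leb n)"
  proof (rule LG.Fubini')
    have zk[measurable]: "(\<lambda>p. fst p k) \<in> borel_measurable (?E \<Otimes>\<^sub>M ?S)" if "k < n" for k
      by (intro measurable_compose[OF measurable_fst measurable_component_singleton]) (use that in auto)
    have dk: "(\<lambda>p. snd p (k, i)) \<in> borel_measurable (?E \<Otimes>\<^sub>M ?S)" if "k < n" "i < m" for k i
      by (intro measurable_compose[OF measurable_snd measurable_component_singleton]) (use that in auto)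
    have [measurable]: "(\<lambda>p. \<lambda>k\<in>{..<n}. - (\<Sum>i<m. snd p (k, i)) + (- 1) * fst p k) \<in> ?E \<Otimes>\<^sub>M ?S \<rightarrow>\<^sub>M ?E"
      by (intro measurable_restrict borel_measurable_add borel_measurable_uminus borel_measurable_sum borel_measurable_times borel_measurable_const dk zk) auto
    have [measurable]: "(\<lambda>p. \<Sum>k<n. fst p k) \<in> borel_measurable (?E \<Otimes>\<^sub>M ?S)"
      by (intro borel_measurable_sum zk) auto
    have "{p \<in> space (?E \<Otimes>\<^sub>M ?S). \<exists>j\<in>J. \<forall>k\<in>{..<n}. fst p k < - (\<Sum>i=j..<m. snd p (k, i)) - (b - c) * (real (m - j) * \<delta>)} \<in> sets (?E \<Otimes>\<^sub>M ?S)"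
    proof (intro sets.sets_Collect_finite_Ex sets.sets_Collect_finite_All borel_measurable_less borel_measurable_const borel_measurable_diff
        borel_measurable_uminus borel_measurable_sum zk dk)
      show "finite J" using J finite_subset by blast
    qed auto
    then have [measurable]: "Measurable.pred (?E \<Otimes>\<^sub>M ?S) (\<lambda>p. ?R (fst p) (snd p))"
      by (simp add: pred_def Ball_def)
    show "(\<lambda>(z, d). ?e z * f (?y z d) * (if ?R z d then 1 else 0)) \<in> borel_measurable (leb n \<Otimes>\<^sub>M ?G)"
      unfolding case_prod_beta by measurable
  qed
  finally show ?thesis .
qed

context brownian_tree begin

abbreviation "n \<equiv> P \<eta>"
abbreviation "L \<equiv> T - \<tau> \<eta>"
abbreviation "\<mu> \<equiv> xvar \<eta> + L"
abbreviation "QX \<equiv> distr M (vecs n) (\<lambda>\<omega>. \<lambda>k\<in>{..<n}. X \<eta> \<omega> k)"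
abbreviation "\<beta> \<equiv> B' \<eta>"

text \<open>Backwards from the end of the last segment, all coordinates exceed \<open>z\<close> plus a line of slope \<open>g\<close> at the same
  time, which is at most \<open>h\<close>.\<close>
abbreviation reach :: "real \<Rightarrow> real \<Rightarrow> (nat \<Rightarrow> real) \<Rightarrow> 'a \<Rightarrow> bool" where
  "reach h g z \<omega> \<equiv> \<exists>s\<in>{0..h}. \<forall>k<n. z k < \<beta> k (L - s) \<omega> - \<beta> k L \<omega> - g * s"

lemma L_pos: "L > 0" using \<tau>T by simp

lemma prob_space_QX: "prob_space QX"
  by (intro prob_space_distr Xvec_measurable) simp

lemma Z_density:
  assumes t: "t > 0"
  shows "distr M (vecs n) (\<lambda>\<omega>. \<lambda>k\<in>{..<n}. Z \<eta> t \<omega> k) = density (leb n) (smoothed n QX t)"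
  unfolding Z_law[OF order_refl less_imp_le[OF t]]
  by (rule add_gauss_density[OF _ prob_space_QX t]) simp

text \<open>The weight that the change of measure leaves: the likelihood ratio and the density of the state at \<open>T - h\<close>,
  which is recovered from the final state \<open>- z\<close> and the increment of the last segment after \<open>T - h\<close>.\<close>
definition kernel :: "real \<Rightarrow> real \<Rightarrow> (nat \<Rightarrow> real) \<Rightarrow> 'a \<Rightarrow> ennreal" where
  "kernel b h z \<omega> = ennreal (exp (b * (\<Sum>k<n. z k) - real n * b\<^sup>2 * \<mu> / 2))
      * smoothed n QX (L - h) (\<lambda>k\<in>{..<n}. - (\<beta> k L \<omega> - \<beta> k (L - h) \<omega>) + (- 1) * z k)"

lemma kernel_measurable:
  assumes h: "0 \<le> h" "h \<le> L"
  shows "(\<lambda>(z, \<omega>). kernel b h z \<omega>) \<in> borel_measurable (leb n \<Otimes>\<^sub>M M)"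
proof -
  note [measurable_cong] = sets_leb[of n]
  have [measurable]: "smoothed n QX (L - h) \<in> borel_measurable (vecs n)"
    by (rule smoothed_measurable[OF _ prob_space_QX]) simp
  have [measurable]: "(\<lambda>p. fst p k) \<in> borel_measurable (vecs n \<Otimes>\<^sub>M M)" if "k < n" for k
    by (intro measurable_compose[OF measurable_fst measurable_component_singleton]) (use that in auto)
  have [measurable]: "(\<lambda>p. \<Sum>k<n. fst p k) \<in> borel_measurable (vecs n \<Otimes>\<^sub>M M)" by measurable
  have [measurable]: "(\<lambda>p. \<lambda>k\<in>{..<n}. - (\<beta> k L (snd p) - \<beta> k (L - h) (snd p)) + (- 1) * fst p k) \<in> vecs n \<Otimes>\<^sub>M M \<rightarrow>\<^sub>M vecs n"
  proof (intro measurable_restrict)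
    fix k assume k: "k \<in> {..<n}"
    have [measurable]: "\<beta> k L \<in> borel_measurable M" "\<beta> k (L - h) \<in> borel_measurable M"
      using k h by (auto intro!: B'_measurable)
    have [measurable]: "(\<lambda>p. fst p k) \<in> borel_measurable (vecs n \<Otimes>\<^sub>M M)"
      by (intro measurable_compose[OF measurable_fst measurable_component_singleton] k)
    show "(\<lambda>p. - (\<beta> k L (snd p) - \<beta> k (L - h) (snd p)) + (- 1) * fst p k) \<in> borel_measurable (vecs n \<Otimes>\<^sub>M M)" by measurable
  qed
  show ?thesis unfolding kernel_def case_prod_beta by measurable
qed

lemma increments_law:
  assumes t: "t \<ge> 0" and \<delta>: "\<delta> > 0" and m: "m > 0"
  shows "distr M (incs n m)
      (\<lambda>\<omega>. \<lambda>(k, j)\<in>steps n m. \<beta> k (t + real (Suc j) * \<delta>) \<omega> - \<beta> k (t + real j * \<delta>) \<omega>) = gauss_steps n m \<delta>"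
    (is "distr M ?S ?D = ?G")
proof -
  let ?Z = "\<lambda>\<omega>. \<lambda>k\<in>{..<n}. Z \<eta> t \<omega> k"
  have Zm: "?Z \<in> M \<rightarrow>\<^sub>M vecs n" by (rule Zvec_measurable[OF order_refl t])
  have Dm: "?D \<in> M \<rightarrow>\<^sub>M ?S"
    unfolding case_prod_beta
    by (intro measurable_restrict borel_measurable_diff B'_measurable) (use t \<delta> in auto)
  interpret Q: prob_space "distr M (vecs n) ?Z" by (rule prob_space_distr[OF Zm])
  interpret G: prob_space ?G by (rule prob_space_gauss_steps)
  have "?G = distr (distr M (vecs n) ?Z \<Otimes>\<^sub>M ?G) ?G snd"
    by (rule Q.distr_pair_snd[OF G.sigma_finite_measure_axioms, symmetric])
  also have "\<dots> = distr (distr M (vecs n) ?Z \<Otimes>\<^sub>M ?G) ?S snd" by (intro distr_cong refl sets_PiM_cong) auto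
  also have "\<dots> = distr M ?S ?D"
    unfolding segment_law[OF order_refl t \<delta> m, symmetric] distr_distr[OF measurable_snd measurable_Pair[OF Zm Dm]]
    by (simp add: comp_def)
  finally show ?thesis by simp
qed

lemma window_grid:
  assumes h: "0 < h" "h < L" and m: "m > 0" and J: "J \<subseteq> {..m}" and b: "b * \<mu> = a"
  defines "s j \<equiv> real (m - j) * (h / real m)"
  shows "emeasure M {\<omega> \<in> space M. \<exists>j\<in>J. \<forall>k<n. a - c * s j < Z \<eta> (L - s j) \<omega> k}
    = (\<integral>\<^sup>+z. \<integral>\<^sup>+\<omega>. kernel b h z \<omega> * (if \<exists>j\<in>J. \<forall>k<n. z k < \<beta> k (L - s j) \<omega> - \<beta> k L \<omega> - (b - c) * s j then 1 else 0) \<partial>M \<partial>leb n)"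
proof -
  let ?\<delta> = "h / real m"
  let ?D = "\<lambda>\<omega>. \<lambda>(k, j)\<in>steps n m. \<beta> k (L - h + real (Suc j) * ?\<delta>) \<omega> - \<beta> k (L - h + real j * ?\<delta>) \<omega>"
  let ?Z = "\<lambda>\<omega>. \<lambda>k\<in>{..<n}. Z \<eta> (L - h) \<omega> k"
  let ?S = "incs n m"
  let ?Q = "distr M (vecs n) ?Z" and ?G = "gauss_steps n m ?\<delta>"
  let ?f = "smoothed n QX (L - h)"
  have \<delta>: "?\<delta> > 0" and m\<delta>: "real m * ?\<delta> = h" using h m by auto
  have Lh: "L - h > 0" using h by simp
  have Zm: "?Z \<in> M \<rightarrow>\<^sub>M vecs n" by (rule Zvec_measurable) (use h in auto)
  have Dm: "?D \<in> M \<rightarrow>\<^sub>M ?S"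
    unfolding case_prod_beta
    by (intro measurable_restrict borel_measurable_diff B'_measurable) (use h \<delta> in auto)
  interpret Q: prob_space ?Q by (rule prob_space_distr[OF Zm])
  interpret G: prob_space ?G by (rule prob_space_gauss_steps)
  have sG: "sets ?G = sets ?S" by (intro sets_PiM_cong) auto
  have sQG: "sets (?Q \<Otimes>\<^sub>M ?G) = sets (vecs n \<Otimes>\<^sub>M ?S)" by (intro sets_pair_measure_cong sG) simp
  have spQG: "space (?Q \<Otimes>\<^sub>M ?G) = space (vecs n \<Otimes>\<^sub>M ?S)" by (rule sets_eq_imp_space_eq[OF sQG])
  have law: "distr M (vecs n \<Otimes>\<^sub>M ?S) (\<lambda>\<omega>. (?Z \<omega>, ?D \<omega>)) = ?Q \<Otimes>\<^sub>M ?G"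
    by (rule segment_law) (use h \<delta> m in auto)
  have sj: "L - s j = L - h + real j * ?\<delta>" if "j \<le> m" for j
  proof -
    have "s j = h - real j * ?\<delta>" using that m\<delta> by (simp add: s_def of_nat_diff left_diff_distrib del: times_divide_eq_right)
    then show ?thesis by simp
  qed
  have sum_D: "(\<Sum>i<j. ?D \<omega> (k, i)) = \<beta> k (L - s j) \<omega> - \<beta> k (L - h) \<omega>" if "j \<le> m" "k < n" for j k \<omega>
  proof -
    have "(\<Sum>i<j. ?D \<omega> (k, i)) = (\<Sum>i<j. \<beta> k (L - h + real (Suc i) * ?\<delta>) \<omega> - \<beta> k (L - h + real i * ?\<delta>) \<omega>)"
      using that by (intro sum.cong refl) auto
    also have "\<dots> = \<beta> k (L - h + real j * ?\<delta>) \<omega> - \<beta> k (L - h + real 0 * ?\<delta>) \<omega>" by (rule sum_lessThan_telescope)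
    finally show ?thesis using that by (simp only: sj) simp
  qed
  have sm: "s m = 0" by (simp add: s_def)
  have sum_D': "(\<Sum>i=j..<m. ?D \<omega> (k, i)) = \<beta> k L \<omega> - \<beta> k (L - s j) \<omega>" if "j \<le> m" "k < n" for j k \<omega>
  proof -
    have "(\<Sum>i<m. ?D \<omega> (k, i)) = (\<Sum>i<j. ?D \<omega> (k, i)) + (\<Sum>i=j..<m. ?D \<omega> (k, i))"
      using that sum.atLeastLessThan_concat[of 0 j m "\<lambda>i. ?D \<omega> (k, i)"] by (simp only: atLeast0LessThan)
    then show ?thesis using sum_D[OF order_refl that(2), of \<omega>] sum_D[OF that, of \<omega>] sm by simp
  qed
  have C: "{z \<in> space (?Q \<Otimes>\<^sub>M ?G). hits n J (\<lambda>j. a - c * s j) (fst z) (snd z)} \<in> sets (vecs n \<Otimes>\<^sub>M ?S)"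
    unfolding spQG by (rule hits_measurable[OF J])
  have "{\<omega> \<in> space M. \<exists>j\<in>J. \<forall>k<n. a - c * s j < Z \<eta> (L - s j) \<omega> k}
    = (\<lambda>\<omega>. (?Z \<omega>, ?D \<omega>)) -` {z \<in> space (?Q \<Otimes>\<^sub>M ?G). hits n J (\<lambda>j. a - c * s j) (fst z) (snd z)} \<inter> space M"
  proof -
    have "hits n J (\<lambda>j. a - c * s j) (?Z \<omega>) (?D \<omega>) \<longleftrightarrow> (\<exists>j\<in>J. \<forall>k<n. a - c * s j < Z \<eta> (L - s j) \<omega> k)" for \<omega>
      unfolding hits_def
    proof (intro bex_cong refl all_cong1 imp_cong)
      fix j k assume j: "j \<in> J" and k: "k < n"
      then have jm: "j \<le> m" using J by auto
      show "(a - c * s j < ?Z \<omega> k + (\<Sum>i<j. ?D \<omega> (k, i))) = (a - c * s j < Z \<eta> (L - s j) \<omega> k)"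
        unfolding sum_D[OF jm k] using k by (simp add: Z_def)
    qed
    moreover have "(?Z \<omega>, ?D \<omega>) \<in> space (?Q \<Otimes>\<^sub>M ?G)" if "\<omega> \<in> space M" for \<omega>
      unfolding spQG using measurable_space[OF measurable_Pair[OF Zm Dm] that] .
    ultimately show ?thesis by (intro set_eqI) (simp only: vimage_eq Int_iff mem_Collect_eq fst_conv snd_conv, blast)
  qed
  then have "emeasure M {\<omega> \<in> space M. \<exists>j\<in>J. \<forall>k<n. a - c * s j < Z \<eta> (L - s j) \<omega> k}
    = emeasure (?Q \<Otimes>\<^sub>M ?G) {z \<in> space (?Q \<Otimes>\<^sub>M ?G). hits n J (\<lambda>j. a - c * s j) (fst z) (snd z)}"
    unfolding law[symmetric] emeasure_distr[OF measurable_Pair[OF Zm Dm] C[unfolded law[symmetric]]] by simp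
  also have "\<dots> = (\<integral>\<^sup>+z. \<integral>\<^sup>+d. ennreal (exp (b * (\<Sum>k<n. z k) - real n * b\<^sup>2 * (xvar \<eta> + (L - h) + real m * ?\<delta>) / 2))
          * ?f (\<lambda>k\<in>{..<n}. - (\<Sum>i<m. d (k, i)) + (- 1) * z k)
          * (if \<exists>j\<in>J. \<forall>k<n. z k < - (\<Sum>i=j..<m. d (k, i)) - (b - c) * (real (m - j) * ?\<delta>) then 1 else 0)
        \<partial>?G \<partial>leb n)" (is "_ = (\<integral>\<^sup>+z. \<integral>\<^sup>+d. ?F z d \<partial>?G \<partial>leb n)")
    unfolding s_def
  proof (rule tilted_window)
    show "tilt n (xvar \<eta> + (L - h)) ?Q" by (rule tilt_Z) (use h in auto)
    show "a = b * (xvar \<eta> + (L - h) + real m * ?\<delta>)" unfolding m\<delta> using b by simp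
    show "?Q = density (leb n) ?f" by (rule Z_density[OF Lh])
    show "?f \<in> borel_measurable (vecs n)" by (rule smoothed_measurable[OF _ prob_space_QX]) simp
  qed (use \<delta> J Q.prob_space_axioms in auto)
  also have "\<dots> = (\<integral>\<^sup>+z. \<integral>\<^sup>+\<omega>. ?F z (?D \<omega>) \<partial>M \<partial>leb n)"
  proof (rule nn_integral_cong)
    fix z
    have GD: "?G = distr M ?S ?D"
      by (rule increments_law[symmetric]) (use h \<delta> m in auto)
    have dk: "(\<lambda>d. d (k, i)) \<in> borel_measurable ?S" if "k < n" "i < m" for k i
      by (intro measurable_component_singleton) (use that in auto)
    have [measurable]: "?f \<in> borel_measurable (vecs n)" by (rule smoothed_measurable[OF _ prob_space_QX]) simp
    have [measurable]: "(\<lambda>d. \<lambda>k\<in>{..<n}. - (\<Sum>i<m. d (k, i)) + (- 1) * z k) \<in> ?S \<rightarrow>\<^sub>M vecs n"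
      by (intro measurable_restrict borel_measurable_add borel_measurable_uminus borel_measurable_sum borel_measurable_const dk) auto
    have "{d \<in> space ?S. \<exists>j\<in>J. \<forall>k\<in>{..<n}. z k < - (\<Sum>i=j..<m. d (k, i)) - (b - c) * (real (m - j) * ?\<delta>)} \<in> sets ?S"
    proof (intro sets.sets_Collect_finite_Ex sets.sets_Collect_finite_All borel_measurable_less borel_measurable_const borel_measurable_diff
        borel_measurable_uminus borel_measurable_sum dk)
      show "finite J" using J finite_subset by blast
    qed auto
    then have [measurable]: "Measurable.pred ?S (\<lambda>d. \<exists>j\<in>J. \<forall>k<n. z k < - (\<Sum>i=j..<m. d (k, i)) - (b - c) * (real (m - j) * ?\<delta>))"
      by (simp add: pred_def Ball_def)
    have "(\<lambda>d. ?F z d) \<in> borel_measurable ?S" by measurable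
    then have "(\<integral>\<^sup>+d. ?F z d \<partial>distr M ?S ?D) = (\<integral>\<^sup>+\<omega>. ?F z (?D \<omega>) \<partial>M)"
      by (intro nn_integral_distr[OF Dm]) simp
    then show "(\<integral>\<^sup>+d. ?F z d \<partial>?G) = (\<integral>\<^sup>+\<omega>. ?F z (?D \<omega>) \<partial>M)" using GD by simp
  qed
  also have "\<dots> = (\<integral>\<^sup>+z. \<integral>\<^sup>+\<omega>. kernel b h z \<omega> * (if \<exists>j\<in>J. \<forall>k<n. z k < \<beta> k (L - s j) \<omega> - \<beta> k L \<omega> - (b - c) * s j then 1 else 0) \<partial>M \<partial>leb n)"
  proof (intro nn_integral_cong arg_cong2[where f="(*)"])
    fix z \<omega>
    have "(\<lambda>k\<in>{..<n}. - (\<Sum>i<m. ?D \<omega> (k, i)) + (- 1) * z k) = (\<lambda>k\<in>{..<n}. - (\<beta> k L \<omega> - \<beta> k (L - h) \<omega>) + (- 1) * z k)"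
      using sum_D[of m] sm by (intro restrict_ext) simp
    then show "ennreal (exp (b * (\<Sum>k<n. z k) - real n * b\<^sup>2 * (xvar \<eta> + (L - h) + real m * ?\<delta>) / 2))
          * ?f (\<lambda>k\<in>{..<n}. - (\<Sum>i<m. ?D \<omega> (k, i)) + (- 1) * z k) = kernel b h z \<omega>"
      unfolding kernel_def m\<delta> by simp
    show "(if \<exists>j\<in>J. \<forall>k<n. z k < - (\<Sum>i=j..<m. ?D \<omega> (k, i)) - (b - c) * (real (m - j) * ?\<delta>) then 1 else 0) =
      (if \<exists>j\<in>J. \<forall>k<n. z k < \<beta> k (L - s j) \<omega> - \<beta> k L \<omega> - (b - c) * s j then 1 else 0 :: ennreal)"
    proof (intro if_cong refl bex_cong all_cong1 imp_cong)
      fix j k assume j: "j \<in> J" and k: "k < n"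
      then have jm: "j \<le> m" using J by auto
      show "(z k < - (\<Sum>i=j..<m. ?D \<omega> (k, i)) - (b - c) * (real (m - j) * ?\<delta>)) = (z k < \<beta> k (L - s j) \<omega> - \<beta> k L \<omega> - (b - c) * s j)"
        unfolding sum_D'[OF jm k] s_def by simp
    qed
  qed
  finally show ?thesis .
qed

text \<open>The same change of measure for the event at time \<open>T\<close> alone: the grid with one cell, restricted to its end.\<close>
lemma endpoint_identity:
  assumes h: "0 < h" "h < L" and b: "b * \<mu> = a"
  shows "emeasure M {\<omega> \<in> space M. \<forall>k<n. a < Z \<eta> L \<omega> k}
    = (\<integral>\<^sup>+z. \<integral>\<^sup>+\<omega>. kernel b h z \<omega> * (if \<forall>k<n. z k < 0 then 1 else 0) \<partial>M \<partial>leb n)"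
  using window_grid[OF h, of 1 "{1}" b a 0] b by simp

text \<open>Monotone convergence along the dyadic grids on both sides of \<open>window_grid\<close>. The measurability statement
  comes from the same limit.\<close>
lemma window_identity:
  assumes h: "0 < h" "h < L" and b: "b * \<mu> = a"
  shows "emeasure M {\<omega> \<in> space M. \<exists>s\<in>{0..h}. \<forall>k<n. a - c * s < Z \<eta> (L - s) \<omega> k}
    = (\<integral>\<^sup>+z. \<integral>\<^sup>+\<omega>. kernel b h z \<omega> * (if reach h (b - c) z \<omega> then 1 else 0) \<partial>M \<partial>leb n)"
    and "(\<lambda>z. \<integral>\<^sup>+\<omega>. kernel b h z \<omega> * (if reach h (b - c) z \<omega> then 1 else 0) \<partial>M)
      \<in> borel_measurable (leb n)"
proof -
  let ?s = "\<lambda>m j. real j * (h / 2^m)"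
  let ?A = "\<lambda>m. {\<omega> \<in> space M. \<exists>j\<le>2^m. \<forall>k<n. a - c * ?s m j < Z \<eta> (L - ?s m j) \<omega> k}"
  let ?I = "\<lambda>m z \<omega>. if \<exists>j\<le>2^m. \<forall>k<n. z k < \<beta> k (L - ?s m j) \<omega> - \<beta> k L \<omega> - (b - c) * ?s m j then 1 else 0 :: ennreal"
  let ?J = "\<lambda>z \<omega>. if reach h (b - c) z \<omega> then 1 else 0 :: ennreal"
  let ?KI = "\<lambda>m z. \<integral>\<^sup>+\<omega>. kernel b h z \<omega> * ?I m z \<omega> \<partial>M"
  have flip: "(\<exists>j\<in>{..2^m}. Q (real (2^m - j) * (h / real (2^m)))) \<longleftrightarrow> (\<exists>j\<le>2^m. Q (?s m j))" for Q and m :: nat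
  proof
    assume "\<exists>j\<in>{..2^m}. Q (real (2^m - j) * (h / real (2^m)))"
    then obtain j :: nat where "j \<le> 2^m" "Q (real (2^m - j) * (h / real (2^m)))" by auto
    then show "\<exists>j\<le>2^m. Q (?s m j)" by (intro exI[of _ "2^m - j"]) simp
  next
    assume "\<exists>j\<le>2^m. Q (?s m j)"
    then obtain j :: nat where "j \<le> 2^m" "Q (?s m j)" by auto
    then show "\<exists>j\<in>{..2^m}. Q (real (2^m - j) * (h / real (2^m)))" by (intro bexI[of _ "2^m - j"]) auto
  qed
  have grid: "emeasure M (?A m) = (\<integral>\<^sup>+z. ?KI m z \<partial>leb n)" for m
    using window_grid[OF h _ order_refl b, of "2^m" c]
    unfolding flip[of _ "\<lambda>s. \<forall>k<n. a - c * s < Z \<eta> (L - s) \<omega> k" for \<omega>]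
      flip[of _ "\<lambda>s. \<forall>k<n. z k < \<beta> k (L - s) \<omega> - \<beta> k L \<omega> - (b - c) * s" for z \<omega>] by simp
  have cZ: "continuous_on {0..h} (\<lambda>s. Z \<eta> (L - s) \<omega> k)" if "k < n" "\<omega> \<in> space M" for k \<omega>
    by (rule continuous_on_compose2[OF Z_continuous[OF order_refl that]]) (use h in \<open>auto intro!: continuous_intros\<close>)
  have c\<beta>: "continuous_on {0..h} (\<lambda>s. \<beta> k (L - s) \<omega>)" if "k < n" "\<omega> \<in> space M" for k \<omega>
    by (rule continuous_on_compose2[OF B'_continuous[OF order_refl that]]) (use h in \<open>auto intro!: continuous_intros\<close>)
  let ?f = "\<lambda>k s \<omega>. Z \<eta> (L - s) \<omega> k - (a - c * s)"
  have A_eq: "?A m = {\<omega> \<in> space M. \<exists>j\<le>2^m. \<forall>k<n. 0 < ?f k (0 + real j * ((h - 0) / 2^m)) \<omega>}" for m by simp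
  have de: "incseq ?A" "range ?A \<subseteq> events"
    "(\<Union>m. ?A m) = {\<omega> \<in> space M. \<exists>s\<in>{0..h}. \<forall>k<n. 0 < ?f k s \<omega>}"
  proof -
    have c: "\<And>k \<omega>. k < n \<Longrightarrow> \<omega> \<in> space M \<Longrightarrow> continuous_on {0..h} (\<lambda>s. ?f k s \<omega>)"
      by (intro continuous_intros cZ)
    have m: "\<And>k s. k < n \<Longrightarrow> s \<in> {0..h} \<Longrightarrow> ?f k s \<in> borel_measurable M"
      by (intro borel_measurable_diff borel_measurable_const Z_measurable) (use h in auto)
    show "incseq ?A" unfolding A_eq by (rule dyadic_event(2)[OF h(1) c m])
    show "range ?A \<subseteq> events" unfolding A_eq by (intro image_subsetI dyadic_event(1)[OF h(1) c m])
    show "(\<Union>m. ?A m) = {\<omega> \<in> space M. \<exists>s\<in>{0..h}. \<forall>k<n. 0 < ?f k s \<omega>}"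
      unfolding A_eq by (rule dyadic_event(3)[OF h(1) c m])
  qed
  let ?g = "\<lambda>z \<omega> k s. \<beta> k (L - s) \<omega> - \<beta> k L \<omega> - (b - c) * s - z k"
  have I_eq: "?I m z \<omega> = (if \<exists>j\<le>2^m. \<forall>k<n. 0 < ?g z \<omega> k (0 + real j * ((h - 0) / 2^m)) then 1 else 0)" for m z \<omega> by simp
  have I_mono: "incseq (\<lambda>m. ?I m z \<omega>)" for z \<omega>
  proof (rule incseq_SucI)
    fix m
    have "(\<exists>j\<le>2^m. \<forall>k<n. 0 < ?g z \<omega> k (0 + real j * ((h - 0) / 2^m))) \<Longrightarrow>
      (\<exists>j\<le>2^Suc m. \<forall>k<n. 0 < ?g z \<omega> k (0 + real j * ((h - 0) / 2^Suc m)))"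
      by (erule dyadic_refine[OF le_SucI[OF order_refl]])
    then show "?I m z \<omega> \<le> ?I (Suc m) z \<omega>" unfolding I_eq by (simp only: split: if_split) simp
  qed
  have I_sup: "(SUP m. ?I m z \<omega>) = ?J z \<omega>" if \<omega>: "\<omega> \<in> space M" for z \<omega>
  proof -
    have "(\<exists>s\<in>{0..h}. \<forall>k<n. ?g z \<omega> k s > 0) \<longleftrightarrow> (\<exists>m. \<exists>j\<le>2^m. \<forall>k<n. 0 < ?g z \<omega> k (0 + real j * ((h - 0) / 2^m)))"
      by (rule ex_dyadic_iff[OF h(1)]) (intro continuous_intros c\<beta> \<omega>)
    then have iff: "(reach h (b - c) z \<omega>) \<longleftrightarrow> (\<exists>m. \<exists>j\<le>2^m. \<forall>k<n. z k < \<beta> k (L - ?s m j) \<omega> - \<beta> k L \<omega> - (b - c) * ?s m j)"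
      by simp
    show ?thesis
    proof (cases "reach h (b - c) z \<omega>")
      case True
      then obtain m where "\<exists>j\<le>2^m. \<forall>k<n. z k < \<beta> k (L - ?s m j) \<omega> - \<beta> k L \<omega> - (b - c) * ?s m j" unfolding iff by blast
      then have m: "?I m z \<omega> = 1" by (rule if_P)
      have "(SUP m. ?I m z \<omega>) = 1"
        by (rule antisym, rule SUP_least, simp, rule SUP_upper2[of m]) (simp_all only: m UNIV_I order_refl)
      then show ?thesis unfolding if_P[OF True] .
    next
      case False
      then have "\<not> (\<exists>j\<le>2^m. \<forall>k<n. z k < \<beta> k (L - ?s m j) \<omega> - \<beta> k L \<omega> - (b - c) * ?s m j)" for m unfolding iff by blast
      then have "?I m z \<omega> = 0" for m by (rule if_not_P)
      then show ?thesis unfolding if_not_P[OF False] by (simp only: SUP_const UNIV_not_empty not_False_eq_True)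
    qed
  qed
  have kI: "(\<lambda>(z, \<omega>). kernel b h z \<omega> * ?I m z \<omega>) \<in> borel_measurable (leb n \<Otimes>\<^sub>M M)" for m
  proof -
    note [measurable_cong] = sets_leb[of n]
    have k: "(\<lambda>p. kernel b h (fst p) (snd p)) \<in> borel_measurable (leb n \<Otimes>\<^sub>M M)"
      using kernel_measurable[of h b] h by (simp add: case_prod_beta)
    have "{p \<in> space (leb n \<Otimes>\<^sub>M M). \<exists>j\<in>{..2^m}. \<forall>k\<in>{..<n}. fst p k < \<beta> k (L - ?s m j) (snd p) - \<beta> k L (snd p) - (b - c) * ?s m j} \<in> sets (leb n \<Otimes>\<^sub>M M)"
    proof (intro sets.sets_Collect_finite_Ex sets.sets_Collect_finite_All borel_measurable_less borel_measurable_const borel_measurable_diff)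
      fix j k :: nat assume j: "j \<in> {..2^m}" and k: "k \<in> {..<n}"
      have "?s m j \<le> 2^m * (h / 2^m)" using j h of_nat_mono[of j "2^m", where 'a=real] by (intro mult_right_mono) auto
      then have sh: "L - ?s m j \<ge> 0" using h by simp
      show "(\<lambda>p. fst p k) \<in> borel_measurable (leb n \<Otimes>\<^sub>M M)"
        using measurable_component_singleton[OF k, of "\<lambda>_. lborel :: real measure"]
        by (intro measurable_compose[OF measurable_fst]) auto
      show "(\<lambda>p. \<beta> k (L - ?s m j) (snd p)) \<in> borel_measurable (leb n \<Otimes>\<^sub>M M)"
        by (intro measurable_compose[OF measurable_snd] B'_measurable sh) (use k in auto)
      show "(\<lambda>p. \<beta> k L (snd p)) \<in> borel_measurable (leb n \<Otimes>\<^sub>M M)"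
        by (intro measurable_compose[OF measurable_snd] B'_measurable) (use k h in auto)
    qed auto
    then have "{p \<in> space (leb n \<Otimes>\<^sub>M M). \<exists>j\<le>2^m. \<forall>k<n. fst p k < \<beta> k (L - ?s m j) (snd p) - \<beta> k L (snd p) - (b - c) * ?s m j} \<in> sets (leb n \<Otimes>\<^sub>M M)"
      by (simp only: Ball_def Bex_def atMost_iff lessThan_iff)
    then show ?thesis unfolding case_prod_beta
      by (intro borel_measurable_times_ennreal k measurable_If borel_measurable_const)
  qed
  have inner_meas: "(\<lambda>z. ?KI m z) \<in> borel_measurable (leb n)" for m
    by (rule borel_measurable_nn_integral[OF kI])
  have inner: "(SUP m. ?KI m z) = (\<integral>\<^sup>+\<omega>. kernel b h z \<omega> * ?J z \<omega> \<partial>M)"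
    if z: "z \<in> space (leb n)" for z
  proof -
    have "(SUP m. ?KI m z) = (\<integral>\<^sup>+\<omega>. (SUP m. kernel b h z \<omega> * ?I m z \<omega>) \<partial>M)"
    proof (rule nn_integral_monotone_convergence_SUP[symmetric])
      show "incseq (\<lambda>m \<omega>. kernel b h z \<omega> * ?I m z \<omega>)"
        by (intro incseq_SucI le_funI mult_left_mono incseq_SucD[OF I_mono]) auto
      show "(\<lambda>\<omega>. kernel b h z \<omega> * ?I m z \<omega>) \<in> borel_measurable M" for m
        using measurable_compose[OF measurable_Pair1'[OF z] kI[of m]] by (simp only: prod.case)
    qed
    also have "\<dots> = (\<integral>\<^sup>+\<omega>. kernel b h z \<omega> * ?J z \<omega> \<partial>M)"
    proof (intro nn_integral_cong)
      fix \<omega> assume \<omega>: "\<omega> \<in> space M"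
      show "(SUP m. kernel b h z \<omega> * ?I m z \<omega>) = kernel b h z \<omega> * ?J z \<omega>"
        unfolding I_sup[OF \<omega>, symmetric] by (rule SUP_mult_left_ennreal[symmetric])
    qed
    finally show ?thesis .
  qed
  have "emeasure M {\<omega> \<in> space M. \<exists>s\<in>{0..h}. \<forall>k<n. a - c * s < Z \<eta> (L - s) \<omega> k} = (SUP m. emeasure M (?A m))"
    using SUP_emeasure_incseq[OF de(2,1)] de(3) by (simp add: algebra_simps)
  also have "\<dots> = (SUP m. \<integral>\<^sup>+z. ?KI m z \<partial>leb n)"
    by (simp only: grid)
  also have "\<dots> = (\<integral>\<^sup>+z. (SUP m. ?KI m z) \<partial>leb n)"
  proof (rule nn_integral_monotone_convergence_SUP[symmetric])
    show "incseq (\<lambda>m z. ?KI m z)"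
      by (intro incseq_SucI le_funI nn_integral_mono mult_left_mono incseq_SucD[OF I_mono]) auto
  qed (rule inner_meas)
  also have "\<dots> = (\<integral>\<^sup>+z. \<integral>\<^sup>+\<omega>. kernel b h z \<omega> * ?J z \<omega> \<partial>M \<partial>leb n)"
    by (rule nn_integral_cong[OF inner])
  finally show "emeasure M {\<omega> \<in> space M. \<exists>s\<in>{0..h}. \<forall>k<n. a - c * s < Z \<eta> (L - s) \<omega> k} = \<dots>" .
  have "(\<lambda>z. SUP m. ?KI m z) \<in> borel_measurable (leb n)"
    by (rule borel_measurable_SUP[OF _ inner_meas]) simp
  then show "(\<lambda>z. \<integral>\<^sup>+\<omega>. kernel b h z \<omega> * ?J z \<omega> \<partial>M) \<in> borel_measurable (leb n)"
    by (rule measurable_cong[THEN iffD1, rotated]) (rule inner)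
qed

end

section \<open>Exceedances of a Brownian vector with drift\<close>

locale brownian_vector =
  fixes M :: "'b measure" and W :: "nat \<Rightarrow> real \<Rightarrow> 'b \<Rightarrow> real" and n :: nat
  assumes n: "n > 0" and ibm: "indep_brownian_motions M {..<n} W"
begin

lemma bm: "k < n \<Longrightarrow> standard_brownian_motion M (W k)"
  using ibm by (auto simp: indep_brownian_motions_def)

sublocale prob_space M
  using bm[OF n] by (simp add: standard_brownian_motion_def)

definition V :: "nat \<Rightarrow> real \<Rightarrow> 'b \<Rightarrow> real" where
  "V k t \<omega> = W k t \<omega> - W k 0 \<omega>"

lemma V_0[simp]: "V k 0 \<omega> = 0" by (simp add: V_def)

lemma V_measurable: "k < n \<Longrightarrow> t \<ge> 0 \<Longrightarrow> V k t \<in> borel_measurable M"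
  using bm unfolding V_def[abs_def] by (auto simp: standard_brownian_motion_def intro!: borel_measurable_diff)

lemma V_continuous: "k < n \<Longrightarrow> \<omega> \<in> space M \<Longrightarrow> continuous_on {0..} (\<lambda>t. V k t \<omega>)"
  using bm[of k] unfolding V_def by (auto simp: standard_brownian_motion_def intro!: continuous_intros)

lemma AE_V: "AE \<omega> in M. \<forall>k<n. \<forall>t. V k t \<omega> = W k t \<omega>"
proof -
  have "AE \<omega> in M. \<forall>k\<in>{..<n}. W k 0 \<omega> = 0"
    using bm by (intro AE_finite_allI) (auto simp: standard_brownian_motion_def)
  then show ?thesis by eventually_elim (auto simp: V_def)
qed

lemma V_increments_measurable:
  assumes \<delta>: "\<delta> > 0"
  shows "(\<lambda>\<omega>. \<lambda>(k, j)\<in>steps n m. V k (real (Suc j) * \<delta>) \<omega> - V k (real j * \<delta>) \<omega>) \<in> M \<rightarrow>\<^sub>M incs n m"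
  unfolding case_prod_beta
  by (intro measurable_restrict borel_measurable_diff V_measurable) (use \<delta> in auto)

lemma V_increments_law:
  assumes \<delta>: "\<delta> > 0"
  shows "distr M (incs n m)
      (\<lambda>\<omega>. \<lambda>(k, j)\<in>steps n m. V k (real (Suc j) * \<delta>) \<omega> - V k (real j * \<delta>) \<omega>) = gauss_steps n m \<delta>"
    (is "distr M ?S ?D = _")
proof -
  let ?K = "{..<n} \<times> {..m}"
  let ?X = "\<lambda>\<omega>. \<lambda>q\<in>?K. bm_step (W (fst q)) 0 \<delta> (snd q) \<omega>"
  let ?f = "\<lambda>(k, j). (k, Suc j)"
  let ?G = "\<lambda>q. gauss (step_var 0 \<delta> (snd q))"
  have law: "distr M (Pi\<^sub>M ?K (\<lambda>_. borel)) ?X = Pi\<^sub>M ?K ?G"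
    by (rule indep_bm_steps_distr[OF ibm]) (use n \<delta> in auto)
  have Xm: "?X \<in> M \<rightarrow>\<^sub>M Pi\<^sub>M ?K (\<lambda>_. borel)"
    by (intro measurable_restrict bm_step_measurable bm) (use \<delta> in auto)
  have fm: "(\<lambda>x. \<lambda>p\<in>steps n m. x (?f p)) \<in> Pi\<^sub>M ?K (\<lambda>_. borel :: real measure) \<rightarrow>\<^sub>M ?S"
    by (intro measurable_restrict measurable_component_singleton) auto
  have "distr (Pi\<^sub>M ?K ?G) (Pi\<^sub>M (steps n m) (\<lambda>p. ?G (?f p))) (\<lambda>x. \<lambda>p\<in>steps n m. x (?f p)) = Pi\<^sub>M (steps n m) (\<lambda>p. ?G (?f p))"
    by (rule distr_PiM_reindex) (auto simp: inj_on_def intro: prob_space_gauss)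
  moreover have "Pi\<^sub>M (steps n m) (\<lambda>p. ?G (?f p)) = gauss_steps n m \<delta>"
    by (intro PiM_cong) auto
  ultimately have "gauss_steps n m \<delta> = distr (Pi\<^sub>M ?K ?G) (gauss_steps n m \<delta>) (\<lambda>x. \<lambda>p\<in>steps n m. x (?f p))" by simp
  also have "\<dots> = distr (distr M (Pi\<^sub>M ?K (\<lambda>_. borel)) ?X) ?S (\<lambda>x. \<lambda>p\<in>steps n m. x (?f p))"
    unfolding law by (intro distr_cong refl sets_PiM_cong) auto
  also have "\<dots> = distr M ?S (\<lambda>\<omega>. \<lambda>p\<in>steps n m. ?X \<omega> (?f p))"
    unfolding distr_distr[OF fm Xm] by (simp only: comp_def)
  also have "\<dots> = distr M ?S ?D"
    by (intro distr_cong refl restrict_ext) (auto simp: bm_step_def V_def)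
  finally show ?thesis by simp
qed

abbreviation drifted :: "real \<Rightarrow> nat \<Rightarrow> real \<Rightarrow> 'b \<Rightarrow> real" where
  "drifted l k r \<omega> \<equiv> l * V k r \<omega> - l\<^sup>2 * r"

definition hit :: "real \<Rightarrow> real \<Rightarrow> (nat \<Rightarrow> real) \<Rightarrow> real" where
  "hit l R x = prob {\<omega> \<in> space M. \<exists>r\<in>{0..R}. \<forall>k<n. x k < drifted l k r \<omega>}"

text \<open>The sets of increments for which the exceedance takes place on the grid. Only their probabilities under
  \<open>gauss_steps\<close> matter, so they also serve for the reversed last segment of the tree.\<close>
definition grid_hit :: "nat \<Rightarrow> real \<Rightarrow> real \<Rightarrow> (nat \<Rightarrow> real) \<Rightarrow> (nat \<times> nat \<Rightarrow> real) set" where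
  "grid_hit m l \<delta> x = {d \<in> space (incs n m). \<exists>j\<in>{..m}. \<forall>k\<in>{..<n}. x k < l * (\<Sum>i<j. d (k, i)) - l\<^sup>2 * (real j * \<delta>)}"

lemma grid_hit_sets: "grid_hit m l \<delta> x \<in> sets (incs n m)"
  unfolding grid_hit_def
  by (intro sets.sets_Collect_finite_Ex sets.sets_Collect_finite_All borel_measurable_less borel_measurable_const borel_measurable_diff
        borel_measurable_times borel_measurable_sum measurable_component_singleton) auto

lemma grid_hit_prob:
  assumes \<delta>: "\<delta> > 0"
  shows "prob {\<omega> \<in> space M. \<exists>j\<le>m. \<forall>k<n. x k < drifted l k (real j * \<delta>) \<omega>}
     = measure (gauss_steps n m \<delta>) (grid_hit m l \<delta> x)"
proof -
  let ?D = "\<lambda>\<omega>. \<lambda>(k, j)\<in>steps n m. V k (real (Suc j) * \<delta>) \<omega> - V k (real j * \<delta>) \<omega>"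
  note Dm = V_increments_measurable[OF \<delta>, of m]
  have sum: "(\<Sum>i<j. ?D \<omega> (k, i)) = V k (real j * \<delta>) \<omega>" if "j \<le> m" "k < n" for j k \<omega>
  proof -
    have "(\<Sum>i<j. ?D \<omega> (k, i)) = (\<Sum>i<j. V k (real (Suc i) * \<delta>) \<omega> - V k (real i * \<delta>) \<omega>)"
      using that by (intro sum.cong refl) auto
    also have "\<dots> = V k (real j * \<delta>) \<omega> - V k (real 0 * \<delta>) \<omega>" by (induction j) auto
    finally show ?thesis by simp
  qed
  have "{\<omega> \<in> space M. \<exists>j\<le>m. \<forall>k<n. x k < drifted l k (real j * \<delta>) \<omega>} = ?D -` grid_hit m l \<delta> x \<inter> space M"
  proof (intro set_eqI)
    fix \<omega>
    show "\<omega> \<in> {\<omega> \<in> space M. \<exists>j\<le>m. \<forall>k<n. x k < drifted l k (real j * \<delta>) \<omega>} \<longleftrightarrow> \<omega> \<in> ?D -` grid_hit m l \<delta> x \<inter> space M"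
    proof (cases "\<omega> \<in> space M")
      case True
      have "(\<exists>j\<le>m. \<forall>k<n. x k < drifted l k (real j * \<delta>) \<omega>) \<longleftrightarrow> (\<exists>j\<le>m. \<forall>k<n. x k < l * (\<Sum>i<j. ?D \<omega> (k, i)) - l\<^sup>2 * (real j * \<delta>))"
        by (intro ex_cong1 conj_cong refl all_cong1 imp_cong) (simp only: sum)
      then show ?thesis using True measurable_space[OF Dm True]
        by (simp only: grid_hit_def vimage_eq Int_iff mem_Collect_eq Bex_def Ball_def atMost_iff lessThan_iff simp_thms)
    qed auto
  qed
  then show ?thesis
    unfolding V_increments_law[OF \<delta>, symmetric] by (simp only: measure_distr[OF Dm grid_hit_sets])
qed

lemma hit_event:
  assumes R: "R > 0"
  shows "{\<omega> \<in> space M. \<exists>r\<in>{0..R}. \<forall>k<n. x k < drifted l k r \<omega>} \<in> events"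
    and "(\<lambda>m. measure (gauss_steps n (2^m) (R / 2^m)) (grid_hit (2^m) l (R / 2^m) x)) \<longlonglongrightarrow> hit l R x"
proof -
  let ?f = "\<lambda>k r \<omega>. drifted l k r \<omega> - x k"
  have c: "\<And>k \<omega>. k < n \<Longrightarrow> \<omega> \<in> space M \<Longrightarrow> continuous_on {0..R} (\<lambda>t. ?f k t \<omega>)"
    by (intro continuous_intros continuous_on_subset[OF V_continuous]) auto
  have ms: "\<And>k t. k < n \<Longrightarrow> t \<in> {0..R} \<Longrightarrow> ?f k t \<in> borel_measurable M"
    by (intro borel_measurable_diff borel_measurable_times borel_measurable_const V_measurable) auto
  have e: "{\<omega> \<in> space M. \<exists>r\<in>{0..R}. \<forall>k<n. x k < drifted l k r \<omega>} = {\<omega> \<in> space M. \<exists>t\<in>{0..R}. \<forall>k<n. 0 < ?f k t \<omega>}" by simp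
  show "{\<omega> \<in> space M. \<exists>r\<in>{0..R}. \<forall>k<n. x k < drifted l k r \<omega>} \<in> events"
    unfolding e by (rule dyadic_event(4)[OF R c ms])
  have "(\<lambda>m. prob {\<omega> \<in> space M. \<exists>j\<le>2^m. \<forall>k<n. ?f k (0 + real j * ((R - 0) / 2^m)) \<omega> > 0}) \<longlonglongrightarrow> hit l R x"
    unfolding hit_def e by (rule dyadic_event(5)[OF R c ms])
  moreover have "prob {\<omega> \<in> space M. \<exists>j\<le>2^m. \<forall>k<n. ?f k (0 + real j * ((R - 0) / 2^m)) \<omega> > 0}
     = measure (gauss_steps n (2^m) (R / 2^m)) (grid_hit (2^m) l (R / 2^m) x)" for m
    using grid_hit_prob[of "R / 2^m" "2^m" x l] R by simp
  ultimately show "(\<lambda>m. measure (gauss_steps n (2^m) (R / 2^m)) (grid_hit (2^m) l (R / 2^m) x)) \<longlonglongrightarrow> hit l R x" by simp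
qed

text \<open>If all coordinates exceed the thresholds at the same time, then so does the sum over those with positive
  threshold. For each coordinate, \<open>2 l W - 2 l\<^sup>2 t\<close> is the logarithm of a martingale of mean 1, which is why the exponent is
  exactly 2 whatever the number of summands.\<close>
lemma hit_bound:
  assumes R: "R > 0"
  shows "hit l R x \<le> exp (- 2 * (\<Sum>k<n. max 0 (x k)))"
proof (rule LIMSEQ_le_const2[OF hit_event(2)[OF R]], intro exI allI impI)
  fix m :: nat
  let ?m = "2^m :: nat" and ?\<delta> = "R / 2^m"
  let ?A = "{k \<in> {..<n}. x k > 0}"
  let ?G = "gauss_steps n ?m ?\<delta>"
  let ?y = "2 * (\<Sum>k<n. max 0 (x k))"
  interpret G: prob_space ?G by (rule prob_space_gauss_steps)
  have sG: "sets ?G = sets (incs n ?m)" by (intro sets_PiM_cong) auto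
  have spG: "space ?G = space (incs n ?m)" by (rule sets_eq_imp_space_eq[OF sG])
  have yA: "?y = 2 * (\<Sum>k\<in>?A. x k)"
    by (subst sum.inter_filter) (auto intro!: sum.cong)
  let ?B = "{d \<in> space ?G. \<exists>j\<le>?m. ?y \<le> (\<Sum>k\<in>?A. \<Sum>i<j. (2 * l) * d (k, i) - (2 * l)\<^sup>2 * ?\<delta> / 2)}"
  have sub: "grid_hit ?m l ?\<delta> x \<subseteq> ?B"
  proof
    fix d assume "d \<in> grid_hit ?m l ?\<delta> x"
    then obtain j where d: "d \<in> space ?G" and j: "j \<le> ?m" and *: "\<And>k. k < n \<Longrightarrow> x k < l * (\<Sum>i<j. d (k, i)) - l\<^sup>2 * (real j * ?\<delta>)"
      unfolding grid_hit_def spG by auto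
    have "?y \<le> 2 * (\<Sum>k\<in>?A. l * (\<Sum>i<j. d (k, i)) - l\<^sup>2 * (real j * ?\<delta>))"
      unfolding yA using * by (intro mult_left_mono sum_mono) (auto intro: less_imp_le)
    also have "\<dots> = (\<Sum>k\<in>?A. \<Sum>i<j. (2 * l) * d (k, i) - (2 * l)\<^sup>2 * ?\<delta> / 2)"
      unfolding sum_distrib_left
      by (intro sum.cong refl) (simp only: sum_subtractf sum_distrib_left[symmetric], simp add: sum_distrib_left power2_eq_square algebra_simps)
    finally show "d \<in> ?B" using d j by blast
  qed
  have B: "?B \<in> sets ?G"
  proof -
    have "?B = {d \<in> space (incs n ?m). \<exists>j\<in>{..?m}. ?y \<le> (\<Sum>k\<in>?A. \<Sum>i<j. (2 * l) * d (k, i) - (2 * l)\<^sup>2 * ?\<delta> / 2)}"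
      unfolding spG by (simp only: Bex_def atMost_iff)
    also have "\<dots> \<in> sets (incs n ?m)"
      by (intro sets.sets_Collect_finite_Ex borel_measurable_le borel_measurable_const borel_measurable_sum borel_measurable_diff
          borel_measurable_times measurable_component_singleton) auto
    finally show ?thesis unfolding sG .
  qed
  have "ennreal (measure ?G (grid_hit ?m l ?\<delta> x)) \<le> emeasure ?G ?B"
    unfolding G.emeasure_eq_measure[symmetric] by (rule emeasure_mono[OF sub B])
  also have "\<dots> \<le> ennreal (exp (- ?y))"
    by (rule gauss_steps_maximal) (use R in auto)
  finally show "measure ?G (grid_hit ?m l ?\<delta> x) \<le> exp (- 2 * (\<Sum>k<n. max 0 (x k)))" by simp
qed

lemma hit_measurable:
  assumes R: "R > 0"
  shows "hit l R \<in> borel_measurable (leb n)"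
proof (rule borel_measurable_LIMSEQ_real[OF hit_event(2)[OF R]])
  fix m :: nat
  let ?m = "2^m :: nat" and ?\<delta> = "R / 2^m"
  let ?S = "incs n ?m"
  let ?G = "gauss_steps n ?m ?\<delta>"
  interpret G: prob_space ?G by (rule prob_space_gauss_steps)
  have sG: "sets ?G = sets ?S" by (intro sets_PiM_cong) auto
  let ?Q = "{p \<in> space (leb n \<Otimes>\<^sub>M ?S). \<exists>j\<in>{..?m}. \<forall>k\<in>{..<n}. fst p k < l * (\<Sum>i<j. snd p (k, i)) - l\<^sup>2 * (real j * ?\<delta>)}"
  have "?Q \<in> sets (leb n \<Otimes>\<^sub>M ?S)"
  proof (intro sets.sets_Collect_finite_Ex sets.sets_Collect_finite_All borel_measurable_less borel_measurable_const borel_measurable_diff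
        borel_measurable_times borel_measurable_sum)
    show "(\<lambda>p. fst p k) \<in> borel_measurable (leb n \<Otimes>\<^sub>M ?S)" if "k \<in> {..<n}" for k
      using measurable_component_singleton[OF that, of "\<lambda>_. lborel :: real measure"]
      by (intro measurable_compose[OF measurable_fst]) auto
    show "(\<lambda>p. snd p (k, i)) \<in> borel_measurable (leb n \<Otimes>\<^sub>M ?S)" if "j \<in> {..?m}" "k \<in> {..<n}" "i \<in> {..<j}" for j k i
      by (intro measurable_compose[OF measurable_snd] measurable_component_singleton) (use that in auto)
  qed auto
  also have "sets (leb n \<Otimes>\<^sub>M ?S) = sets (leb n \<Otimes>\<^sub>M ?G)" by (intro sets_pair_measure_cong refl sG[symmetric])
  finally have "(\<lambda>x. emeasure ?G (Pair x -` ?Q)) \<in> borel_measurable (leb n)" by (rule G.measurable_emeasure_Pair)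
  then have "(\<lambda>x. enn2real (emeasure ?G (Pair x -` ?Q))) \<in> borel_measurable (leb n)" by measurable
  moreover have "enn2real (emeasure ?G (Pair x -` ?Q)) = measure ?G (grid_hit ?m l ?\<delta> x)" if "x \<in> space (leb n)" for x
    unfolding measure_def by (intro arg_cong[where f=enn2real] arg_cong2[where f=emeasure] refl)
      (use that in \<open>auto simp: grid_hit_def space_pair_measure\<close>)
  ultimately show "(\<lambda>x. measure ?G (grid_hit ?m l ?\<delta> x)) \<in> borel_measurable (leb n)"
    by (rule measurable_cong[THEN iffD1, rotated])
qed

text \<open>The probability inside the constant \<open>H_const\<close>.\<close>
definition ever_hit :: "real \<Rightarrow> (nat \<Rightarrow> real) \<Rightarrow> real" where
  "ever_hit l x = \<P>(\<omega> in M. \<exists>t>0. \<forall>i<n. l * W i t \<omega> - l\<^sup>2 * t > x i)"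

text \<open>The exceedance events for finite horizons increase to the one for the infinite horizon. Time 0 makes no
  difference: an exceedance there persists for a short while, by continuity.\<close>
lemma ever_hit_limit:
  assumes x: "filterlim r at_top F"
  shows "((\<lambda>u. hit l (r u) x) \<longlongrightarrow> ever_hit l x) F"
proof -
  let ?A = "\<lambda>R. {\<omega> \<in> space M. \<exists>r\<in>{0..R}. \<forall>k<n. x k < drifted l k r \<omega>}"
  let ?U = "{\<omega> \<in> space M. \<exists>t>0. \<forall>k<n. x k < drifted l k t \<omega>}"
  have A: "?A R \<in> events" if "R > 0" for R by (rule hit_event(1)[OF that])
  have mono: "?A R \<subseteq> ?A R'" if "R \<le> R'" for R R' using that by auto
  have pos: "\<exists>t>0. t \<le> 1 \<and> (\<forall>k<n. x k < drifted l k t \<omega>)" if \<omega>: "\<omega> \<in> space M" and z: "\<forall>k<n. x k < drifted l k 0 \<omega>" for \<omega>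
  proof -
    have "\<forall>k\<in>{..<n}. \<forall>\<^sub>F t in at_right 0. x k < drifted l k t \<omega>"
    proof
      fix k assume k: "k \<in> {..<n}"
      have "((\<lambda>t. V k t \<omega>) \<longlongrightarrow> V k 0 \<omega>) (at 0 within {0..})"
        using V_continuous[of k \<omega>] k \<omega> unfolding continuous_on_def by (metis atLeast_iff lessThan_iff order_refl)
      then have "((\<lambda>t. drifted l k t \<omega>) \<longlongrightarrow> drifted l k 0 \<omega>) (at 0 within {0..})"
        by (intro tendsto_intros)
      then have "((\<lambda>t. drifted l k t \<omega>) \<longlongrightarrow> drifted l k 0 \<omega>) (at_right 0)"
        by (rule tendsto_within_subset) auto
      then show "\<forall>\<^sub>F t in at_right 0. x k < drifted l k t \<omega>"
        using z k by (intro order_tendstoD(1)) auto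
    qed
    then have "\<forall>\<^sub>F t in at_right 0. \<forall>k\<in>{..<n}. x k < drifted l k t \<omega>"
      by (rule eventually_ball_finite[OF finite_lessThan])
    moreover have "\<forall>\<^sub>F t in at_right 0. t \<in> {0<..<1::real}" by (rule eventually_at_right_real) simp
    ultimately have "\<forall>\<^sub>F t in at_right 0. t > 0 \<and> t \<le> 1 \<and> (\<forall>k<n. x k < drifted l k t \<omega>)"
      by eventually_elim auto
    then show ?thesis using eventually_happens[of _ "at_right (0::real)"] by fastforce
  qed
  have un: "(\<Union>i. ?A (real (Suc i))) = ?U"
  proof (intro subset_antisym subsetI)
    fix \<omega> assume "\<omega> \<in> (\<Union>i. ?A (real (Suc i)))"
    then obtain r where \<omega>: "\<omega> \<in> space M" and r: "r \<ge> 0" "\<forall>k<n. x k < drifted l k r \<omega>" by auto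
    show "\<omega> \<in> ?U"
    proof (cases "r = 0")
      case True
      then show ?thesis using pos[OF \<omega>] r \<omega> by blast
    next
      case False
      then have "r > 0" using r by simp
      then show ?thesis using r \<omega> by blast
    qed
  next
    fix \<omega> assume "\<omega> \<in> ?U"
    then obtain t where \<omega>: "\<omega> \<in> space M" and t: "t > 0" "\<forall>k<n. x k < drifted l k t \<omega>" by blast
    obtain i where "t \<le> real i" using real_arch_simple by blast
    then have "t \<in> {0..real (Suc i)}" using t by auto
    then have "\<omega> \<in> ?A (real (Suc i))" using \<omega> t by blast
    then show "\<omega> \<in> (\<Union>i. ?A (real (Suc i)))" by blast
  qed
  have inc: "incseq (\<lambda>i. ?A (real (Suc i)))" by (intro incseq_SucI mono) simp
  have lim: "(\<lambda>i. hit l (real (Suc i)) x) \<longlonglongrightarrow> prob ?U"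
    unfolding hit_def un[symmetric] by (rule finite_Lim_measure_incseq[OF _ inc]) (use A in auto)
  have U: "?U \<in> events" unfolding un[symmetric] by (intro sets.countable_UN) (use A in auto)
  have Ueq: "prob ?U = ever_hit l x"
  proof -
    let ?Y = "{\<omega> \<in> space M. \<exists>t>0. \<forall>k<n. x k < l * W k t \<omega> - l\<^sup>2 * t}"
    have Y: "?Y \<in> events"
    proof -
      let ?Q = "\<lambda>i. {\<omega> \<in> space M. \<exists>t\<in>{0<..real (Suc i)}. \<forall>k<n. 0 < l * W k t \<omega> - l\<^sup>2 * t - x k}"
      have "\<exists>i. t \<le> real (Suc i)" for t :: real
        using real_arch_simple[of t] by (metis le_SucI of_nat_le_iff order_refl order_trans)
      then have "?Y = (\<Union>i. ?Q i)" by fastforce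
      also have "\<dots> \<in> events"
      proof (intro sets.countable_UN image_subsetI half_open_event)
        fix i k \<omega> assume "k < n" "\<omega> \<in> space M"
        then have "continuous_on {0..} (\<lambda>t. W k t \<omega>)" using bm[of k] by (auto simp: standard_brownian_motion_def)
        then show "continuous_on {0..real (Suc i)} (\<lambda>t. l * W k t \<omega> - l\<^sup>2 * t - x k)"
          by (intro continuous_intros continuous_on_subset[where s="{0..}" and t="{0..real (Suc i)}"]) auto
      next
        fix i k t assume "k < n" "t \<in> {0..real (Suc i)}"
        then show "(\<lambda>\<omega>. l * W k t \<omega> - l\<^sup>2 * t - x k) \<in> borel_measurable M"
          using bm[of k] by (intro borel_measurable_diff borel_measurable_times borel_measurable_const)
             (auto simp: standard_brownian_motion_def)
      qed simp
      finally show ?thesis .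
    qed
    have "AE \<omega> in M. (\<exists>t>0. \<forall>k<n. x k < drifted l k t \<omega>) \<longleftrightarrow> (\<exists>t>0. \<forall>k<n. x k < l * W k t \<omega> - l\<^sup>2 * t)"
      using AE_V by eventually_elim simp
    then show ?thesis unfolding ever_hit_def by (rule prob_eq_AE[OF _ U Y])
  qed
  have hmono: "hit l R x \<le> hit l R' x" if "R \<le> R'" "R' > 0" for R R'
    unfolding hit_def by (rule finite_measure_mono[OF mono[OF that(1)] A[OF that(2)]])
  have le: "hit l R x \<le> ever_hit l x" if "R > 0" for R
  proof -
    have "?A R \<subseteq> ?U" 
    proof
      fix \<omega> assume \<omega>: "\<omega> \<in> ?A R"
      obtain i where "R \<le> real i" using real_arch_simple by blast
      then have "R \<le> real (Suc i)" by simp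
      from subsetD[OF mono[OF this] \<omega>] have "\<omega> \<in> ?A (real (Suc i))" .
      then show "\<omega> \<in> ?U" unfolding un[symmetric] by blast
    qed
    then show ?thesis unfolding Ueq[symmetric] hit_def by (rule finite_measure_mono[OF _ U])
  qed
  show ?thesis
  proof (rule order_tendstoI)
    fix a assume "a < ever_hit l x"
    then have "\<forall>\<^sub>F i in sequentially. a < hit l (real (Suc i)) x" using lim unfolding Ueq by (rule order_tendstoD(1)[rotated])
    then obtain i where i: "a < hit l (real (Suc i)) x" by (auto simp: eventually_sequentially)
    have "\<forall>\<^sub>F u in F. r u \<ge> real (Suc i)" using x by (simp only: filterlim_at_top)
    then show "\<forall>\<^sub>F u in F. a < hit l (r u) x"
    proof eventually_elim
      case (elim u)
      have "real (Suc i) > 0" by simp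
      then have "r u > 0" using elim by linarith
      then show ?case using hmono[OF elim] i by linarith
    qed
  next
    fix a assume a: "ever_hit l x < a"
    have "\<forall>\<^sub>F u in F. r u \<ge> 1" using x by (simp only: filterlim_at_top)
    then show "\<forall>\<^sub>F u in F. hit l (r u) x < a"
    proof eventually_elim
      case (elim u)
      then show ?case using le[of "r u"] a by linarith
    qed
  qed
qed

lemma ever_hit_bound: "ever_hit l x \<le> exp (- 2 * (\<Sum>k<n. max 0 (x k)))"
proof -
  have "((\<lambda>R. hit l R x) \<longlongrightarrow> ever_hit l x) at_top" by (rule ever_hit_limit[OF filterlim_ident])
  then show ?thesis
    by (rule tendsto_upperbound[OF _ eventually_mono[OF eventually_gt_at_top hit_bound] trivial_limit_at_top_linorder])
qed

lemma ever_hit_measurable: "ever_hit l \<in> borel_measurable (leb n)"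
proof (rule borel_measurable_LIMSEQ_real)
  show "(\<lambda>i. hit l (real (Suc i)) x) \<longlonglongrightarrow> ever_hit l x" for x
    by (rule ever_hit_limit[OF filterlim_compose[OF filterlim_real_sequentially filterlim_Suc]])
  show "hit l (real (Suc i)) \<in> borel_measurable (leb n)" for i by (rule hit_measurable) simp
qed

lemma ever_hit_nonneg: "0 \<le> ever_hit l x" by (simp add: ever_hit_def)

lemma ever_hit_neg:
  assumes "\<forall>k<n. x k < 0"
  shows "ever_hit l x = 1"
proof -
  have "hit l R x = 1" if "R > 0" for R
  proof -
    have "{\<omega> \<in> space M. \<exists>r\<in>{0..R}. \<forall>k<n. x k < drifted l k r \<omega>} = space M"
      using that assms by (auto intro!: bexI[of _ 0])
    then show ?thesis by (simp add: hit_def prob_space)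
  qed
  then have "\<forall>\<^sub>F R in at_top. hit l R x = 1" by (rule eventually_mono[OF eventually_gt_at_top[of 0]])
  then have "((\<lambda>R. hit l R x) \<longlongrightarrow> 1) at_top" by (rule tendsto_eventually)
  then show ?thesis using ever_hit_limit[OF filterlim_ident, of l x] tendsto_unique trivial_limit_at_top_linorder by metis
qed

end

section \<open>The limit of the window integral\<close>

lemma normal_density_le:
  assumes "v > 0"
  shows "normal_density 0 (sqrt v) x \<le> 1 / sqrt (2 * pi * v)"
proof -
  have "normal_density 0 (sqrt v) x = 1 / sqrt (2 * pi * v) * exp (- (x\<^sup>2 / (2 * v)))"
    using assms by (simp add: normal_density_def)
  also have "\<dots> \<le> 1 / sqrt (2 * pi * v) * 1" using assms by (intro mult_left_mono) auto
  finally show ?thesis by simp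
qed

abbreviation heat_real :: "nat \<Rightarrow> real \<Rightarrow> (nat \<Rightarrow> real) \<Rightarrow> (nat \<Rightarrow> real) \<Rightarrow> real" where
  "heat_real n v y x \<equiv> \<Prod>k<n. normal_density 0 (sqrt v) (y k - x k)"

text \<open>The real-valued version of \<open>smoothed\<close>, for limits by dominated convergence.\<close>
definition smooth :: "nat \<Rightarrow> (nat \<Rightarrow> real) measure \<Rightarrow> real \<Rightarrow> (nat \<Rightarrow> real) \<Rightarrow> real" where
  "smooth n Q v y = (\<integral>x. (heat_real n v y x) \<partial>Q)"

lemma smooth_kernel_bounds:
  assumes v: "0 < v0" "v0 \<le> v"
  shows "0 \<le> (heat_real n v y x)"
    and "(heat_real n v y x) \<le> (1 / sqrt (2 * pi * v0)) ^ n"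
proof -
  show "0 \<le> (heat_real n v y x)" by (intro prod_nonneg) auto
  have "normal_density 0 (sqrt v) z \<le> 1 / sqrt (2 * pi * v0)" for z
  proof -
    have "normal_density 0 (sqrt v) z \<le> 1 / sqrt (2 * pi * v)" using v by (intro normal_density_le) auto
    also have "\<dots> \<le> 1 / sqrt (2 * pi * v0)" using v by (intro divide_left_mono) auto
    finally show ?thesis .
  qed
  then have "(heat_real n v y x) \<le> (\<Prod>k<n. 1 / sqrt (2 * pi * v0))"
    by (intro prod_mono) auto
  then show "(heat_real n v y x) \<le> (1 / sqrt (2 * pi * v0)) ^ n" by simp
qed

lemma smooth_kernel_measurable:
  assumes sQ: "sets Q = sets (vecs n)"
  shows "(\<lambda>x. heat_real n v y x) \<in> borel_measurable Q"
proof (rule borel_measurable_prod)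
  fix k assume "k \<in> {..<n}"
  then have "(\<lambda>x. x k) \<in> borel_measurable (vecs n)" by (rule measurable_component_singleton)
  then have [measurable]: "(\<lambda>x. x k) \<in> borel_measurable Q" by (simp add: measurable_cong_sets[OF sQ refl])
  show "(\<lambda>x. normal_density 0 (sqrt v) (y k - x k)) \<in> borel_measurable Q" by measurable
qed

lemma smoothed_eq_smooth:
  assumes sQ: "sets Q = sets (vecs n)" and pQ: "prob_space Q" and v: "v > 0"
  shows "smoothed n Q v y = ennreal (smooth n Q v y)"
proof -
  interpret prob_space Q by fact
  have "integrable Q (\<lambda>x. heat_real n v y x)"
    using smooth_kernel_bounds[OF v order_refl, of y _ n] smooth_kernel_measurable[OF sQ, of v y]
    by (intro integrable_const_bound[of _ "(1 / sqrt (2 * pi * v)) ^ n"]) (auto intro!: AE_I2)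
  then have "(\<integral>\<^sup>+x. ennreal (heat_real n v y x) \<partial>Q) = ennreal (smooth n Q v y)"
    unfolding smooth_def using smooth_kernel_bounds[OF v order_refl, of y _ n] by (intro nn_integral_eq_integral) auto
  then show ?thesis unfolding smoothed_def by (simp add: prod_ennreal)
qed

lemma smooth_bounds:
  assumes sQ: "sets Q = sets (vecs n)" and pQ: "prob_space Q" and v: "0 < v0" "v0 \<le> v"
  shows "0 \<le> smooth n Q v y" "smooth n Q v y \<le> (1 / sqrt (2 * pi * v0)) ^ n"
proof -
  interpret prob_space Q by fact
  note b = smooth_kernel_bounds[OF v, of y _ n]
  show "0 \<le> smooth n Q v y" unfolding smooth_def using b by (intro Bochner_Integration.integral_nonneg) auto
  have i: "integrable Q (\<lambda>x. heat_real n v y x)"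
    using b smooth_kernel_measurable[OF sQ, of v y]
    by (intro integrable_const_bound[of _ "(1 / sqrt (2 * pi * v0)) ^ n"]) (auto intro!: AE_I2)
  have "smooth n Q v y \<le> (\<integral>x. (1 / sqrt (2 * pi * v0)) ^ n \<partial>Q)"
    unfolding smooth_def using b i by (intro Bochner_Integration.integral_mono) auto
  then show "smooth n Q v y \<le> (1 / sqrt (2 * pi * v0)) ^ n" by (simp add: prob_space)
qed

lemma smooth_tendsto:
  assumes sQ: "sets Q = sets (vecs n)" and pQ: "prob_space Q" and v0: "v0 > 0"
    and v: "(v \<longlongrightarrow> v0) at_top" and y: "\<And>k. k < n \<Longrightarrow> ((\<lambda>u::real. y u k) \<longlongrightarrow> y0 k) at_top"
  shows "((\<lambda>u. smooth n Q (v u) (y u)) \<longlongrightarrow> smooth n Q v0 y0) at_top"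
  unfolding smooth_def
proof (rule integral_dominated_convergence_at_top)
  interpret prob_space Q by fact
  show "integrable Q (\<lambda>_. (1 / sqrt (2 * pi * (v0 / 2))) ^ n)" by simp
  show "(\<lambda>x. \<Prod>k<n. normal_density 0 (sqrt v0) (y0 k - x k)) \<in> borel_measurable Q"
    "(\<lambda>x. \<Prod>k<n. normal_density 0 (sqrt (v u)) (y u k - x k)) \<in> borel_measurable Q" for u
    by (rule smooth_kernel_measurable[OF sQ])+
  show "AE x in Q. ((\<lambda>u. \<Prod>k<n. normal_density 0 (sqrt (v u)) (y u k - x k)) \<longlongrightarrow> (\<Prod>k<n. normal_density 0 (sqrt v0) (y0 k - x k))) at_top"
    unfolding normal_density_def using v0 by (intro AE_I2 tendsto_intros v y) auto
  have "\<forall>\<^sub>F u in at_top. v u > v0 / 2" by (rule order_tendstoD(1)[OF v]) (use v0 in simp)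
  then show "\<forall>\<^sub>F u in at_top. AE x in Q. norm (\<Prod>k<n. normal_density 0 (sqrt (v u)) (y u k - x k)) \<le> (1 / sqrt (2 * pi * (v0 / 2))) ^ n"
  proof eventually_elim
    case (elim u)
    then show ?case using smooth_kernel_bounds[of "v0 / 2" "v u" "y u" _ n] v0 by (intro AE_I2) auto
  qed
qed

text \<open>The limit \<open>f\<^sub>0(0)\<close> will appear in numerator and denominator; it has to be positive for it to cancel.\<close>
lemma smooth_pos:
  assumes sQ: "sets Q = sets (vecs n)" and pQ: "prob_space Q" and v: "v > 0"
  shows "smooth n Q v y > 0"
proof -
  interpret prob_space Q by fact
  note b = smooth_kernel_bounds[OF v order_refl, of y _ n]
  have i: "integrable Q (\<lambda>x. heat_real n v y x)"
    using b smooth_kernel_measurable[OF sQ, of v y]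
    by (intro integrable_const_bound[of _ "(1 / sqrt (2 * pi * v)) ^ n"]) (auto intro!: AE_I2)
  have "smooth n Q v y \<noteq> 0"
  proof
    assume "smooth n Q v y = 0"
    then have "AE x in Q. (heat_real n v y x) = 0"
      unfolding smooth_def using integral_nonneg_eq_0_iff_AE[OF i] b by auto
    moreover have "(heat_real n v y x) \<noteq> 0" for x
      using v normal_density_pos[of "sqrt v" 0] by (simp add: prod_zero_iff less_imp_neq[symmetric])
    ultimately have "AE x in Q. False" by simp
    then show False by simp
  qed
  then show ?thesis using smooth_bounds(1)[OF sQ pQ v order_refl, of y] by linarith
qed

lemma exp_abs_integrable: "integrable (leb n) (\<lambda>x. \<Prod>k<n. exp (- \<bar>x k\<bar> / 2))"
proof -
  interpret product_sigma_finite "\<lambda>_::nat. lborel :: real measure" ..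
  have e: "integrable lborel (\<lambda>x::real. indicator {0..} x *\<^sub>R exp (- x / 2))"
  proof -
    have "set_integrable lborel {0..} (\<lambda>x::real. exp (- (1/2) * x))"
    proof -
      have "((\<lambda>x::real. exp (- (1/2) * x)) has_integral exp (- (1/2) * 0) / (1/2)) {0..}"
        by (rule has_integral_exp_minus_to_infinity) simp
      then have "(\<lambda>x::real. exp (- (1/2) * x)) absolutely_integrable_on {0..}"
        by (intro nonnegative_absolutely_integrable_1) (auto simp: integrable_on_def)
      then show ?thesis
        unfolding set_integrable_def by (subst (asm) integrable_completion) auto
    qed
    then show ?thesis by (simp add: set_integrable_def)
  qed
  have "integrable lborel (\<lambda>x::real. indicator {0..} (0 + (-1) * x) *\<^sub>R exp (- (0 + (-1) * x) / 2))"
    by (rule lborel_integrable_real_affine[OF e]) simp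
  from Bochner_Integration.integrable_add[OF e this]
  have "integrable lborel (\<lambda>x::real. exp (- \<bar>x\<bar> / 2))"
  proof (rule Bochner_Integration.integrable_bound)
    show "AE x in lborel. norm (exp (- \<bar>x\<bar> / 2)) \<le> norm (indicator {0..} x *\<^sub>R exp (- x / 2) + indicator {0..} (0 + (-1) * x) *\<^sub>R exp (- (0 + (-1) * x) / 2) :: real)"
      by (intro AE_I2) (auto simp: indicator_def)
  qed measurable
  then show ?thesis by (intro product_integrable_prod) auto
qed

lemma affine_ratio_limits:
  fixes c d m :: real
  assumes "m > 0"
  shows "filterlim (\<lambda>u. (u + d) / m) at_top at_top"
    and "filterlim (\<lambda>u. (u + d) / m - c) at_top at_top"
    and "((\<lambda>u. (u + d) / m / ((u + d) / m - c)) \<longlongrightarrow> 1) at_top"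
  using assms by real_asymp+

locale tree_and_vector = brownian_tree M B \<eta> N \<tau> T + Wv: brownian_vector M' W "offspring_prod N \<eta>"
  for M :: "'a measure" and B \<eta> N \<tau> T and M' :: "'b measure" and W
begin

lemma beta_continuous:
  assumes "k < n" "\<omega> \<in> space M" "h \<le> L"
  shows "continuous_on {0..h} (\<lambda>s. \<beta> k (L - s) \<omega>)"
  by (rule continuous_on_compose2[OF B'_continuous[OF order_refl assms(1,2)]]) (use assms in \<open>auto intro!: continuous_intros\<close>)

abbreviation scaled_reach :: "real \<Rightarrow> real \<Rightarrow> (nat \<Rightarrow> real) \<Rightarrow> 'a \<Rightarrow> bool" where
  "scaled_reach h \<kappa> x \<omega> \<equiv> \<exists>s\<in>{0..h}. \<forall>k<n. x k < \<kappa> * (\<beta> k (L - s) \<omega> - \<beta> k L \<omega>) - \<kappa>\<^sup>2 * s"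

text \<open>Run backwards from \<open>T\<close>, scaled by \<open>\<kappa>/l\<close> in space and accordingly in time, the motions of the last segment have
  the law of \<open>W\<close>. On every dyadic grid this is \<open>gauss_steps_reverse_scale\<close>.\<close>
lemma beta_hit:
  assumes h: "0 < h" "h < L" and \<kappa>: "\<kappa> > 0" and l: "l > 0"
  shows "{\<omega> \<in> space M. scaled_reach h \<kappa> x \<omega>} \<in> events"
    and "prob {\<omega> \<in> space M. scaled_reach h \<kappa> x \<omega>} = Wv.hit l (\<kappa>\<^sup>2 * h / l\<^sup>2) x"
proof -
  let ?f = "\<lambda>k s \<omega>. \<kappa> * (\<beta> k (L - s) \<omega> - \<beta> k L \<omega>) - \<kappa>\<^sup>2 * s - x k"
  let ?R = "\<kappa>\<^sup>2 * h / l\<^sup>2"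
  have R: "?R > 0" using h \<kappa> l by simp
  have c: "\<And>k \<omega>. k < n \<Longrightarrow> \<omega> \<in> space M \<Longrightarrow> continuous_on {0..h} (\<lambda>t. ?f k t \<omega>)"
    by (intro continuous_intros beta_continuous) (use h in auto)
  have ms: "\<And>k t. k < n \<Longrightarrow> t \<in> {0..h} \<Longrightarrow> ?f k t \<in> borel_measurable M"
    by (intro borel_measurable_diff borel_measurable_times borel_measurable_const B'_measurable) (use h in auto)
  have e: "{\<omega> \<in> space M. scaled_reach h \<kappa> x \<omega>}
    = {\<omega> \<in> space M. \<exists>t\<in>{0..h}. \<forall>k<n. 0 < ?f k t \<omega>}" by simp
  show "{\<omega> \<in> space M. scaled_reach h \<kappa> x \<omega>} \<in> events"
    unfolding e by (rule dyadic_event(4)[OF h(1) c ms])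
  have "(\<lambda>m. prob {\<omega> \<in> space M. \<exists>j\<le>2^m. \<forall>k<n. ?f k (0 + real j * ((h - 0) / 2^m)) \<omega> > 0})
    \<longlonglongrightarrow> prob {\<omega> \<in> space M. \<exists>t\<in>{0..h}. \<forall>k<n. 0 < ?f k t \<omega>}"
    by (rule dyadic_event(5)[OF h(1) c ms])
  moreover have "prob {\<omega> \<in> space M. \<exists>j\<le>2^m. \<forall>k<n. ?f k (0 + real j * ((h - 0) / 2^m)) \<omega> > 0}
     = measure (gauss_steps n (2^m) (?R / 2^m)) (Wv.grid_hit (2^m) l (?R / 2^m) x)" for m
  proof -
    let ?m = "2^m :: nat" and ?\<delta> = "h / 2^m" and ?c = "- \<kappa> / l"
    let ?S = "incs n ?m"
    let ?D = "\<lambda>\<omega>. \<lambda>(k, j)\<in>steps n ?m. \<beta> k (L - h + real (Suc j) * ?\<delta>) \<omega> - \<beta> k (L - h + real j * ?\<delta>) \<omega>"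
    let ?r = "\<lambda>d. \<lambda>(k, i)\<in>steps n ?m. ?c * d (k, ?m - 1 - i)"
    have \<delta>: "?\<delta> > 0" using h by simp
    have Dm: "?D \<in> M \<rightarrow>\<^sub>M ?S"
      unfolding case_prod_beta
      by (intro measurable_restrict borel_measurable_diff B'_measurable) (use h \<delta> in auto)
    have rm: "?r \<in> ?S \<rightarrow>\<^sub>M ?S"
      unfolding case_prod_beta
      by (intro measurable_restrict borel_measurable_times borel_measurable_const measurable_component_singleton) auto
    have c\<delta>: "?c\<^sup>2 * ?\<delta> = ?R / 2^m" by (simp add: power_divide)
    have law: "distr M ?S (\<lambda>\<omega>. ?r (?D \<omega>)) = gauss_steps n ?m (?R / 2^m)"
    proof -
      have "distr M ?S (\<lambda>\<omega>. ?r (?D \<omega>)) = distr (distr M ?S ?D) ?S ?r"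
        unfolding distr_distr[OF rm Dm] by (simp only: comp_def)
      also have "distr M ?S ?D = gauss_steps n ?m ?\<delta>" by (rule increments_law) (use h in auto)
      also have "distr (gauss_steps n ?m ?\<delta>) ?S ?r = gauss_steps n ?m (?R / 2^m)"
        unfolding c\<delta>[symmetric] by (rule gauss_steps_reverse_scale) (use \<delta> \<kappa> l in auto)
      finally show ?thesis .
    qed
    have rDm: "(\<lambda>\<omega>. ?r (?D \<omega>)) \<in> M \<rightarrow>\<^sub>M ?S" by (rule measurable_compose[OF Dm rm])
    have sum: "l * (\<Sum>i<j. ?r (?D \<omega>) (k, i)) - l\<^sup>2 * (real j * (?R / 2^m)) = \<kappa> * (\<beta> k (L - real j * ?\<delta>) \<omega> - \<beta> k L \<omega>) - \<kappa>\<^sup>2 * (real j * ?\<delta>)"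
      if "j \<le> ?m" "k < n" for j k \<omega>
    proof -
      have pt: "L - h + real (?m - i) * ?\<delta> = L - real i * ?\<delta>" if "i \<le> ?m" for i
        using that by (simp add: of_nat_diff field_simps)
      have "(\<Sum>i<j. ?r (?D \<omega>) (k, i)) = (\<Sum>i<j. ?c * \<beta> k (L - real i * ?\<delta>) \<omega> - ?c * \<beta> k (L - real (Suc i) * ?\<delta>) \<omega>)"
      proof (rule sum.cong[OF refl])
        fix i assume "i \<in> {..<j}"
        then have i: "i < ?m" using that by auto
        then have "?r (?D \<omega>) (k, i) = ?c * (\<beta> k (L - h + real (Suc (?m - 1 - i)) * ?\<delta>) \<omega> - \<beta> k (L - h + real (?m - 1 - i) * ?\<delta>) \<omega>)"
          using that(2) by auto
        moreover have "Suc (?m - 1 - i) = ?m - i" "?m - 1 - i = ?m - Suc i" using i by auto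
        ultimately show "?r (?D \<omega>) (k, i) = ?c * \<beta> k (L - real i * ?\<delta>) \<omega> - ?c * \<beta> k (L - real (Suc i) * ?\<delta>) \<omega>"
          using pt[of i] pt[of "Suc i"] i by (simp only: right_diff_distrib less_imp_le Suc_le_eq)
      qed
      also have "\<dots> = ?c * \<beta> k (L - real 0 * ?\<delta>) \<omega> - ?c * \<beta> k (L - real j * ?\<delta>) \<omega>"
        by (induction j) auto
      finally have "l * (\<Sum>i<j. ?r (?D \<omega>) (k, i)) = \<kappa> * (\<beta> k (L - real j * ?\<delta>) \<omega> - \<beta> k L \<omega>)"
        using l by (simp only:) (simp add: field_simps)
      moreover have "l\<^sup>2 * (real j * (?R / 2^m)) = \<kappa>\<^sup>2 * (real j * ?\<delta>)" using l by simp
      ultimately show ?thesis by (simp only:)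
    qed
    have "{\<omega> \<in> space M. \<exists>j\<le>2^m. \<forall>k<n. ?f k (0 + real j * ((h - 0) / 2^m)) \<omega> > 0} = (\<lambda>\<omega>. ?r (?D \<omega>)) -` Wv.grid_hit ?m l (?R / 2^m) x \<inter> space M"
    proof (intro set_eqI)
      fix \<omega>
      show "\<omega> \<in> {\<omega> \<in> space M. \<exists>j\<le>2^m. \<forall>k<n. ?f k (0 + real j * ((h - 0) / 2^m)) \<omega> > 0} \<longleftrightarrow> \<omega> \<in> (\<lambda>\<omega>. ?r (?D \<omega>)) -` Wv.grid_hit ?m l (?R / 2^m) x \<inter> space M"
      proof (cases "\<omega> \<in> space M")
        case True
        have "(\<exists>j\<le>2^m. \<forall>k<n. ?f k (0 + real j * ((h - 0) / 2^m)) \<omega> > 0) \<longleftrightarrow> (\<exists>j\<le>?m. \<forall>k<n. x k < l * (\<Sum>i<j. ?r (?D \<omega>) (k, i)) - l\<^sup>2 * (real j * (?R / 2^m)))"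
          by (intro ex_cong1 conj_cong refl all_cong1 imp_cong) (simp only: sum add_0 diff_zero diff_gt_0_iff_gt)
        then show ?thesis using True measurable_space[OF rDm True]
          by (simp only: Wv.grid_hit_def vimage_eq Int_iff mem_Collect_eq Bex_def Ball_def atMost_iff lessThan_iff simp_thms)
      qed auto
    qed
    then show ?thesis
      unfolding law[symmetric] by (simp only: measure_distr[OF rDm Wv.grid_hit_sets])
  qed
  ultimately have "(\<lambda>m. measure (gauss_steps n (2^m) (?R / 2^m)) (Wv.grid_hit (2^m) l (?R / 2^m) x)) \<longlonglongrightarrow> prob {\<omega> \<in> space M. \<exists>t\<in>{0..h}. \<forall>k<n. 0 < ?f k t \<omega>}"
    by simp
  from LIMSEQ_unique[OF this Wv.hit_event(2)[OF R]]
  show "prob {\<omega> \<in> space M. scaled_reach h \<kappa> x \<omega>} = Wv.hit l ?R x"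
    unfolding e .
qed

lemma incoming_var_nonneg: "i \<le> \<eta> \<Longrightarrow> xvar i \<ge> 0"
proof (induction i)
  case (Suc i)
  then show ?case using \<tau>_less[of i] by simp
qed simp

lemma \<mu>_pos: "\<mu> > 0"
  using incoming_var_nonneg[of \<eta>] L_pos by simp

text \<open>The exponent \<open>b\<close> of the change of measure. It is chosen such that the shifted mean at time \<open>T\<close> is exactly
  the level \<open>u + c T\<close>.\<close>
definition slope :: "real \<Rightarrow> real \<Rightarrow> real" where
  "slope c u = (u + c * T) / \<mu>"

definition net_slope :: "real \<Rightarrow> real \<Rightarrow> real" where
  "net_slope c u = slope c u - c"

text \<open>Levels that are high enough for all the estimates. The window length \<open>1 / u\<close> is long compared with the scale
  \<open>u\<^sup>-\<^sup>2\<close> of the limit and short compared with 1. The bounds on the ratio keep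
  \<open>exp (b/\<kappa> \<Sum>\<^sub>k x\<^sub>k - 2 \<Sum>\<^sub>k max 0 x\<^sub>k)\<close> integrable.\<close>
definition good :: "real \<Rightarrow> real \<Rightarrow> bool" where
  "good c u \<longleftrightarrow> u > 0 \<and> 1 / u < L / 2 \<and> net_slope c u > 0 \<and>
     1 / 2 \<le> slope c u / net_slope c u \<and> slope c u / net_slope c u \<le> 3 / 2"

definition rescale :: "real \<Rightarrow> real \<Rightarrow> (nat \<Rightarrow> real) \<Rightarrow> nat \<Rightarrow> real" where
  "rescale c u x = (\<lambda>k\<in>{..<n}. 0 + (1 / net_slope c u) * x k)"

text \<open>The argument of the density: the state at \<open>T - 1 / u\<close> that leads to the final state \<open>- x/\<kappa>\<close>.\<close>
definition end_shift :: "real \<Rightarrow> real \<Rightarrow> (nat \<Rightarrow> real) \<Rightarrow> 'a \<Rightarrow> nat \<Rightarrow> real" where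
  "end_shift c u x \<omega> = (\<lambda>k\<in>{..<n}. - (\<beta> k L \<omega> - \<beta> k (L - 1 / u) \<omega>) + (- 1) * rescale c u x k)"

text \<open>The integrand after the substitution \<open>z = x/\<kappa>\<close>, without the factor \<open>exp (- n b\<^sup>2 \<mu>/2)\<close>; \<open>A\<close> is the event
  in the inner expectation.\<close>
definition integrand :: "real \<Rightarrow> real \<Rightarrow> (nat \<Rightarrow> real) \<Rightarrow> 'a set \<Rightarrow> real" where
  "integrand c u x A = exp (slope c u / net_slope c u * (\<Sum>k<n. x k)) *
     (\<integral>\<omega>. smooth n QX (L - 1 / u) (end_shift c u x \<omega>) * indicator A \<omega> \<partial>M)"

text \<open>\<open>f\<^sub>0(0)\<close>: the density at 0 of the vector of the branches at time \<open>T\<close>.\<close>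
definition limit_density :: real where
  "limit_density = smooth n QX L (\<lambda>_. 0)"

lemma sets_QX: "sets QX = sets (vecs n)" by simp

lemma limit_density_pos: "limit_density > 0"
  unfolding limit_density_def by (rule smooth_pos[OF sets_QX prob_space_QX L_pos])

lemma slope_at_top: "filterlim (slope c) at_top at_top"
  unfolding slope_def[abs_def] by (rule affine_ratio_limits(1)[OF \<mu>_pos])

lemma net_slope_at_top: "filterlim (net_slope c) at_top at_top"
  unfolding net_slope_def[abs_def] slope_def by (rule affine_ratio_limits(2)[OF \<mu>_pos])

lemma slope_ratio: "((\<lambda>u. slope c u / net_slope c u) \<longlongrightarrow> 1) at_top"
  unfolding net_slope_def slope_def by (rule affine_ratio_limits(3)[OF \<mu>_pos])

lemma eventually_good: "\<forall>\<^sub>F u in at_top. good c u"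
proof -
  have "\<forall>\<^sub>F u in at_top. 1 / u < L / (2::real)"
    by (rule order_tendstoD(2)[of _ 0]) (real_asymp, use L_pos in simp)
  moreover have "\<forall>\<^sub>F u in at_top. net_slope c u > 0"
    using net_slope_at_top by (simp add: filterlim_at_top_dense)
  moreover have "\<forall>\<^sub>F u in at_top. slope c u / net_slope c u > 1 / 2"
    by (rule order_tendstoD(1)[OF slope_ratio]) simp
  moreover have "\<forall>\<^sub>F u in at_top. slope c u / net_slope c u < 3 / 2"
    by (rule order_tendstoD(2)[OF slope_ratio]) simp
  ultimately show ?thesis
    using eventually_gt_at_top[of 0] by eventually_elim (auto simp: good_def)
qed

lemma end_shift_measurable:
  assumes "good c u"
  shows "end_shift c u x \<in> M \<rightarrow>\<^sub>M vecs n"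
  unfolding end_shift_def[abs_def] using assms L_pos
  by (intro measurable_restrict borel_measurable_add borel_measurable_uminus borel_measurable_diff borel_measurable_const B'_measurable)
     (auto simp: good_def)

lemma smooth_end_shift:
  assumes g: "good c u"
  shows "(\<lambda>\<omega>. smooth n QX (L - 1 / u) (end_shift c u x \<omega>)) \<in> borel_measurable M"
    and "0 \<le> smooth n QX (L - 1 / u) (end_shift c u x \<omega>)"
    and "smooth n QX (L - 1 / u) (end_shift c u x \<omega>) \<le> (1 / sqrt (2 * pi * (L / 2))) ^ n"
proof -
  have v: "0 < L / 2" "L / 2 \<le> L - 1 / u" using g L_pos by (auto simp: good_def)
  then have v': "L - 1 / u > 0" by simp
  have "(\<lambda>\<omega>. enn2real (smoothed n QX (L - 1 / u) (end_shift c u x \<omega>))) \<in> borel_measurable M"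
    by (intro measurable_compose[OF measurable_compose[OF end_shift_measurable[OF g] smoothed_measurable[OF sets_QX prob_space_QX]]]) simp
  then show "(\<lambda>\<omega>. smooth n QX (L - 1 / u) (end_shift c u x \<omega>)) \<in> borel_measurable M"
    unfolding smoothed_eq_smooth[OF sets_QX prob_space_QX v']
    by (simp add: enn2real_ennreal smooth_bounds(1)[OF sets_QX prob_space_QX v])
  show "0 \<le> smooth n QX (L - 1 / u) (end_shift c u x \<omega>)"
    "smooth n QX (L - 1 / u) (end_shift c u x \<omega>) \<le> (1 / sqrt (2 * pi * (L / 2))) ^ n"
    by (rule smooth_bounds[OF sets_QX prob_space_QX v])+
qed

lemma kernel_integral:
  assumes g: "good c u" and A: "A \<in> events"
  shows "(\<integral>\<^sup>+\<omega>. kernel (slope c u) (1 / u) (rescale c u x) \<omega> * indicator A \<omega> \<partial>M)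
    = ennreal (exp (- (real n * (slope c u)\<^sup>2 * \<mu> / 2)) * integrand c u x A)"
proof -
  let ?s = "\<lambda>\<omega>. smooth n QX (L - 1 / u) (end_shift c u x \<omega>)"
  let ?K = "(1 / sqrt (2 * pi * (L / 2))) ^ n"
  let ?c = "exp (slope c u / net_slope c u * (\<Sum>k<n. x k) - real n * (slope c u)\<^sup>2 * \<mu> / 2)"
  have v': "L - 1 / u > 0" using g L_pos by (auto simp: good_def)
  note [measurable] = smooth_end_shift(1)[OF g] A
  have K: "?K \<ge> 0" by (intro zero_le_power) (use L_pos in auto)
  have int: "integrable M (\<lambda>\<omega>. ?s \<omega> * indicator A \<omega>)"
    by (intro integrable_const_bound[of _ ?K] AE_I2)
       (use smooth_end_shift(2,3)[OF g] K in \<open>auto simp: indicator_def\<close>)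
  have sum: "(\<Sum>k<n. rescale c u x k) = (\<Sum>k<n. x k) / net_slope c u"
    unfolding sum_divide_distrib by (intro sum.cong) (auto simp: rescale_def)
  have "kernel (slope c u) (1 / u) (rescale c u x) \<omega> * indicator A \<omega> = ennreal (?c * (?s \<omega> * indicator A \<omega>))" for \<omega>
    unfolding kernel_def sum smoothed_eq_smooth[OF sets_QX prob_space_QX v'] end_shift_def[symmetric]
    by (auto simp: indicator_def ennreal_mult'[symmetric])
  then have "(\<integral>\<^sup>+\<omega>. kernel (slope c u) (1 / u) (rescale c u x) \<omega> * indicator A \<omega> \<partial>M) = (\<integral>\<^sup>+\<omega>. ennreal (?c * (?s \<omega> * indicator A \<omega>)) \<partial>M)"
    by simp
  also have "\<dots> = ennreal (\<integral>\<omega>. ?c * (?s \<omega> * indicator A \<omega>) \<partial>M)"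
    by (rule nn_integral_eq_integral)
       (use int smooth_end_shift(2)[OF g] in \<open>auto simp: indicator_def\<close>)
  also have "(\<integral>\<omega>. ?c * (?s \<omega> * indicator A \<omega>) \<partial>M) = ?c * (\<integral>\<omega>. ?s \<omega> * indicator A \<omega> \<partial>M)"
    by (rule integral_mult_right_zero)
  also have "\<dots> = exp (- (real n * (slope c u)\<^sup>2 * \<mu> / 2)) * integrand c u x A"
    unfolding integrand_def mult.assoc[symmetric] exp_add[symmetric] by (simp only: add.commute[of "- _"] diff_conv_add_uminus[symmetric])
  finally show ?thesis .
qed

lemma integrand_bounds:
  assumes g: "good c u" and A: "A \<in> events" and p: "prob A \<le> exp (- 2 * (\<Sum>k<n. max 0 (x k)))"
  shows "0 \<le> integrand c u x A"
    and "integrand c u x A \<le> (1 / sqrt (2 * pi * (L / 2))) ^ n * (\<Prod>k<n. exp (- \<bar>x k\<bar> / 2))"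
proof -
  let ?s = "\<lambda>\<omega>. smooth n QX (L - 1 / u) (end_shift c u x \<omega>)"
  let ?K = "(1 / sqrt (2 * pi * (L / 2))) ^ n"
  let ?q = "slope c u / net_slope c u"
  note [measurable] = smooth_end_shift(1)[OF g] A
  note b = smooth_end_shift(2,3)[OF g, of x]
  have K: "?K \<ge> 0" by (intro zero_le_power) (use L_pos in auto)
  have int: "integrable M (\<lambda>\<omega>. ?s \<omega> * indicator A \<omega>)"
    by (intro integrable_const_bound[of _ ?K] AE_I2) (use b K in \<open>auto simp: indicator_def\<close>)
  have int2: "integrable M (\<lambda>\<omega>. ?K * indicator A \<omega>)"
    using A by (intro integrable_mult_right integrable_real_indicator) (auto simp: emeasure_eq_measure)
  have "(\<integral>\<omega>. ?s \<omega> * indicator A \<omega> \<partial>M) \<le> (\<integral>\<omega>. ?K * indicator A \<omega> \<partial>M)"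
    by (intro Bochner_Integration.integral_mono int int2) (use b K in \<open>auto simp: indicator_def\<close>)
  also have "\<dots> = ?K * prob A" by simp
  also have "\<dots> \<le> ?K * exp (- 2 * (\<Sum>k<n. max 0 (x k)))" by (rule mult_left_mono[OF p K])
  finally have le: "(\<integral>\<omega>. ?s \<omega> * indicator A \<omega> \<partial>M) \<le> ?K * exp (- 2 * (\<Sum>k<n. max 0 (x k)))" .
  show "0 \<le> integrand c u x A"
    unfolding integrand_def using b by (intro mult_nonneg_nonneg Bochner_Integration.integral_nonneg) auto
  have "integrand c u x A \<le> exp (?q * (\<Sum>k<n. x k)) * (?K * exp (- 2 * (\<Sum>k<n. max 0 (x k))))"
    unfolding integrand_def by (intro mult_left_mono le) auto
  also have "\<dots> = ?K * exp (\<Sum>k<n. ?q * x k - 2 * max 0 (x k))"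
  proof -
    have "(\<Sum>k<n. ?q * x k - 2 * max 0 (x k)) = ?q * (\<Sum>k<n. x k) + - 2 * (\<Sum>k<n. max 0 (x k))"
      by (simp only: sum_subtractf sum_distrib_left[symmetric])
    then show ?thesis by (simp only: exp_add ac_simps)
  qed
  also have "\<dots> \<le> ?K * exp (\<Sum>k<n. - \<bar>x k\<bar> / 2)"
  proof (intro mult_left_mono K iffD2[OF exp_le_cancel_iff] sum_mono)
    fix k
    have q: "1 / 2 \<le> ?q" "?q \<le> 3 / 2" using g by (auto simp: good_def)
    show "?q * x k - 2 * max 0 (x k) \<le> - \<bar>x k\<bar> / 2"
    proof (cases "x k \<ge> 0")
      case True
      then have "?q * x k \<le> 3 / 2 * x k" using q by (intro mult_right_mono)
      moreover have "max 0 (x k) = x k" "\<bar>x k\<bar> = x k" using True by simp_all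
      ultimately show ?thesis by linarith
    next
      case False
      then have "?q * x k \<le> 1 / 2 * x k" using q by (intro mult_right_mono_neg) auto
      moreover have "max 0 (x k) = 0" "\<bar>x k\<bar> = - x k" using False by simp_all
      ultimately show ?thesis by linarith
    qed
  qed
  also have "exp (\<Sum>k<n. - \<bar>x k\<bar> / 2) = (\<Prod>k<n. exp (- \<bar>x k\<bar> / 2))" by (rule exp_sum) simp
  finally show "integrand c u x A \<le> ?K * (\<Prod>k<n. exp (- \<bar>x k\<bar> / 2))" .
qed

text \<open>The density converges almost surely to a constant. Hence it can be taken out of the expectation,
  although it is not independent of \<open>A u\<close>.\<close>
lemma integrand_tendsto:
  assumes A: "\<And>u. good c u \<Longrightarrow> A u \<in> events" and p: "((\<lambda>u. prob (A u)) \<longlongrightarrow> p) at_top"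
  shows "((\<lambda>u. integrand c u x (A u)) \<longlongrightarrow> limit_density * p * exp (\<Sum>k<n. x k)) at_top"
proof -
  let ?s = "\<lambda>u \<omega>. smooth n QX (L - 1 / u) (end_shift c u x \<omega>)"
  let ?K = "(1 / sqrt (2 * pi * (L / 2))) ^ n"
  let ?d = "\<lambda>u \<omega>. if good c u then \<bar>?s u \<omega> - limit_density\<bar> else 0"
  have K: "?K \<ge> 0" by (intro zero_le_power) (use L_pos in auto)
  have ld: "0 \<le> limit_density" "limit_density \<le> ?K"
    unfolding limit_density_def using smooth_bounds[OF sets_QX prob_space_QX, of "L / 2" L] L_pos by auto
  have ptw: "((\<lambda>u. ?s u \<omega>) \<longlongrightarrow> limit_density) at_top" if \<omega>: "\<omega> \<in> space M" for \<omega>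
    unfolding limit_density_def
  proof (rule smooth_tendsto[OF sets_QX prob_space_QX L_pos])
    have inv: "((\<lambda>u::real. 1 / u) \<longlongrightarrow> 0) at_top" by real_asymp
    from tendsto_diff[OF tendsto_const[of L] inv] show "((\<lambda>u. L - 1 / u) \<longlongrightarrow> L) at_top" by simp
    fix k assume k: "k < n"
    have "((\<lambda>s. \<beta> k (L - s) \<omega>) \<longlongrightarrow> \<beta> k (L - 0) \<omega>) (at 0 within {0..L})"
      using beta_continuous[OF k \<omega> order_refl] unfolding continuous_on_def by (rule bspec) (use L_pos in simp)
    moreover have "filterlim (\<lambda>u::real. 1 / u) (at 0 within {0..L}) at_top"
      unfolding filterlim_at
    proof (intro conjI inv)
      have "\<forall>\<^sub>F u in at_top. 1 / u < L" by (rule order_tendstoD(2)[OF inv L_pos])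
      then show "\<forall>\<^sub>F u in at_top. 1 / u \<in> {0..L} \<and> 1 / u \<noteq> 0"
        using eventually_gt_at_top[of 0] by eventually_elim auto
    qed
    ultimately have "((\<lambda>u. \<beta> k (L - 1 / u) \<omega>) \<longlongrightarrow> \<beta> k (L - 0) \<omega>) at_top" by (rule filterlim_compose)
    moreover have "((\<lambda>u. 1 / net_slope c u) \<longlongrightarrow> 0) at_top"
      by (rule tendsto_divide_0[OF tendsto_const filterlim_at_top_imp_at_infinity[OF net_slope_at_top]])
    ultimately have "((\<lambda>u. - (\<beta> k L \<omega> - \<beta> k (L - 1 / u) \<omega>) + (- 1) * (0 + (1 / net_slope c u) * x k)) \<longlongrightarrow> - (\<beta> k L \<omega> - \<beta> k (L - 0) \<omega>) + (- 1) * (0 + 0 * x k)) at_top"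
      by (intro tendsto_intros)
    then show "((\<lambda>u. end_shift c u x \<omega> k) \<longlongrightarrow> 0) at_top" using k by (simp add: end_shift_def rescale_def)
  qed
  have d_bound: "norm (?d u \<omega>) \<le> ?K" for u \<omega>
    using smooth_end_shift(2,3)[of c u x \<omega>] ld K by (auto simp: abs_if)
  have "((\<lambda>u. \<integral>\<omega>. ?d u \<omega> \<partial>M) \<longlongrightarrow> (\<integral>\<omega>. 0 \<partial>M)) at_top"
  proof (rule integral_dominated_convergence_at_top)
    show "integrable M (\<lambda>_. ?K)" by simp
    show "?d u \<in> borel_measurable M" for u
      using smooth_end_shift(1)[of c u x] by (cases "good c u") auto
    show "AE \<omega> in M. ((\<lambda>u. ?d u \<omega>) \<longlongrightarrow> 0) at_top"
    proof (rule AE_I2)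
      fix \<omega> assume "\<omega> \<in> space M"
      then have "((\<lambda>u. \<bar>?s u \<omega> - limit_density\<bar>) \<longlongrightarrow> 0) at_top"
        by (intro tendsto_rabs_zero LIM_zero ptw)
      then show "((\<lambda>u. ?d u \<omega>) \<longlongrightarrow> 0) at_top"
        by (rule Lim_transform_eventually) (rule eventually_mono[OF eventually_good[of c]], simp)
    qed
    show "\<forall>\<^sub>F u in at_top. AE \<omega> in M. norm (?d u \<omega>) \<le> ?K"
      by (intro always_eventually allI AE_I2 d_bound)
  qed simp
  then have d0: "((\<lambda>u. \<integral>\<omega>. ?d u \<omega> \<partial>M) \<longlongrightarrow> 0) at_top" by simp
  have "((\<lambda>u. (\<integral>\<omega>. ?s u \<omega> * indicator (A u) \<omega> \<partial>M) - limit_density * prob (A u)) \<longlongrightarrow> 0) at_top"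
  proof (rule Lim_null_comparison[OF _ d0], rule eventually_mono[OF eventually_good[of c]])
    fix u assume g: "good c u"
    note [measurable] = smooth_end_shift(1)[OF g, of x] A[OF g]
    note b = smooth_end_shift(2,3)[OF g, of x]
    have i1: "integrable M (\<lambda>\<omega>. ?s u \<omega> * indicator (A u) \<omega>)"
      by (intro integrable_const_bound[of _ ?K] AE_I2) (use b K in \<open>auto simp: indicator_def\<close>)
    have i2: "integrable M (\<lambda>\<omega>. limit_density * indicator (A u) \<omega>)"
      using A[OF g] by (intro integrable_mult_right integrable_real_indicator) (auto simp: emeasure_eq_measure)
    have i3: "integrable M (?d u)"
      by (intro integrable_const_bound[of _ ?K] AE_I2 d_bound) (use g in simp)
    have e: "(\<integral>\<omega>. ?s u \<omega> * indicator (A u) \<omega> \<partial>M) - limit_density * prob (A u) = (\<integral>\<omega>. ?s u \<omega> * indicator (A u) \<omega> - limit_density * indicator (A u) \<omega> \<partial>M)"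
      unfolding Bochner_Integration.integral_diff[OF i1 i2] by (simp add: A[OF g])
    show "norm ((\<integral>\<omega>. ?s u \<omega> * indicator (A u) \<omega> \<partial>M) - limit_density * prob (A u)) \<le> (\<integral>\<omega>. ?d u \<omega> \<partial>M)"
      unfolding e
      by (rule order_trans[OF integral_norm_bound Bochner_Integration.integral_mono])
         (use i1 i2 i3 g in \<open>auto simp: indicator_def\<close>)
  qed
  from tendsto_add[OF this tendsto_mult[OF tendsto_const[of limit_density] p]]
  have "((\<lambda>u. \<integral>\<omega>. ?s u \<omega> * indicator (A u) \<omega> \<partial>M) \<longlongrightarrow> limit_density * p) at_top" by simp
  moreover have "((\<lambda>u. exp (slope c u / net_slope c u * (\<Sum>k<n. x k))) \<longlongrightarrow> exp (1 * (\<Sum>k<n. x k))) at_top"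
    by (intro tendsto_intros slope_ratio)
  ultimately show ?thesis
    unfolding integrand_def using tendsto_mult[of _ "exp (1 * (\<Sum>k<n. x k))" at_top _ "limit_density * p"] by (simp add: mult.commute)
qed

text \<open>Dominated convergence, for the window and for the end point at once: \<open>S\<close> is the condition that remains after the
  change of measure and \<open>p x\<close> is the limit of its probability.\<close>
lemma laplace_limit:
  fixes S :: "real \<Rightarrow> (nat \<Rightarrow> real) \<Rightarrow> 'a \<Rightarrow> bool" and Ev :: "real \<Rightarrow> 'a set"
  assumes Ev: "\<And>u. good c u \<Longrightarrow> emeasure M (Ev u)
        = (\<integral>\<^sup>+z. \<integral>\<^sup>+\<omega>. kernel (slope c u) (1 / u) z \<omega> * (if S u z \<omega> then 1 else 0) \<partial>M \<partial>leb n)"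
    and meas: "\<And>u. good c u \<Longrightarrow> (\<lambda>z. \<integral>\<^sup>+\<omega>. kernel (slope c u) (1 / u) z \<omega> * (if S u z \<omega> then 1 else 0) \<partial>M) \<in> borel_measurable (leb n)"
    and S: "\<And>u x. good c u \<Longrightarrow> {\<omega> \<in> space M. S u (rescale c u x) \<omega>} \<in> events"
    and bound: "\<And>u x. good c u \<Longrightarrow> prob {\<omega> \<in> space M. S u (rescale c u x) \<omega>} \<le> exp (- 2 * (\<Sum>k<n. max 0 (x k)))"
    and lim: "\<And>x. ((\<lambda>u. prob {\<omega> \<in> space M. S u (rescale c u x) \<omega>}) \<longlongrightarrow> p x) at_top"
    and p: "p \<in> borel_measurable (leb n)"
  shows "((\<lambda>u. prob (Ev u) * (net_slope c u ^ n * exp (real n * (slope c u)\<^sup>2 * \<mu> / 2)))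
     \<longlongrightarrow> limit_density * (\<integral>x. p x * exp (\<Sum>k<n. x k) \<partial>leb n)) at_top"
proof -
  let ?A = "\<lambda>u x. {\<omega> \<in> space M. S u (rescale c u x) \<omega>}"
  let ?s = "\<lambda>u x. if good c u then integrand c u x (?A u x) else 0"
  let ?F = "\<lambda>u z. \<integral>\<^sup>+\<omega>. kernel (slope c u) (1 / u) z \<omega> * (if S u z \<omega> then 1 else 0) \<partial>M"
  let ?K = "(1 / sqrt (2 * pi * (L / 2))) ^ n"
  let ?w = "\<lambda>x. ?K * (\<Prod>k<n. exp (- \<bar>x k\<bar> / 2))"
  let ?e = "\<lambda>u. exp (- (real n * (slope c u)\<^sup>2 * \<mu> / 2))"
  note [measurable_cong] = sets_leb[of n]
  have inner: "(?F u (rescale c u x))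
     = ennreal (?e u * ?s u x)" if g: "good c u" for u x
  proof -
    have "(?F u (rescale c u x))
      = (\<integral>\<^sup>+\<omega>. kernel (slope c u) (1 / u) (rescale c u x) \<omega> * indicator (?A u x) \<omega> \<partial>M)"
      by (intro nn_integral_cong) (auto simp: indicator_def)
    then show ?thesis using kernel_integral[OF g S[OF g], of x x] g by simp
  qed
  have rescale_meas: "rescale c u \<in> vecs n \<rightarrow>\<^sub>M vecs n" for u
    unfolding rescale_def[abs_def]
    by (intro measurable_restrict borel_measurable_add borel_measurable_times borel_measurable_const measurable_component_singleton)
  have s_meas: "?s u \<in> borel_measurable (leb n)" for u
  proof (cases "good c u")
    case True
    have "(\<lambda>x. ?F u (rescale c u x)) \<in> borel_measurable (vecs n)"
      by (rule measurable_compose[OF rescale_meas]) (use meas[OF True] in measurable)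
    then have "(\<lambda>x. ennreal (?e u * ?s u x)) \<in> borel_measurable (vecs n)" using inner[OF True] by simp
    then have m: "(\<lambda>x. enn2real (ennreal (?e u * ?s u x)) / ?e u) \<in> borel_measurable (vecs n)" by measurable
    have "enn2real (ennreal (?e u * ?s u x)) / ?e u = ?s u x" for x
      using integrand_bounds(1)[OF True S[OF True] bound[OF True], of x] True by simp
    then show ?thesis using m by (simp cong: measurable_cong_sets)
  qed simp
  have w_int: "integrable (leb n) ?w" by (intro integrable_mult_right exp_abs_integrable)
  have s_bound: "norm (?s u x) \<le> ?w x" for u x
  proof (cases "good c u")
    case True
    then show ?thesis using integrand_bounds[OF True S[OF True] bound[OF True], of x] by simp
  next
    case False
    have "?w x \<ge> 0" by (intro mult_nonneg_nonneg prod_nonneg zero_le_power) (use L_pos in auto)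
    then show ?thesis using False by simp
  qed
  have conv: "((\<lambda>u. \<integral>x. ?s u x \<partial>leb n) \<longlongrightarrow> (\<integral>x. limit_density * p x * exp (\<Sum>k<n. x k) \<partial>leb n)) at_top"
  proof (rule integral_dominated_convergence_at_top)
    note p[measurable]
    show "(\<lambda>x. limit_density * p x * exp (\<Sum>k<n. x k)) \<in> borel_measurable (leb n)" by measurable
    show "AE x in leb n. ((\<lambda>u. ?s u x) \<longlongrightarrow> limit_density * p x * exp (\<Sum>k<n. x k)) at_top"
    proof (rule AE_I2)
      fix x
      have "((\<lambda>u. integrand c u x (?A u x)) \<longlongrightarrow> limit_density * p x * exp (\<Sum>k<n. x k)) at_top"
        by (rule integrand_tendsto[OF S lim])
      then show "((\<lambda>u. ?s u x) \<longlongrightarrow> limit_density * p x * exp (\<Sum>k<n. x k)) at_top"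
        by (rule Lim_transform_eventually) (rule eventually_mono[OF eventually_good[of c]], simp)
    qed
    show "\<forall>\<^sub>F u in at_top. AE x in leb n. norm (?s u x) \<le> ?w x"
      by (intro always_eventually allI AE_I2 s_bound)
  qed (use s_meas w_int in auto)
  have eq: "(\<integral>x. limit_density * p x * exp (\<Sum>k<n. x k) \<partial>leb n) = limit_density * (\<integral>x. p x * exp (\<Sum>k<n. x k) \<partial>leb n)"
    unfolding mult.assoc by (rule integral_mult_right_zero)
  have ev: "\<forall>\<^sub>F u in at_top. (\<integral>x. ?s u x \<partial>leb n) = prob (Ev u) * (net_slope c u ^ n * exp (real n * (slope c u)\<^sup>2 * \<mu> / 2))"
  proof (rule eventually_mono[OF eventually_good[of c]])
    fix u assume g: "good c u"
    then have \<kappa>: "net_slope c u > 0" by (simp add: good_def)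
    have s0: "?s u x \<ge> 0" for x using integrand_bounds(1)[OF g S[OF g] bound[OF g], of x] g by simp
    have s_int: "integrable (leb n) (?s u)"
      by (rule Bochner_Integration.integrable_bound[OF w_int s_meas]) (intro AE_I2 order_trans[OF s_bound], simp)
    have F: "?F u \<in> borel_measurable (vecs n)" using meas[OF g] by measurable
    define J where "J = (\<integral>x. ?s u x \<partial>leb n)"
    have J: "J \<ge> 0" unfolding J_def by (intro Bochner_Integration.integral_nonneg s0)
    have e1: "(\<integral>\<^sup>+z. ?F u z \<partial>leb n) = ennreal (\<bar>1 / net_slope c u\<bar> ^ n) * (\<integral>\<^sup>+x. ?F u (\<lambda>k\<in>{..<n}. (\<lambda>_. 0) k + (1 / net_slope c u) * x k) \<partial>leb n)"
      by (rule leb_affine[OF _ F]) (use \<kappa> in auto)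
    have e2: "(\<integral>\<^sup>+x. ?F u (\<lambda>k\<in>{..<n}. (\<lambda>_. 0) k + (1 / net_slope c u) * x k) \<partial>leb n) = (\<integral>\<^sup>+x. ennreal (?e u * ?s u x) \<partial>leb n)"
      unfolding rescale_def[symmetric] by (intro nn_integral_cong inner[OF g])
    have e3: "(\<integral>\<^sup>+x. ennreal (?e u * ?s u x) \<partial>leb n) = ennreal (\<integral>x. ?e u * ?s u x \<partial>leb n)"
      by (rule nn_integral_eq_integral[OF integrable_mult_right[OF s_int]]) (intro AE_I2 mult_nonneg_nonneg s0, simp)
    have e4: "(\<integral>x. ?e u * ?s u x \<partial>leb n) = ?e u * J" unfolding J_def by (rule integral_mult_right_zero)
    have e: "emeasure M (Ev u) = ennreal (\<bar>1 / net_slope c u\<bar> ^ n) * ennreal (?e u * J)"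
      unfolding Ev[OF g] e1 e2 e3 e4 by (rule refl)
    have "ennreal (prob (Ev u)) = ennreal (\<bar>1 / net_slope c u\<bar> ^ n * (?e u * J))"
      by (subst ennreal_mult') (simp, simp only: emeasure_eq_measure[symmetric] e)
    then have "prob (Ev u) = \<bar>1 / net_slope c u\<bar> ^ n * (?e u * J)"
      using J by (subst (asm) ennreal_inj) auto
    then have "prob (Ev u) * (net_slope c u ^ n * exp (real n * (slope c u)\<^sup>2 * \<mu> / 2)) = J"
      using \<kappa> by (simp add: exp_minus power_divide field_simps)
    then show "(\<integral>x. ?s u x \<partial>leb n) = prob (Ev u) * (net_slope c u ^ n * exp (real n * (slope c u)\<^sup>2 * \<mu> / 2))"
      unfolding J_def by (rule sym)
  qed
  show ?thesis by (rule Lim_transform_eventually[OF conv[unfolded eq] ev])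
qed

end

section \<open>Numerator and denominator near the end\<close>

lemma integral_exp_neg: "(\<integral>x. (if x < 0 then exp x else 0) \<partial>lborel) = (1::real)"
proof -
  interpret e: prob_space "density lborel (\<lambda>x. ennreal (exponential_density 1 x))"
    by (rule prob_space_exponential_density) simp
  have "(\<integral>\<^sup>+x. ennreal (exponential_density 1 x) \<partial>lborel) = 1"
    using e.emeasure_space_1 by (simp add: emeasure_density)
  then have 1: "(\<integral>x. exponential_density 1 x \<partial>lborel) = 1"
    by (subst integral_eq_nn_integral) (auto simp: exponential_density_nonneg)
  have "(\<integral>x. (if x < 0 then exp x else 0) \<partial>lborel) = \<bar>-1\<bar> *\<^sub>R (\<integral>x. (if 0 + (-1) * x < 0 then exp (0 + (-1) * x) else 0) \<partial>lborel :: real)"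
    by (rule lborel_integral_real_affine) simp
  also have "(\<integral>x. (if 0 + (-1) * x < 0 then exp (0 + (-1) * x) else 0) \<partial>lborel :: real) = (\<integral>x. exponential_density 1 x \<partial>lborel)"
  proof (rule integral_cong_AE)
    show "AE x in lborel. (if 0 + (-1) * x < 0 then exp (0 + (-1) * x) else 0) = exponential_density 1 x"
      using AE_lborel_singleton[of "0::real"] by eventually_elim (auto simp: exponential_density_def)
  qed measurable
  finally show ?thesis using 1 by simp
qed

lemma integral_exp_orthant:
  "(\<integral>x. (if \<forall>k<n. x k < 0 then 1 else 0) * exp (\<Sum>k<n. x k) \<partial>leb n) = (1::real)"
proof -
  interpret product_sigma_finite "\<lambda>_::nat. lborel :: real measure" ..
  have i: "integrable lborel (\<lambda>x::real. if x < 0 then exp x else 0)"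
    using integral_exp_neg not_integrable_integral_eq by fastforce
  have "(if \<forall>k<n. x k < 0 then 1 else 0) * exp (\<Sum>k<n. x k) = (\<Prod>k<n. if x k < 0 then exp (x k) else 0 :: real)" for x
    by (auto simp: exp_sum prod_zero_iff intro!: prod.cong)
  then have "(\<integral>x. (if \<forall>k<n. x k < 0 then 1 else 0) * exp (\<Sum>k<n. x k) \<partial>leb n) = (\<integral>x. (\<Prod>k<n. if x k < 0 then exp (x k) else 0 :: real) \<partial>leb n)"
    by simp
  also have "\<dots> = (\<Prod>k<n. \<integral>x. (if x < 0 then exp x else 0) \<partial>lborel)"
    by (rule product_integral_prod) (use i in auto)
  finally show ?thesis by (simp add: integral_exp_neg)
qed

text \<open>Both use the window length \<open>1 / u\<close>. The first limit says that it contains the whole scale \<open>u\<^sup>-\<^sup>2\<close> in the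
  limit, the second one that the rest of \<open>[0, T]\<close> is negligible.\<close>
lemma real_limits:
  fixes c d m l :: real
  assumes "m > 0" "l > 0"
  shows "filterlim (\<lambda>u. ((u + d) / m - c)\<^sup>2 * (1 / u) / l\<^sup>2) at_top at_top"
    and "\<And>r k. r > 0 \<Longrightarrow> ((\<lambda>u. ((u + d) / m - c) ^ k * exp (- (r * (1 / u * (((u + d) / m)\<^sup>2 / 2 - c * ((u + d) / m)))))) \<longlongrightarrow> 0) at_top"
  using assms by real_asymp+

context tree_and_vector begin

abbreviation "win c u \<equiv> {\<omega> \<in> space M. \<exists>s\<in>{0..1 / u}. \<forall>k<n. u + c * T - c * s < Z \<eta> (L - s) \<omega> k}"
abbreviation "end_event c u \<equiv> {\<omega> \<in> space M. \<forall>k<n. u + c * T < Z \<eta> L \<omega> k}"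
text \<open>The reciprocal of the common order of magnitude of both probabilities.\<close>
abbreviation "norming c u \<equiv> net_slope c u ^ n * exp (real n * (slope c u)\<^sup>2 * \<mu> / 2)"

lemma slope_\<mu>: "slope c u * \<mu> = u + c * T"
  using \<mu>_pos by (simp add: slope_def)

lemma goodD:
  assumes "good c u"
  shows "u > 0" "0 < 1 / u" "1 / u < L" "net_slope c u > 0"
  using assms L_pos by (auto simp: good_def)

lemma win_limit:
  "((\<lambda>u. prob (win c u) * norming c u) \<longlongrightarrow> limit_density * H_const M' W n (1 / \<mu>)) at_top"
proof -
  let ?l = "1 / \<mu>"
  have l: "?l > 0" using \<mu>_pos by simp
  let ?S = "\<lambda>u z \<omega>. reach (1 / u) (slope c u - c) z \<omega>"
  have S_eq: "{\<omega> \<in> space M. ?S u (rescale c u x) \<omega>} = {\<omega> \<in> space M. scaled_reach (1 / u) (net_slope c u) x \<omega>}"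
    if g: "good c u" for u x
  proof (intro Collect_cong conj_cong refl bex_cong all_cong1 imp_cong)
    fix \<omega> s k assume k: "k < n"
    have "(rescale c u x k < \<beta> k (L - s) \<omega> - \<beta> k L \<omega> - net_slope c u * s) \<longleftrightarrow> x k < net_slope c u * (\<beta> k (L - s) \<omega> - \<beta> k L \<omega> - net_slope c u * s)"
      using goodD(4)[OF g] k by (simp add: rescale_def pos_divide_less_eq mult.commute)
    then show "(rescale c u x k < \<beta> k (L - s) \<omega> - \<beta> k L \<omega> - (slope c u - c) * s) = (x k < net_slope c u * (\<beta> k (L - s) \<omega> - \<beta> k L \<omega>) - (net_slope c u)\<^sup>2 * s)"
      unfolding net_slope_def[symmetric] by (simp add: power2_eq_square algebra_simps)
  qed
  have hit: "prob {\<omega> \<in> space M. ?S u (rescale c u x) \<omega>} = Wv.hit ?l ((net_slope c u)\<^sup>2 * (1 / u) / ?l\<^sup>2) x"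
    "{\<omega> \<in> space M. ?S u (rescale c u x) \<omega>} \<in> events" if g: "good c u" for u x
    unfolding S_eq[OF g] by (rule beta_hit; use goodD[OF g] l in simp)+
  have "((\<lambda>u. prob (win c u) * norming c u) \<longlongrightarrow> limit_density * (\<integral>x. Wv.ever_hit ?l x * exp (\<Sum>k<n. x k) \<partial>leb n)) at_top"
  proof (rule laplace_limit)
    fix u assume g: "good c u"
    show "emeasure M (win c u) = (\<integral>\<^sup>+z. \<integral>\<^sup>+\<omega>. kernel (slope c u) (1 / u) z \<omega> * (if ?S u z \<omega> then 1 else 0) \<partial>M \<partial>leb n)"
      "(\<lambda>z. \<integral>\<^sup>+\<omega>. kernel (slope c u) (1 / u) z \<omega> * (if ?S u z \<omega> then 1 else 0) \<partial>M) \<in> borel_measurable (leb n)"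
      by (rule window_identity[OF goodD(2,3)[OF g] slope_\<mu>])+
  next
    fix u x assume g: "good c u"
    show "{\<omega> \<in> space M. ?S u (rescale c u x) \<omega>} \<in> events" by (rule hit(2)[OF g])
    show "prob {\<omega> \<in> space M. ?S u (rescale c u x) \<omega>} \<le> exp (- 2 * (\<Sum>k<n. max 0 (x k)))"
      unfolding hit(1)[OF g] by (rule Wv.hit_bound) (use goodD[OF g] l in simp)
  next
    fix x
    have "filterlim (\<lambda>u. (net_slope c u)\<^sup>2 * (1 / u) / ?l\<^sup>2) at_top at_top"
      unfolding net_slope_def slope_def by (rule real_limits(1)[OF \<mu>_pos l])
    then have "((\<lambda>u. Wv.hit ?l ((net_slope c u)\<^sup>2 * (1 / u) / ?l\<^sup>2) x) \<longlongrightarrow> Wv.ever_hit ?l x) at_top"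
      by (rule Wv.ever_hit_limit)
    then show "((\<lambda>u. prob {\<omega> \<in> space M. ?S u (rescale c u x) \<omega>}) \<longlongrightarrow> Wv.ever_hit ?l x) at_top"
      by (rule Lim_transform_eventually) (rule eventually_mono[OF eventually_good[of c]], rule hit(1)[symmetric])
  qed (rule Wv.ever_hit_measurable)
  then show ?thesis by (simp only: H_const_def Wv.ever_hit_def)
qed

lemma end_limit: "((\<lambda>u. prob (end_event c u) * norming c u) \<longlongrightarrow> limit_density) at_top"
proof -
  let ?S = "\<lambda>u z \<omega>. \<forall>k<n. z k < (0::real)"
  have resc: "(\<forall>k<n. rescale c u x k < 0) \<longleftrightarrow> (\<forall>k<n. x k < 0)" if g: "good c u" for u x
    using goodD(4)[OF g] by (auto simp: rescale_def divide_less_0_iff)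
  have pr: "prob {\<omega> \<in> space M. ?S u (rescale c u x) \<omega>} = (if \<forall>k<n. x k < 0 then 1 else 0)" if g: "good c u" for u x
  proof -
    have "{\<omega> \<in> space M. ?S u (rescale c u x) \<omega>} = (if \<forall>k<n. x k < 0 then space M else {})"
      unfolding resc[OF g] by (cases "\<forall>k<n. x k < 0") (simp_all only: if_True if_False, auto)
    then show ?thesis by (simp add: prob_space)
  qed
  have orth: "Measurable.pred (leb n) (\<lambda>z. \<forall>k<n. z k < 0)"
  proof -
    have "{z \<in> space (leb n). \<forall>k\<in>{..<n}. z k < 0} \<in> sets (leb n)"
    proof (intro sets.sets_Collect_finite_All borel_measurable_less borel_measurable_const)
      fix k assume "k \<in> {..<n}"
      then show "(\<lambda>z. z k) \<in> borel_measurable (leb n)"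
        using measurable_component_singleton[of k "{..<n}" "\<lambda>_. lborel :: real measure"] by simp
    qed simp
    then show ?thesis by (simp only: pred_def Ball_def lessThan_iff)
  qed
  have "((\<lambda>u. prob (end_event c u) * norming c u) \<longlongrightarrow> limit_density * (\<integral>x. (if \<forall>k<n. x k < 0 then 1 else 0) * exp (\<Sum>k<n. x k) \<partial>leb n)) at_top"
  proof (rule laplace_limit)
    fix u assume g: "good c u"
    show "emeasure M (end_event c u) = (\<integral>\<^sup>+z. \<integral>\<^sup>+\<omega>. kernel (slope c u) (1 / u) z \<omega> * (if ?S u z \<omega> then 1 else 0) \<partial>M \<partial>leb n)"
      by (rule endpoint_identity[OF goodD(2,3)[OF g] slope_\<mu>])
    have k: "(\<lambda>(z, \<omega>). kernel (slope c u) (1 / u) z \<omega>) \<in> borel_measurable (leb n \<Otimes>\<^sub>M M)"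
      by (rule kernel_measurable) (use goodD[OF g] in auto)
    have m: "(\<lambda>z. \<integral>\<^sup>+\<omega>. kernel (slope c u) (1 / u) z \<omega> \<partial>M) \<in> borel_measurable (leb n)"
      by (rule borel_measurable_nn_integral[OF k])
    have "(\<lambda>z. if \<forall>k<n. z k < 0 then \<integral>\<^sup>+\<omega>. kernel (slope c u) (1 / u) z \<omega> \<partial>M else 0) \<in> borel_measurable (leb n)"
      by (intro measurable_If m borel_measurable_const) (use orth in \<open>simp add: pred_def\<close>)
    moreover have "(if \<forall>k<n. z k < 0 then \<integral>\<^sup>+\<omega>. kernel (slope c u) (1 / u) z \<omega> \<partial>M else 0)
      = (\<integral>\<^sup>+\<omega>. kernel (slope c u) (1 / u) z \<omega> * (if \<forall>k<n. z k < 0 then 1 else 0) \<partial>M)" for z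
    proof (cases "\<forall>k<n. z k < 0")
      case True
      show ?thesis unfolding if_P[OF True] by simp
    next
      case False
      show ?thesis unfolding if_not_P[OF False] by simp
    qed
    ultimately show "(\<lambda>z. \<integral>\<^sup>+\<omega>. kernel (slope c u) (1 / u) z \<omega> * (if ?S u z \<omega> then 1 else 0) \<partial>M) \<in> borel_measurable (leb n)"
      by (simp only:)
  next
    fix u x assume g: "good c u"
    show "{\<omega> \<in> space M. ?S u (rescale c u x) \<omega>} \<in> events" by (cases "\<forall>k<n. rescale c u x k < 0") simp_all
    show "prob {\<omega> \<in> space M. ?S u (rescale c u x) \<omega>} \<le> exp (- 2 * (\<Sum>k<n. max 0 (x k)))"
    proof (cases "\<forall>k<n. x k < 0")
      case True
      then have "(\<Sum>k<n. max 0 (x k)) = 0" by (intro sum.neutral) (auto intro: max_absorb1 less_imp_le)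
      then show ?thesis unfolding pr[OF g] by simp
    next
      case False
      then show ?thesis unfolding pr[OF g] if_not_P[OF False] by simp
    qed
  next
    fix x
    show "((\<lambda>u. prob {\<omega> \<in> space M. ?S u (rescale c u x) \<omega>}) \<longlongrightarrow> (if \<forall>k<n. x k < 0 then 1 else 0)) at_top"
      by (rule tendsto_eventually, rule eventually_mono[OF eventually_good[of c]], rule pr)
  next
    show "(\<lambda>x. if \<forall>k<n. x k < 0 then 1 else 0) \<in> borel_measurable (leb n)"
      using orth by measurable
  qed
  then show ?thesis unfolding integral_exp_orthant by simp
qed

text \<open>For negative \<open>x\<close> the exceedance is certain, at small times. So the constant dominates the integral
  of the exponential over the negative orthant.\<close>
lemma H_ge_1: "H_const M' W n (1 / \<mu>) \<ge> 1"
proof -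
  let ?l = "1 / \<mu>"
  note [measurable_cong] = sets_leb[of n]
  have em: "Wv.ever_hit ?l \<in> borel_measurable (leb n)" by (rule Wv.ever_hit_measurable)
  have i1: "integrable (leb n) (\<lambda>x. Wv.ever_hit ?l x * exp (\<Sum>k<n. x k))"
  proof (rule Bochner_Integration.integrable_bound[OF exp_abs_integrable])
    show "(\<lambda>x. Wv.ever_hit ?l x * exp (\<Sum>k<n. x k)) \<in> borel_measurable (leb n)" using em by measurable
    show "AE x in leb n. norm (Wv.ever_hit ?l x * exp (\<Sum>k<n. x k)) \<le> norm (\<Prod>k<n. exp (- \<bar>x k\<bar> / 2))"
    proof (rule AE_I2)
      fix x
      have "Wv.ever_hit ?l x * exp (\<Sum>k<n. x k) \<le> exp (- 2 * (\<Sum>k<n. max 0 (x k))) * exp (\<Sum>k<n. x k)"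
        by (intro mult_right_mono Wv.ever_hit_bound) simp
      also have "\<dots> = exp (\<Sum>k<n. x k - 2 * max 0 (x k))"
      proof -
        have "(\<Sum>k<n. x k - 2 * max 0 (x k)) = (\<Sum>k<n. x k) + - 2 * (\<Sum>k<n. max 0 (x k))"
          by (simp add: sum_subtractf sum_distrib_left[symmetric])
        then show ?thesis by (simp only: exp_add ac_simps)
      qed
      also have "\<dots> \<le> exp (\<Sum>k<n. - \<bar>x k\<bar> / 2)"
        by (intro iffD2[OF exp_le_cancel_iff] sum_mono) (auto simp: max_def)
      also have "\<dots> = (\<Prod>k<n. exp (- \<bar>x k\<bar> / 2))" by (rule exp_sum) simp
      finally show "norm (Wv.ever_hit ?l x * exp (\<Sum>k<n. x k)) \<le> norm (\<Prod>k<n. exp (- \<bar>x k\<bar> / 2))"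
        using Wv.ever_hit_nonneg[of ?l x] by (simp add: prod_nonneg abs_mult)
    qed
  qed
  have i0: "integrable (leb n) (\<lambda>x. (if \<forall>k<n. x k < 0 then 1 else 0) * exp (\<Sum>k<n. x k))"
    using integral_exp_orthant[of n] not_integrable_integral_eq by fastforce
  have "(\<integral>x. (if \<forall>k<n. x k < 0 then 1 else 0) * exp (\<Sum>k<n. x k) \<partial>leb n) \<le> (\<integral>x. Wv.ever_hit ?l x * exp (\<Sum>k<n. x k) \<partial>leb n)"
    by (intro Bochner_Integration.integral_mono i0 i1 mult_right_mono)
       (use Wv.ever_hit_neg Wv.ever_hit_nonneg in auto)
  then show ?thesis unfolding integral_exp_orthant by (simp only: H_const_def Wv.ever_hit_def)
qed

section \<open>The times before the window\<close>

definition seg_end :: "nat \<Rightarrow> real" where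
  "seg_end i = (if i < \<eta> then \<tau> (Suc i) else T)"

lemma seg_end_gt: "i \<le> \<eta> \<Longrightarrow> \<tau> i < seg_end i"
  using \<tau>_less[of i] \<tau>T by (auto simp: seg_end_def)

lemma \<tau>_le: "j \<le> k \<Longrightarrow> k \<le> \<eta> \<Longrightarrow> \<tau> j \<le> \<tau> k"
  using \<tau>_mono by (cases "j = k") (auto simp: strict_mono_on_def intro: less_imp_le)

lemma seg_end_le: "seg_end i \<le> T"
  using \<tau>_le[of "Suc i" \<eta>] \<tau>T by (auto simp: seg_end_def)

text \<open>The number of branches that pass through a given coordinate of segment \<open>i\<close>.\<close>
definition offspring :: "nat \<Rightarrow> nat" where
  "offspring i = (\<Prod>j=Suc i..\<eta>. N j)"

lemma offspring_rec: "i < \<eta> \<Longrightarrow> offspring i = N (Suc i) * offspring (Suc i)"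
  unfolding offspring_def by (subst prod.atLeast_Suc_atMost) auto

lemma offspring_\<eta>[simp]: "offspring \<eta> = 1" by (simp add: offspring_def)

lemma offspring_pos: "offspring i \<ge> 1"
proof -
  have "N j > 0" if "j \<in> {Suc i..\<eta>}" for j using N[of j] that by auto
  then have "offspring i > 0" unfolding offspring_def by (intro prod_pos) auto
  then show ?thesis by simp
qed

lemma P_offspring: "i \<le> \<eta> \<Longrightarrow> P i * offspring i = n"
proof (induction rule: inc_induct)
  case (step i)
  then show ?case by (simp add: offspring_prod_Suc offspring_rec ac_simps)
qed simp

lemma P_le_n: "i \<le> \<eta> \<Longrightarrow> P i \<le> n"
  using P_offspring[of i] offspring_pos[of i] by (metis mult.right_neutral mult_le_mono2)

text \<open>The left side is \<open>1/n\<close> times the variance of the sum of all branches at time \<open>t\<close> of segment \<open>i\<close>. It equals \<open>\<mu>\<close> at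
  time \<open>T\<close> and grows at a rate that is the number of branches sharing a motion, which is at least 1.\<close>
lemma sum_var_bound:
  "i \<le> \<eta> \<Longrightarrow> \<tau> i + t \<le> seg_end i \<Longrightarrow> real (offspring i) * (xvar i + t) \<le> \<mu> - (T - \<tau> i - t)"
proof (induction arbitrary: t rule: inc_induct)
  case (step i)
  let ?l = "\<tau> (Suc i) - \<tau> i"
  have t: "t \<le> ?l" using step by (simp add: seg_end_def)
  define A where "A = real (offspring i) * (xvar i + t)"
  define C where "C = real (offspring i) * (?l - t)"
  define D where "D = real (offspring (Suc i)) * (xvar (Suc i) + 0)"
  have "1 * (?l - t) \<le> C"
    unfolding C_def using t offspring_pos[of i] by (intro mult_right_mono) auto
  moreover have "D \<le> \<mu> - (T - \<tau> (Suc i) - 0)"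
    unfolding D_def using step seg_end_gt[of "Suc i"] by (intro step.IH) auto
  moreover have "A = D - C"
    unfolding A_def C_def D_def using step by (simp add: offspring_rec algebra_simps)
  ultimately have "A \<le> \<mu> - (T - \<tau> i - t)" by simp
  then show ?case unfolding A_def .
qed simp

definition out_event :: "real \<Rightarrow> real \<Rightarrow> nat \<Rightarrow> 'a set" where
  "out_event c u i = {\<omega> \<in> space M. \<exists>t\<in>{0..min (seg_end i) (T - 1 / u) - \<tau> i}. \<forall>k<P i. 0 < Z i t \<omega> k - (u + c * (\<tau> i + t))}"

lemma seg_cut: "good c u \<Longrightarrow> i \<le> \<eta> \<Longrightarrow> 0 < min (seg_end i) (T - 1 / u) - \<tau> i"
proof -
  assume g: "good c u" and i: "i \<le> \<eta>"
  have "\<tau> i \<le> \<tau> \<eta>" using \<tau>_le i by simp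
  then show ?thesis using goodD(3)[OF g] seg_end_gt[OF i] by auto
qed

lemma out_event_events:
  assumes g: "good c u" and i: "i \<le> \<eta>"
  shows "out_event c u i \<in> events"
  unfolding out_event_def
proof (rule dyadic_event(4)[OF seg_cut[OF g i]])
  show "continuous_on {0..min (seg_end i) (T - 1 / u) - \<tau> i} (\<lambda>t. Z i t \<omega> k - (u + c * (\<tau> i + t)))" if "k < P i" "\<omega> \<in> space M" for k \<omega>
    using that by (intro continuous_intros continuous_on_subset[OF Z_continuous[OF i]]) auto
  show "(\<lambda>\<omega>. Z i t \<omega> k - (u + c * (\<tau> i + t))) \<in> borel_measurable M" if "k < P i" "t \<in> {0..min (seg_end i) (T - 1 / u) - \<tau> i}" for k t
    using that by (intro borel_measurable_diff borel_measurable_const Z_measurable[OF i]) auto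
qed

text \<open>On this event the sum over the segment is large. The exponent \<open>\<theta>\<close> is \<open>b\<close> times the number of branches through
  each coordinate, that is, the exponent \<open>b\<close> for the sum of all \<open>n\<close> branches. In terms of the remaining time
  \<open>s \<ge> 1 / u\<close> the level that has to be exceeded is \<open>n (b\<^sup>2 \<mu>/2 + s (b\<^sup>2/2 - c b))\<close>.\<close>
lemma out_event_bound:
  assumes g: "good c u" and i: "i \<le> \<eta>" and b: "slope c u > 0" "slope c u \<ge> 2 * c"
  defines "b \<equiv> slope c u"
  shows "prob (out_event c u i) \<le> exp (- (real n * (b\<^sup>2 * \<mu> / 2 + 1 / u * (b\<^sup>2 / 2 - c * b))))" (is "_ \<le> exp (- ?y)")
proof -
  let ?l = "min (seg_end i) (T - 1 / u) - \<tau> i"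
  let ?p = "real (offspring i)"
  let ?\<theta> = "?p * b"
  let ?V = "{\<omega> \<in> space M. \<exists>t\<in>{0..?l}. ?y < tilted_sum i ?\<theta> t \<omega>}"
  have pn: "?p * real (P i) = real n" using P_offspring[OF i] by (metis mult.commute of_nat_mult)
  have \<theta>: "?\<theta> > 0" using b offspring_pos[of i] by (simp add: b_def)
  have "out_event c u i \<subseteq> ?V"
  proof
    fix \<omega> assume "\<omega> \<in> out_event c u i"
    then obtain t where \<omega>: "\<omega> \<in> space M" and t: "t \<in> {0..?l}" and *: "\<And>k. k < P i \<Longrightarrow> u + c * (\<tau> i + t) < Z i t \<omega> k"
      unfolding out_event_def by auto
    define s where "s = T - \<tau> i - t"
    have s: "s \<ge> 1 / u" using t by (auto simp: s_def)
    have a: "u + c * (\<tau> i + t) = b * \<mu> - c * s"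
      unfolding b_def slope_\<mu> s_def by (simp add: algebra_simps)
    have "(\<Sum>k<P i. b * \<mu> - c * s) < (\<Sum>k<P i. Z i t \<omega> k)"
      using * P_pos[OF i] unfolding a by (intro sum_strict_mono) auto
    then have "?\<theta> * (real (P i) * (b * \<mu> - c * s)) < ?\<theta> * (\<Sum>k<P i. Z i t \<omega> k)"
      by (intro mult_strict_left_mono \<theta>) simp
    moreover have "?\<theta> * (real (P i) * (b * \<mu> - c * s)) = real n * (b * (b * \<mu> - c * s))"
      unfolding pn[symmetric] by simp
    moreover have "?\<theta>\<^sup>2 * real (P i) * (xvar i + t) / 2 \<le> real n * (b\<^sup>2 * (\<mu> - s) / 2)"
    proof -
      have "?p * (xvar i + t) \<le> \<mu> - s"
        unfolding s_def by (rule sum_var_bound[OF i]) (use t in auto)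
      then have "real n * b\<^sup>2 / 2 * (?p * (xvar i + t)) \<le> real n * b\<^sup>2 / 2 * (\<mu> - s)"
        by (intro mult_left_mono) auto
      then show ?thesis unfolding pn[symmetric] by (simp add: power2_eq_square ac_simps)
    qed
    moreover have "real n * (b * (b * \<mu> - c * s)) - real n * (b\<^sup>2 * (\<mu> - s) / 2) \<ge> ?y"
    proof -
      have "b\<^sup>2 / 2 - c * b = b / 2 * (b - 2 * c)" by (simp add: power2_eq_square algebra_simps)
      also have "\<dots> \<ge> 0" using b unfolding b_def by (intro mult_nonneg_nonneg) auto
      finally have "1 / u * (b\<^sup>2 / 2 - c * b) \<le> s * (b\<^sup>2 / 2 - c * b)"
        using s by (intro mult_right_mono)
      then have "?y \<le> real n * (b\<^sup>2 * \<mu> / 2 + s * (b\<^sup>2 / 2 - c * b))"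
        by (intro mult_left_mono add_left_mono) auto
      also have "\<dots> = real n * (b * (b * \<mu> - c * s)) - real n * (b\<^sup>2 * (\<mu> - s) / 2)"
        by (simp add: power2_eq_square field_simps)
      finally show ?thesis .
    qed
    ultimately have "?y < tilted_sum i ?\<theta> t \<omega>" by linarith
    then show "\<omega> \<in> ?V" using \<omega> t by blast
  qed
  then have "prob (out_event c u i) \<le> prob ?V"
    by (rule finite_measure_mono) (rule segment_event[OF i seg_cut[OF g i]])
  also have "\<dots> \<le> exp (- ?y)" by (rule segment_maximal[OF i seg_cut[OF g i]])
  finally show ?thesis .
qed

lemma out_event_limit:
  assumes i: "i \<le> \<eta>"
  shows "((\<lambda>u. prob (out_event c u i) * norming c u) \<longlongrightarrow> 0) at_top"
proof (rule tendsto_sandwich[OF _ _ tendsto_const])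
  let ?g = "\<lambda>u. net_slope c u ^ n * exp (- (real n * (1 / u * ((slope c u)\<^sup>2 / 2 - c * slope c u))))"
  have n: "real n > 0" using P_pos[of \<eta>] by simp
  show "(?g \<longlongrightarrow> 0) at_top"
    unfolding net_slope_def slope_def by (rule real_limits(2)[OF \<mu>_pos zero_less_one n])
  have bl: "\<forall>\<^sub>F u in at_top. slope c u > max 0 (2 * c)"
    using slope_at_top[of c] unfolding filterlim_at_top_dense by blast
  show "\<forall>\<^sub>F u in at_top. 0 \<le> prob (out_event c u i) * norming c u"
    by (rule eventually_mono[OF eventually_good[of c]]) (auto dest: goodD(4))
  show "\<forall>\<^sub>F u in at_top. prob (out_event c u i) * norming c u \<le> ?g u"
    using bl eventually_good[of c]
  proof eventually_elim
    case (elim u)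
    let ?b = "slope c u"
    have "prob (out_event c u i) * norming c u \<le> exp (- (real n * (?b\<^sup>2 * \<mu> / 2 + 1 / u * (?b\<^sup>2 / 2 - c * ?b)))) * norming c u"
      by (intro mult_right_mono out_event_bound i) (use elim goodD(4)[of c u] in auto)
    also have "\<dots> = ?g u"
    proof -
      have "- (real n * (?b\<^sup>2 * \<mu> / 2 + 1 / u * (?b\<^sup>2 / 2 - c * ?b))) + real n * ?b\<^sup>2 * \<mu> / 2 = - (real n * (1 / u * (?b\<^sup>2 / 2 - c * ?b)))"
        by (simp add: algebra_simps)
      from arg_cong[where f=exp, OF this] show ?thesis unfolding exp_add by (simp only: ac_simps)
    qed
    finally show ?case .
  qed
qed

section \<open>The asymptotics of the tree\<close>

lemma tree_level_bounds:
  assumes t: "0 \<le> t" "t \<le> T"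
  defines "i \<equiv> tree_level \<eta> \<tau> t"
  shows "i \<le> \<eta>" "\<tau> i \<le> t" "t \<le> seg_end i" "i > 0 \<Longrightarrow> \<tau> i < t"
proof -
  have "i \<le> \<eta> \<and> \<tau> i \<le> t \<and> t \<le> seg_end i \<and> (i > 0 \<longrightarrow> \<tau> i < t)"
  proof (cases "\<tau> 1 < t")
    case False
    then have i: "i = 0" by (simp add: i_def tree_level_def)
    have "t \<le> seg_end 0" using False \<eta> t by (auto simp: seg_end_def)
    then show ?thesis unfolding i using t \<tau>0 by simp
  next
    case True
    let ?A = "{i \<in> {1..\<eta>}. \<tau> i < t}"
    have i: "i = Max ?A" using True by (simp add: i_def tree_level_def)
    have "1 \<in> ?A" using True \<eta> by simp
    then have "i \<in> ?A" unfolding i by (intro Max_in) auto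
    moreover have "t \<le> seg_end i"
    proof (cases "i < \<eta>")
      case True
      have "\<not> \<tau> (Suc i) < t"
      proof
        assume "\<tau> (Suc i) < t"
        then have "Suc i \<in> ?A" using True by simp
        then have "Suc i \<le> i" unfolding i by (intro Max_ge) auto
        then show False by simp
      qed
      then show ?thesis using True by (simp add: seg_end_def)
    qed (use t in \<open>simp add: seg_end_def\<close>)
    ultimately show ?thesis by auto
  qed
  then show "i \<le> \<eta>" "\<tau> i \<le> t" "t \<le> seg_end i" "i > 0 \<Longrightarrow> \<tau> i < t" by auto
qed

lemma tree_level_eq:
  assumes i: "i \<le> \<eta>" and t: "\<tau> i < t" "t \<le> seg_end i"
  shows "tree_level \<eta> \<tau> t = i"
proof (cases "i = 0")
  case True
  then show ?thesis using t \<eta> by (auto simp: tree_level_def seg_end_def)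
next
  case False
  note mono = \<tau>_le
  have "\<tau> 1 < t" using mono[of 1 i] False i t by simp
  moreover have "Max {i \<in> {1..\<eta>}. \<tau> i < t} = i"
  proof (rule Max_eqI)
    fix j assume j: "j \<in> {i \<in> {1..\<eta>}. \<tau> i < t}"
    show "j \<le> i"
    proof (rule ccontr)
      assume "\<not> j \<le> i"
      then have "Suc i \<le> j" "i < \<eta>" using j by auto
      then have "t \<le> \<tau> j" using mono[of "Suc i" j] j t by (auto simp: seg_end_def)
      then show False using j by simp
    qed
  qed (use False i t in auto)
  ultimately show ?thesis by (simp add: tree_level_def)
qed

lemma tree_level_0: "tree_level \<eta> \<tau> 0 = 0"
  using \<tau>_less[of 0] \<eta> \<tau>0 by (simp add: tree_level_def)

text \<open>Almost surely the motions start at 0, and then the branches of the tree are those formed from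
  \<^const>\<open>from_zero\<close>.\<close>
lemma AE_start: "AE \<omega> in M. \<forall>i\<le>\<eta>. \<forall>k<P i. B i k 0 \<omega> = 0"
proof -
  have "AE \<omega> in M. \<forall>p\<in>I. B (fst p) (snd p) 0 \<omega> = 0"
    using bm by (intro AE_finite_allI) (auto simp: standard_brownian_motion_def)
  then show ?thesis by eventually_elim force
qed

lemma incoming_start:
  assumes s: "\<forall>i\<le>\<eta>. \<forall>k<P i. B i k 0 \<omega> = 0"
  shows "i \<le> \<eta> \<Longrightarrow> k < P i \<Longrightarrow> incoming N \<tau> B i \<omega> k = X i \<omega> k"
proof (induction i arbitrary: k)
  case (Suc i)
  have "k mod P i < P i" using P_pos[of i] Suc by simp
  then show ?case using Suc s by (simp add: from_zero_def)
qed simp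

lemma tree_vec_start:
  assumes s: "\<forall>i\<le>\<eta>. \<forall>k<P i. B i k 0 \<omega> = 0" and i: "i \<le> \<eta>" and k: "k < P i"
  shows "tree_vec N \<tau> B i t \<omega> k = Z i (t - \<tau> i) \<omega> k"
  using incoming_start[OF s i k] s i k by (simp add: tree_vec_incoming[where \<tau>=\<tau>, OF \<tau>0] Z_def from_zero_def)

text \<open>A condition on all branches is one on all coordinates of the segment.\<close>
lemma all_mod: "i \<le> \<eta> \<Longrightarrow> (\<forall>\<gamma><n. Q (\<gamma> mod P i)) \<longleftrightarrow> (\<forall>k<P i. Q k)"
proof
  assume i: "i \<le> \<eta>" and a: "\<forall>\<gamma><n. Q (\<gamma> mod P i)"
  show "\<forall>k<P i. Q k"
  proof (intro allI impI)
    fix k assume "k < P i"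
    then show "Q k" using a[rule_format, of k] P_le_n[OF i] by simp
  qed
next
  assume i: "i \<le> \<eta>" and a: "\<forall>k<P i. Q k"
  then show "\<forall>\<gamma><n. Q (\<gamma> mod P i)" using P_pos[OF i] by simp
qed

abbreviation "tree_event c u \<equiv> {\<omega> \<in> space M. \<exists>t\<in>{0..T}. \<forall>\<gamma><n. tree_branch \<eta> N \<tau> B \<gamma> t \<omega> - c * t > u}"

lemma tree_vec_measurable:
  assumes i: "i \<le> \<eta>" and k: "k < P i" and t: "t \<ge> \<tau> i"
  shows "(\<lambda>\<omega>. tree_vec N \<tau> B i t \<omega> k) \<in> borel_measurable M"
proof -
  have "i \<le> \<eta> \<Longrightarrow> k < P i \<Longrightarrow> (\<lambda>\<omega>. incoming N \<tau> B i \<omega> k) \<in> borel_measurable M" for i k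
  proof (induction i arbitrary: k)
    case (Suc i)
    then have "P i > 0" using P_pos by simp
    then show ?case using Suc \<tau>_less[of i] by (auto intro!: borel_measurable_add B_measurable)
  qed simp
  then show ?thesis unfolding tree_vec_incoming[where \<tau>=\<tau>, OF \<tau>0] using i k t by (intro borel_measurable_add B_measurable) auto
qed

lemma tree_vec_continuous:
  assumes i: "i \<le> \<eta>" and k: "k < P i" and \<omega>: "\<omega> \<in> space M"
  shows "continuous_on {\<tau> i..} (\<lambda>t. tree_vec N \<tau> B i t \<omega> k)"
proof -
  have "continuous_on {0..} (\<lambda>t. B i k t \<omega>)" using bm[OF i k] \<omega> by (auto simp: standard_brownian_motion_def)
  then have "continuous_on {\<tau> i..} (\<lambda>t. B i k (t - \<tau> i) \<omega>)"
    by (rule continuous_on_compose2) (auto intro!: continuous_intros)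
  then show ?thesis unfolding tree_vec_incoming[where \<tau>=\<tau>, OF \<tau>0] by (intro continuous_intros)
qed

text \<open>The comparison with the window is only almost sure and the space need not be complete, so the measurability of
  the event has to be shown for the branches as they are given.\<close>
lemma tree_event_events: "tree_event c u \<in> events"
proof -
  let ?f = "\<lambda>i k t \<omega>. tree_vec N \<tau> B i t \<omega> k - (c * t + u)"
  let ?Q = "\<lambda>i. {\<omega> \<in> space M. \<exists>t\<in>{\<tau> i<..seg_end i}. \<forall>k<P i. 0 < ?f i k t \<omega>}"
  let ?At = "{\<omega> \<in> space M. \<forall>k<P 0. 0 < ?f 0 k 0 \<omega>}"
  have br: "(\<forall>\<gamma><n. tree_branch \<eta> N \<tau> B \<gamma> t \<omega> - c * t > u) \<longleftrightarrow> (\<forall>k<P i. 0 < ?f i k t \<omega>)"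
    if "tree_level \<eta> \<tau> t = i" "i \<le> \<eta>" for t i \<omega>
  proof -
    have "(\<forall>\<gamma><n. tree_branch \<eta> N \<tau> B \<gamma> t \<omega> - c * t > u) \<longleftrightarrow> (\<forall>\<gamma><n. 0 < ?f i (\<gamma> mod P i) t \<omega>)"
      using that by (simp add: tree_branch_def Let_def algebra_simps)
    also have "\<dots> \<longleftrightarrow> (\<forall>k<P i. 0 < ?f i k t \<omega>)" by (rule all_mod[OF that(2)])
    finally show ?thesis .
  qed
  have "tree_event c u = ?At \<union> (\<Union>i\<in>{0..\<eta>}. ?Q i)"
  proof (intro subset_antisym subsetI)
    fix \<omega> assume "\<omega> \<in> tree_event c u"
    then obtain t where \<omega>: "\<omega> \<in> space M" and t: "t \<in> {0..T}" and *: "\<forall>\<gamma><n. tree_branch \<eta> N \<tau> B \<gamma> t \<omega> - c * t > u" by blast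
    define i where "i = tree_level \<eta> \<tau> t"
    have b: "i \<le> \<eta>" "\<tau> i \<le> t" "t \<le> seg_end i" "i > 0 \<Longrightarrow> \<tau> i < t"
      unfolding i_def by (rule tree_level_bounds; use t in auto)+
    have f: "\<forall>k<P i. 0 < ?f i k t \<omega>" using * br[OF i_def[symmetric] b(1)] by blast
    show "\<omega> \<in> ?At \<union> (\<Union>i\<in>{0..\<eta>}. ?Q i)"
    proof (cases "\<tau> i < t")
      case True
      then have "t \<in> {\<tau> i<..seg_end i}" using b by simp
      then have "\<omega> \<in> ?Q i" using \<omega> f by blast
      moreover have "i \<in> {0..\<eta>}" using b(1) by simp
      ultimately show ?thesis by blast
    next
      case False
      then have "i = 0" "t = 0" using b \<tau>0 by (auto intro: antisym)
      then show ?thesis using \<omega> f by auto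
    qed
  next
    fix \<omega> assume "\<omega> \<in> ?At \<union> (\<Union>i\<in>{0..\<eta>}. ?Q i)"
    then show "\<omega> \<in> tree_event c u"
    proof
      assume Q0: "\<omega> \<in> ?At"
      have "\<forall>\<gamma><n. tree_branch \<eta> N \<tau> B \<gamma> 0 \<omega> - c * 0 > u"
        using br[OF tree_level_0, of \<omega>] Q0 by blast
      moreover have "0 \<in> {0..T}" using \<tau>_le[of 0 \<eta>] \<tau>0 \<tau>T by simp
      ultimately show ?thesis using Q0 by blast
    next
      assume "\<omega> \<in> (\<Union>i\<in>{0..\<eta>}. ?Q i)"
      then obtain i t where i: "i \<le> \<eta>" and \<omega>: "\<omega> \<in> space M" and t: "\<tau> i < t" "t \<le> seg_end i" and f: "\<forall>k<P i. 0 < ?f i k t \<omega>" by auto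
      have lev: "tree_level \<eta> \<tau> t = i" by (rule tree_level_eq[OF i t])
      have "0 \<le> \<tau> i" using \<tau>_le[of 0 i] i \<tau>0 by simp
      then have "t \<in> {0..T}" using t seg_end_le[of i] by auto
      then show ?thesis using \<omega> br[OF lev i] f by blast
    qed
  qed
  also have "\<dots> \<in> events"
  proof (intro sets.Un sets.finite_UN half_open_event seg_end_gt)
    have "{\<omega> \<in> space M. \<forall>k\<in>{..<P 0}. 0 < ?f 0 k 0 \<omega>} \<in> events"
      by (intro sets.sets_Collect_finite_All borel_measurable_less borel_measurable_const borel_measurable_diff tree_vec_measurable)
         (use \<tau>0 in auto)
    then show "?At \<in> events" by (simp only: Ball_def lessThan_iff)
    fix i assume "i \<in> {0..\<eta>}"
    then show i: "i \<le> \<eta>" by simp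
    show "continuous_on {\<tau> i..seg_end i} (\<lambda>t. ?f i k t \<omega>)" if "k < P i" "\<omega> \<in> space M" for k \<omega>
      by (intro continuous_intros continuous_on_subset[OF tree_vec_continuous[OF i that]]) auto
    show "?f i k t \<in> borel_measurable M" if "k < P i" "t \<in> {\<tau> i..seg_end i}" for k t
      by (intro borel_measurable_diff borel_measurable_const tree_vec_measurable[OF i that(1)]) (use that in auto)
  qed simp
  finally show ?thesis .
qed

lemma win_events:
  assumes g: "good c u"
  shows "win c u \<in> events"
proof -
  have "{\<omega> \<in> space M. \<exists>s\<in>{0..1 / u}. \<forall>k<n. 0 < Z \<eta> (L - s) \<omega> k - (u + c * T - c * s)} \<in> events"
  proof (rule dyadic_event(4)[OF goodD(2)[OF g]])
    show "continuous_on {0..1 / u} (\<lambda>s. Z \<eta> (L - s) \<omega> k - (u + c * T - c * s))" if "k < n" "\<omega> \<in> space M" for k \<omega>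
      by (intro continuous_intros continuous_on_compose2[OF Z_continuous[OF order_refl that]])
         (use goodD[OF g] in \<open>auto intro!: continuous_intros\<close>)
    show "(\<lambda>\<omega>. Z \<eta> (L - s) \<omega> k - (u + c * T - c * s)) \<in> borel_measurable M" if "k < n" "s \<in> {0..1 / u}" for k s
      by (intro borel_measurable_diff borel_measurable_const Z_measurable[OF order_refl that(1)]) (use that goodD[OF g] in auto)
  qed
  then show ?thesis by simp
qed

text \<open>The window lies inside the last segment, so no branching time has to be considered.\<close>
lemma tree_event_lower:
  assumes g: "good c u"
  shows "prob (win c u) \<le> prob (tree_event c u)"
proof (rule finite_measure_mono_AE[OF _ tree_event_events])
  show "AE \<omega> in M. \<omega> \<in> win c u \<longrightarrow> \<omega> \<in> tree_event c u"
    using AE_start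
  proof eventually_elim
    case (elim \<omega>)
    show ?case
    proof
      assume "\<omega> \<in> win c u"
      then obtain s where \<omega>: "\<omega> \<in> space M" and s: "s \<in> {0..1 / u}" and *: "\<forall>k<n. u + c * T - c * s < Z \<eta> (L - s) \<omega> k" by blast
      have lt: "\<tau> \<eta> < T - s" using s goodD[OF g] by auto
      have lev: "tree_level \<eta> \<tau> (T - s) = \<eta>"
        by (rule tree_level_eq[OF order_refl lt]) (use s in \<open>simp add: seg_end_def\<close>)
      have "\<tau> 0 \<le> \<tau> \<eta>" by (rule \<tau>_le) auto
      then have t: "T - s \<in> {0..T}" using s lt \<tau>0 by auto
      have "tree_branch \<eta> N \<tau> B \<gamma> (T - s) \<omega> - c * (T - s) > u" if "\<gamma> < n" for \<gamma>
      proof -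
        have "tree_branch \<eta> N \<tau> B \<gamma> (T - s) \<omega> = Z \<eta> (T - s - \<tau> \<eta>) \<omega> \<gamma>"
          using tree_vec_start[OF elim order_refl that] that by (simp add: tree_branch_def Let_def lev)
        also have "T - s - \<tau> \<eta> = L - s" by simp
        finally show ?thesis using *[rule_format, OF that] by (simp add: algebra_simps)
      qed
      then show "\<omega> \<in> tree_event c u" using \<omega> t by blast
    qed
  qed
qed

lemma tree_event_upper:
  assumes g: "good c u"
  shows "prob (tree_event c u) \<le> prob (win c u) + (\<Sum>i\<in>{0..\<eta>}. prob (out_event c u i))"
proof -
  have out: "(\<Union>i\<in>{0..\<eta>}. out_event c u i) \<in> events"
    by (intro sets.finite_UN out_event_events[OF g]) auto
  have "prob (tree_event c u) \<le> prob (win c u \<union> (\<Union>i\<in>{0..\<eta>}. out_event c u i))"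
  proof (rule finite_measure_mono_AE[OF _ sets.Un[OF win_events[OF g] out]])
    show "AE \<omega> in M. \<omega> \<in> tree_event c u \<longrightarrow> \<omega> \<in> win c u \<union> (\<Union>i\<in>{0..\<eta>}. out_event c u i)"
      using AE_start
    proof eventually_elim
      case (elim \<omega>)
      show ?case
      proof
        assume "\<omega> \<in> tree_event c u"
        then obtain t where \<omega>: "\<omega> \<in> space M" and t: "t \<in> {0..T}" and *: "\<forall>\<gamma><n. tree_branch \<eta> N \<tau> B \<gamma> t \<omega> - c * t > u" by blast
        define i where "i = tree_level \<eta> \<tau> t"
        have b: "i \<le> \<eta>" "\<tau> i \<le> t" "t \<le> seg_end i"
          unfolding i_def by (rule tree_level_bounds; use t in auto)+
        have "\<forall>\<gamma><n. (\<lambda>k. 0 < Z i (t - \<tau> i) \<omega> k - (u + c * t)) (\<gamma> mod P i)"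
          using * tree_vec_start[OF elim b(1)] P_pos[OF b(1)]
          by (auto simp: tree_branch_def Let_def i_def[symmetric] algebra_simps)
        then have Zp: "\<forall>k<P i. 0 < Z i (t - \<tau> i) \<omega> k - (u + c * t)"
          using all_mod[OF b(1), of "\<lambda>k. 0 < Z i (t - \<tau> i) \<omega> k - (u + c * t)"] by blast
        show "\<omega> \<in> win c u \<union> (\<Union>i\<in>{0..\<eta>}. out_event c u i)"
        proof (cases "t \<le> T - 1 / u")
          case True
          then have "t - \<tau> i \<in> {0..min (seg_end i) (T - 1 / u) - \<tau> i}" using b by auto
          moreover have "\<forall>k<P i. 0 < Z i (t - \<tau> i) \<omega> k - (u + c * (\<tau> i + (t - \<tau> i)))" using Zp by simp
          ultimately have "\<omega> \<in> out_event c u i" unfolding out_event_def using \<omega> by blast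
          then show ?thesis using b(1) by auto
        next
          case False
          then have "\<tau> \<eta> < t" using goodD[OF g] by auto
          then have i: "i = \<eta>" unfolding i_def by (intro tree_level_eq) (use t in \<open>auto simp: seg_end_def\<close>)
          have "T - t \<in> {0..1 / u}" using False t by auto
          moreover have "\<forall>k<n. u + c * T - c * (T - t) < Z \<eta> (L - (T - t)) \<omega> k"
            using Zp unfolding i by (simp add: algebra_simps)
          ultimately have "\<omega> \<in> win c u" using \<omega> by blast
          then show ?thesis by simp
        qed
      qed
    qed
  qed
  also have "\<dots> \<le> prob (win c u) + prob (\<Union>i\<in>{0..\<eta>}. out_event c u i)"
    by (rule measure_Un_le[OF win_events[OF g] out])
  also have "prob (\<Union>i\<in>{0..\<eta>}. out_event c u i) \<le> (\<Sum>i\<in>{0..\<eta>}. prob (out_event c u i))"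
    by (rule measure_UNION_le) (auto intro: out_event_events[OF g])
  finally show ?thesis by simp
qed

lemma tree_end_event:
  "\<P>(\<omega> in M. \<forall>\<gamma><n. tree_branch \<eta> N \<tau> B \<gamma> T \<omega> - c * T > u) = prob (end_event c u)"
proof (rule prob_eq_AE)
  have lev: "tree_level \<eta> \<tau> T = \<eta>"
    by (rule tree_level_eq) (use \<tau>T in \<open>auto simp: seg_end_def\<close>)
  show "AE \<omega> in M. (\<forall>\<gamma><n. tree_branch \<eta> N \<tau> B \<gamma> T \<omega> - c * T > u) \<longleftrightarrow> (\<forall>k<n. u + c * T < Z \<eta> L \<omega> k)"
    using AE_start
  proof eventually_elim
    case (elim \<omega>)
    have "tree_branch \<eta> N \<tau> B \<gamma> T \<omega> = Z \<eta> L \<omega> \<gamma>" if "\<gamma> < n" for \<gamma>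
      using tree_vec_start[OF elim order_refl that] that by (simp add: tree_branch_def Let_def lev)
    then show ?case by (simp add: algebra_simps)
  qed
  have "(\<lambda>\<omega>. tree_branch \<eta> N \<tau> B \<gamma> T \<omega>) \<in> borel_measurable M" if "\<gamma> < n" for \<gamma>
    using tree_vec_measurable[of \<eta> "\<gamma> mod n" T] that \<tau>T by (simp add: tree_branch_def Let_def lev)
  then have "{\<omega> \<in> space M. \<forall>\<gamma>\<in>{..<n}. u < tree_branch \<eta> N \<tau> B \<gamma> T \<omega> - c * T} \<in> events"
    by (intro sets.sets_Collect_finite_All borel_measurable_less borel_measurable_const borel_measurable_diff) auto
  then show "{\<omega> \<in> space M. \<forall>\<gamma><n. tree_branch \<eta> N \<tau> B \<gamma> T \<omega> - c * T > u} \<in> events"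
    by (simp only: Ball_def lessThan_iff)
  have "{\<omega> \<in> space M. \<forall>k\<in>{..<n}. u + c * T < Z \<eta> L \<omega> k} \<in> events"
    using L_pos by (intro sets.sets_Collect_finite_All borel_measurable_less borel_measurable_const Z_measurable) auto
  then show "end_event c u \<in> events" by (simp only: Ball_def lessThan_iff)
qed

theorem tree_asymptotics:
  "((\<lambda>u. \<P>(\<omega> in M. \<exists>t\<in>{0..T}. \<forall>\<gamma><n. tree_branch \<eta> N \<tau> B \<gamma> t \<omega> - c * t > u)
      / (H_const M' W n (1 / \<mu>\<^sub>0 \<eta> N \<tau> T) * \<P>(\<omega> in M. \<forall>\<gamma><n. tree_branch \<eta> N \<tau> B \<gamma> T \<omega> - c * T > u)))
    \<longlongrightarrow> 1) at_top"
proof -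
  let ?H = "H_const M' W n (1 / \<mu>)"
  have H: "?H \<ge> 1" by (rule H_ge_1)
  note ld = limit_density_pos
  have "((\<lambda>u. \<Sum>i\<in>{0..\<eta>}. prob (out_event c u i) * norming c u) \<longlongrightarrow> (\<Sum>i\<in>{0..\<eta>}. 0)) at_top"
    by (intro tendsto_sum out_event_limit) auto
  from tendsto_add[OF win_limit this]
  have up: "((\<lambda>u. prob (win c u) * norming c u + (\<Sum>i\<in>{0..\<eta>}. prob (out_event c u i) * norming c u)) \<longlongrightarrow> limit_density * ?H) at_top"
    by simp
  have tree: "((\<lambda>u. prob (tree_event c u) * norming c u) \<longlongrightarrow> limit_density * ?H) at_top"
  proof (rule tendsto_sandwich[OF _ _ win_limit up])
    have nn: "norming c u \<ge> 0" if "good c u" for u using goodD(4)[OF that] by simp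
    show "\<forall>\<^sub>F u in at_top. prob (win c u) * norming c u \<le> prob (tree_event c u) * norming c u"
      by (rule eventually_mono[OF eventually_good[of c]]) (intro mult_right_mono tree_event_lower nn)
    show "\<forall>\<^sub>F u in at_top. prob (tree_event c u) * norming c u \<le> prob (win c u) * norming c u + (\<Sum>i\<in>{0..\<eta>}. prob (out_event c u i) * norming c u)"
    proof (rule eventually_mono[OF eventually_good[of c]])
      fix u assume g: "good c u"
      have "prob (tree_event c u) * norming c u \<le> (prob (win c u) + (\<Sum>i\<in>{0..\<eta>}. prob (out_event c u i))) * norming c u"
        by (rule mult_right_mono[OF tree_event_upper[OF g] nn[OF g]])
      then show "prob (tree_event c u) * norming c u \<le> prob (win c u) * norming c u + (\<Sum>i\<in>{0..\<eta>}. prob (out_event c u i) * norming c u)"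
        by (simp only: distrib_right sum_distrib_right)
    qed
  qed
  have lim: "((\<lambda>u. (prob (tree_event c u) * norming c u) / (?H * (prob (end_event c u) * norming c u))) \<longlongrightarrow> limit_density * ?H / (?H * limit_density)) at_top"
    by (intro tendsto_divide tree tendsto_mult tendsto_const end_limit) (use H ld in auto)
  have one: "limit_density * ?H / (?H * limit_density) = 1" using H ld by simp
  have ev: "\<forall>\<^sub>F u in at_top. (prob (tree_event c u) * norming c u) / (?H * (prob (end_event c u) * norming c u)) = prob (tree_event c u) / (?H * prob (end_event c u))"
  proof (rule eventually_mono[OF eventually_good[of c]])
    fix u assume g: "good c u"
    have nz: "norming c u \<noteq> 0" using goodD(4)[OF g] by simp
    have cancel: "(a * x) / (h * (d * x)) = a / (h * d)" if "x \<noteq> 0" for a h d x :: real using that by simp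
    show "(prob (tree_event c u) * norming c u) / (?H * (prob (end_event c u) * norming c u)) = prob (tree_event c u) / (?H * prob (end_event c u))"
      by (rule cancel[OF nz])
  qed
  show ?thesis
    unfolding tree_end_event \<mu>\<^sub>0_incoming_var by (rule Lim_transform_eventually[OF lim[unfolded one] ev])
qed

end

theorem theorem3p4:
  fixes M :: "'a measure" and B :: "nat \<Rightarrow> nat \<Rightarrow> real \<Rightarrow> 'a \<Rightarrow> real"
    and M' :: "'b measure" and W :: "nat \<Rightarrow> real \<Rightarrow> 'b \<Rightarrow> real"
    and \<eta> :: nat and N :: "nat \<Rightarrow> nat" and \<tau> :: "nat \<Rightarrow> real" and T c :: real
  assumes "T > 0" and "\<eta> \<ge> 1"
    and "\<tau> 0 = 0" and "strict_mono_on {0..\<eta>} \<tau>" and "\<tau> \<eta> < T"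
    and "\<And>j. j \<in> {1..\<eta>} \<Longrightarrow> N j \<ge> 1"
    and "indep_brownian_motions M (SIGMA i:{0..\<eta>}. {..<offspring_prod N i}) (\<lambda>(i, k). B i k)"
    and "indep_brownian_motions M' {..<offspring_prod N \<eta>} W"
  shows "((\<lambda>u. \<P>(\<omega> in M. \<exists>t\<in>{0..T}. \<forall>\<gamma><offspring_prod N \<eta>.
                     tree_branch \<eta> N \<tau> B \<gamma> t \<omega> - c * t > u)
             / (H_const M' W (offspring_prod N \<eta>) (1 / \<mu>\<^sub>0 \<eta> N \<tau> T)
                * \<P>(\<omega> in M. \<forall>\<gamma><offspring_prod N \<eta>.
                       tree_branch \<eta> N \<tau> B \<gamma> T \<omega> - c * T > u)))
         \<longlongrightarrow> 1) at_top"
proof -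
  have "N j > 0" if "j \<in> {1..\<eta>}" for j using assms(6)[OF that] by simp
  then have "offspring_prod N \<eta> > 0" by (simp add: offspring_prod_def prod_pos)
  then interpret tree_and_vector M B \<eta> N \<tau> T M' W
    by unfold_locales (use assms in auto)
  show ?thesis by (rule tree_asymptotics)
qed

end
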